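(* Let $J$ be a kernel on $\mathbb{R}^N$ such that $$\gamma_0:=\sup\Big\{\gamma>0:\int_{\mathbb{R}^N}J(y)|y|^\gamma\,dy<\infty\Big\}\in(0,\infty).$$ For any integer $p\geq 1$ with $2p\in(0,\gamma_0)$, the unique solution of $u_t=J\ast u-u$ in $\mathbb{R}^N\times(0,\infty)$ with initial data $u_0(x)=|x|^{2p}$ has the explicit form $$u(x,t)=|x|^{2p}+\sum_{k=1}^p c_k(x)\frac{t^k}{k},$$ where $c_1(x)=(J\ast|x|^{2p})(x)-|x|^{2p}$ and, for $2\le k\le p$, $$c_k(x)=\frac{1}{k-1}\big((J\ast c_{k-1})(x)-c_{k-1}(x)\big).$$
   Context: A kernel is a nonnegative symmetric continuous function $J:\mathbb{R}^N\to\mathbb{R}$ with $\int_{\mathbb{R}^N}J=1$; $\ast$ is convolution in the space variable. "Solution" means strong solution: $u\in C^0([0,\infty);L^1_{\rm loc}(\mathbb{R}^N))$ such that $u_t,J\ast u\in L^1_{\rm loc}(\mathbb{R}^N\times(0,\infty))$, the equation is satisfied in the $L^1_{\rm loc}$-sense, and $u(x,0)=u_0(x)$ almost everywhere. "Unique" means unique in the class of solutions such that, for some $\gamma\in(0,\gamma_0)$, $|u|\ll 1+|x|^\gamma$ locally uniformly in $[0,\infty)$, i.e. $|u(x,t)|\le C(t)\epsilon(x)(1+|x|^\gamma)$ with $C\in L^\infty_{\rm loc}([0,\infty))$ and $\epsilon(x)\to0$ as $|x|\to\infty$. *)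

theory Defs
  imports "HOL-Analysis.Analysis"
begin

text \<open>Space is \<open>real ^ 'n\<close>; space-time functions take a pair \<open>(x, t)\<close>. All measure-theoretic
  notions refer to the (complete) Lebesgue measure.\<close>

definition kernel :: "(real ^ 'n \<Rightarrow> real) \<Rightarrow> bool" where
  "kernel J \<longleftrightarrow> continuous_on UNIV J \<and> (\<forall>x. 0 \<le> J x) \<and> (\<forall>x. J (- x) = J x)
     \<and> has_bochner_integral lebesgue J 1"

definition moment_exponent :: "(real ^ 'n \<Rightarrow> real) \<Rightarrow> ereal" where
  "moment_exponent J =
     Sup (ereal ` {\<gamma>. 0 < \<gamma> \<and> (\<integral>\<^sup>+ y. ennreal (J y * norm y powr \<gamma>) \<partial>lebesgue) < \<infinity>})"

text \<open>The Bochner integral of a non-integrable function is \<open>0\<close>, so convergence of a convolution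
  integral is a separate predicate.\<close>

definition convolves_at :: "(real ^ 'n \<Rightarrow> real) \<Rightarrow> (real ^ 'n \<Rightarrow> real) \<Rightarrow> real ^ 'n \<Rightarrow> bool" where
  "convolves_at J f x \<longleftrightarrow> integrable lebesgue (\<lambda>y. J (x - y) * f y)"

definition conv :: "(real ^ 'n \<Rightarrow> real) \<Rightarrow> (real ^ 'n \<Rightarrow> real) \<Rightarrow> real ^ 'n \<Rightarrow> real" where
  "conv J f x = (LINT y|lebesgue. J (x - y) * f y)"

definition locally_integrable_on :: "('a::euclidean_space \<Rightarrow> real) \<Rightarrow> 'a set \<Rightarrow> bool"
    (infix \<open>locally'_integrable'_on\<close> 46) where
  "f locally_integrable_on \<Omega> \<longleftrightarrow> (\<forall>K. compact K \<and> K \<subseteq> \<Omega> \<longrightarrow> f absolutely_integrable_on K)"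

definition spacetime :: "((real ^ 'n) \<times> real) set" where
  "spacetime = UNIV \<times> {0<..}"

definition continuous_L1_loc :: "((real ^ 'n) \<times> real \<Rightarrow> real) \<Rightarrow> bool" where
  "continuous_L1_loc u \<longleftrightarrow>
     (\<forall>t\<ge>0. (\<lambda>x. u (x, t)) locally_integrable_on UNIV) \<and>
     (\<forall>K. compact K \<longrightarrow> (\<forall>t\<ge>0.
        ((\<lambda>s. LINT x:K|lebesgue. \<bar>u (x, s) - u (x, t)\<bar>) \<longlongrightarrow> 0) (at t within {0..})))"

primrec k_smooth :: "nat \<Rightarrow> ('a::euclidean_space \<Rightarrow> real) \<Rightarrow> bool" where
  "k_smooth 0 f \<longleftrightarrow> continuous_on UNIV f"
| "k_smooth (Suc k) f \<longleftrightarrow> (\<forall>z. f differentiable (at z)) \<and>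
     (\<forall>b\<in>Basis. k_smooth k (\<lambda>z. frechet_derivative f (at z) b))"

definition test_function_on :: "'a::euclidean_space set \<Rightarrow> ('a \<Rightarrow> real) \<Rightarrow> bool" where
  "test_function_on \<Omega> \<phi> \<longleftrightarrow> (\<forall>k. k_smooth k \<phi>) \<and>
     compact (closure {z. \<phi> z \<noteq> 0}) \<and> closure {z. \<phi> z \<noteq> 0} \<subseteq> \<Omega>"

text \<open>\<open>v\<close> is the distributional time derivative of \<open>u\<close>; \<open>(0, 1)\<close> is the time direction.\<close>

definition weak_time_derivative ::
    "((real ^ 'n) \<times> real \<Rightarrow> real) \<Rightarrow> ((real ^ 'n) \<times> real \<Rightarrow> real) \<Rightarrow> bool" where
  "weak_time_derivative u v \<longleftrightarrow>
     u locally_integrable_on spacetime \<and> v locally_integrable_on spacetime \<and>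
     (\<forall>\<phi>. test_function_on spacetime \<phi> \<longrightarrow>
        (LINT z|lebesgue. u z * frechet_derivative \<phi> (at z) (0, 1)) =
        - (LINT z|lebesgue. v z * \<phi> z))"

text \<open>Strong solutions of \<open>u\<^sub>t = J * u - u\<close> with initial datum \<open>u0\<close>. The values of \<open>u\<close> at negative
  times are irrelevant.\<close>

definition strong_solution ::
    "(real ^ 'n \<Rightarrow> real) \<Rightarrow> (real ^ 'n \<Rightarrow> real) \<Rightarrow> ((real ^ 'n) \<times> real \<Rightarrow> real) \<Rightarrow> bool" where
  "strong_solution J u0 u \<longleftrightarrow>
     continuous_L1_loc u \<and>
     (AE (x, t) in lebesgue. 0 < t \<longrightarrow> convolves_at J (\<lambda>y. u (y, t)) x) \<and>
     (\<lambda>(x, t). conv J (\<lambda>y. u (y, t)) x) locally_integrable_on spacetime \<and>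
     (\<exists>ut. weak_time_derivative u ut \<and>
        (AE (x, t) in lebesgue. 0 < t \<longrightarrow>
           ut (x, t) = conv J (\<lambda>y. u (y, t)) x - u (x, t))) \<and>
     (AE x in lebesgue. u (x, 0) = u0 x)"

definition L_infinity_loc :: "(real \<Rightarrow> real) \<Rightarrow> bool" where
  "L_infinity_loc C \<longleftrightarrow> set_borel_measurable lebesgue {0..} C \<and>
     (\<forall>T\<ge>0. \<exists>M. AE t in lebesgue. t \<in> {0..T} \<longrightarrow> \<bar>C t\<bar> \<le> M)"

text \<open>\<open>|u| \<lless> 1 + |x|\<^sup>\<gamma>\<close> locally uniformly in \<open>[0, \<infinity>)\<close>. As \<open>u (\<cdot>, t)\<close> stands for a class in
  \<open>L\<^sup>1\<^sub>l\<^sub>o\<^sub>c\<close>, the bound is required for almost every \<open>x\<close>.\<close>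

definition growth_below :: "real \<Rightarrow> ((real ^ 'n) \<times> real \<Rightarrow> real) \<Rightarrow> bool" where
  "growth_below \<gamma> u \<longleftrightarrow> (\<exists>C \<epsilon>. L_infinity_loc C \<and> (\<epsilon> \<longlongrightarrow> 0) at_infinity \<and>
     (\<forall>t\<ge>0. AE x in lebesgue. \<bar>u (x, t)\<bar> \<le> C t * \<epsilon> x * (1 + norm x powr \<gamma>)))"

definition uniqueness_class :: "(real ^ 'n \<Rightarrow> real) \<Rightarrow> ((real ^ 'n) \<times> real \<Rightarrow> real) \<Rightarrow> bool" where
  "uniqueness_class J u \<longleftrightarrow> (\<exists>\<gamma>. 0 < \<gamma> \<and> ereal \<gamma> < moment_exponent J \<and> growth_below \<gamma> u)"

text \<open>Uniqueness is equality of \<open>L\<^sup>1\<^sub>l\<^sub>o\<^sub>c\<close> classes at every time.\<close>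

definition is_unique_solution ::
    "(real ^ 'n \<Rightarrow> real) \<Rightarrow> (real ^ 'n \<Rightarrow> real) \<Rightarrow> ((real ^ 'n) \<times> real \<Rightarrow> real) \<Rightarrow> bool" where
  "is_unique_solution J u0 u \<longleftrightarrow>
     strong_solution J u0 u \<and> uniqueness_class J u \<and>
     (\<forall>w. strong_solution J u0 w \<and> uniqueness_class J w \<longrightarrow>
        (\<forall>t\<ge>0. AE x in lebesgue. w (x, t) = u (x, t)))"

end

theory Submission
  imports Defs
begin

text \<open>
  Write \<open>L f = J * f - f\<close>.

  \<^emph>\<open>Existence.\<close> The solution ought to be \<open>exp (t L) u\<^sub>0 = (\<Sum>k. t\<^sup>k / k! L\<^sup>k u\<^sub>0)\<close>, and \<open>c k = L\<^sup>k u\<^sub>0 / (k - 1)!\<close>, so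
  the formula says that this series stops at \<open>k = p\<close>. It does, because \<open>J\<close> is even: odd moments of \<open>J\<close>
  vanish, and therefore \<open>L\<close> lowers the degree of a polynomial by two (\<open>pdl_conv_even\<close>). Only moments of
  order at most \<open>2 p\<close> occur, and these are finite. The sum is a polynomial in \<open>t\<close> whose coefficients are
  polynomials in \<open>x\<close>; it solves the equation classically (\<open>u_equation\<close>), hence weakly.

  \<^emph>\<open>Uniqueness.\<close> Let \<open>v\<close> be the difference of two solutions. The idea is that \<open>L\<close> is a bounded operator on a
  suitable weighted space that contains \<open>v\<close>, so that Gronwall's argument applies. A supremum norm
  with weight \<open>1 + |x|\<^sup>\<gamma>\<close> is not suitable: the growth condition restricts \<open>v\<close> only near infinity, locally \<open>v\<close> is just
  integrable in \<open>x\<close>, and a kernel need not be bounded. A weighted \<open>L\<^sup>1\<close> norm does work. There is a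
  bounded weight \<open>\<rho>\<close>, at least \<open>1\<close> on any prescribed ball and integrable against \<open>(1 + |x|)\<^sup>\<gamma>\<close>, with \<open>J * \<rho> \<le> C \<rho>\<close>
  (\<open>supersolution_weight\<close>); by duality \<open>L\<close> is bounded for the norm with weight \<open>\<rho>\<close>
  (\<open>generator_weighted_bound\<close>). The norm \<open>\<Phi> t\<close> of \<open>v(\<cdot>, t)\<close> is then finite and satisfies
  \<open>\<Phi> t \<le> (C + 1) \<integral>\<^sub>0\<^sup>t \<Phi>\<close>, which forces \<open>\<Phi> = 0\<close> (\<open>volterra_iteration\<close>).

  That integral inequality comes from the distributional equation by testing with smooth cutoffs of
  space-time boxes (\<open>integrated_weak_derivative\<close>), which yields the equation integrated in time for
  almost every \<open>x\<close> (\<open>mild_formulation\<close>); the strong continuity at time \<open>0\<close> brings in the initial datum.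
\<close>

section \<open>Smooth functions\<close>

text \<open>
  For \<open>q = 1\<close> this is the standard flat function \<open>exp (- 1 / x)\<close>. The polynomial factor in \<open>1 / x\<close>
  makes the family closed under differentiation, so that smoothness follows by a single induction.
\<close>

definition flat_exp :: "real poly \<Rightarrow> real \<Rightarrow> real" where
  "flat_exp q x = (if x \<le> 0 then 0 else poly q (1 / x) * exp (- (1 / x)))"

text \<open>
  The chain rule in the variable \<open>1 / x\<close> gives the factor \<open>X\<^sup>2 (q - q')\<close>.
\<close>

definition flat_exp_deriv :: "real poly \<Rightarrow> real poly" where
  "flat_exp_deriv q = [:0, 0, 1:] * (q - pderiv q)"

lemma poly_times_exp_tendsto_0: "((\<lambda>y::real. poly q y * exp (- y)) \<longlongrightarrow> 0) at_top"
proof -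
  have "((\<lambda>y::real. \<Sum>i\<le>degree q. coeff q i * (y ^ i / exp y)) \<longlongrightarrow> (\<Sum>i\<le>degree q. coeff q i * 0)) at_top"
    by (intro tendsto_sum tendsto_mult tendsto_const tendsto_power_div_exp_0)
  moreover have "(\<lambda>y::real. \<Sum>i\<le>degree q. coeff q i * (y ^ i / exp y)) = (\<lambda>y. poly q y * exp (- y))"
    by (auto simp: poly_altdef sum_distrib_right exp_minus field_simps sum_divide_distrib)
  ultimately show ?thesis by simp
qed

text \<open>
  Away from \<open>0\<close> this is the chain rule. At \<open>0\<close> the right difference quotient is
  \<open>y q(y) exp (- y)\<close> with \<open>y = 1 / h \<longlongrightarrow> \<infinity>\<close>, and the exponential wins over the polynomial.
\<close>

lemma flat_exp_has_derivative:
  "(flat_exp q has_real_derivative flat_exp (flat_exp_deriv q) x) (at x)"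
proof -
  consider "x < 0" | "x = 0" | "x > 0" by linarith
  then show ?thesis
  proof cases
    case 1
    have "((\<lambda>_. 0) has_real_derivative 0) (at x)" by simp
    then have "(flat_exp q has_real_derivative 0) (at x)"
      by (rule has_field_derivative_transform_within_open[of _ _ _ "{..<0}"])
        (use 1 in \<open>auto simp: flat_exp_def\<close>)
    with 1 show ?thesis by (simp add: flat_exp_def)
  next
    case 3
    have "((\<lambda>x. poly q (1 / x) * exp (- (1 / x))) has_real_derivative
       poly (flat_exp_deriv q) (1 / x) * exp (- (1 / x))) (at x)"
      using 3 by (auto intro!: derivative_eq_intros poly_DERIV
         simp: flat_exp_deriv_def field_simps power2_eq_square)
    then have "(flat_exp q has_real_derivative poly (flat_exp_deriv q) (1 / x) * exp (- (1 / x))) (at x)"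
      by (rule has_field_derivative_transform_within_open[of _ _ _ "{0<..}"])
        (use 3 in \<open>auto simp: flat_exp_def\<close>)
    with 3 show ?thesis by (simp add: flat_exp_def)
  next
    case 2
    have "((\<lambda>h. flat_exp q h / h) \<longlongrightarrow> 0) (at 0)"
    proof (rule filterlim_split_at)
      show "((\<lambda>h. flat_exp q h / h) \<longlongrightarrow> 0) (at_left 0)"
        by (rule Lim_transform_eventually[of "\<lambda>_. 0"])
          (auto simp: flat_exp_def eventually_at_filter)
      have "filterlim (\<lambda>h::real. 1 / h) at_top (at_right 0)"
        using filterlim_inverse_at_top_right by (simp add: inverse_eq_divide)
      with poly_times_exp_tendsto_0[of "[:0, 1:] * q"]
      have "((\<lambda>h::real. poly ([:0, 1:] * q) (1 / h) * exp (- (1 / h))) \<longlongrightarrow> 0) (at_right 0)"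
        by (rule filterlim_compose)
      then show "((\<lambda>h. flat_exp q h / h) \<longlongrightarrow> 0) (at_right 0)"
        by (rule Lim_transform_eventually)
          (auto simp: flat_exp_def eventually_at_filter field_simps)
    qed
    then show ?thesis
      using 2 by (simp add: DERIV_def flat_exp_def)
  qed
qed

text \<open>
  Working with an explicit derivative instead of \<^const>\<open>frechet_derivative\<close> lets the calculus rules
  for \<^const>\<open>has_derivative\<close> be used in the closure properties below.
\<close>

lemma k_smooth_SucI:
  assumes "\<And>z. (f has_derivative f' z) (at z)" "\<And>b. b \<in> Basis \<Longrightarrow> k_smooth k (\<lambda>z. f' z b)"
  shows "k_smooth (Suc k) f"
proof -
  have "frechet_derivative f (at z) = f' z" for z
    using assms(1) by (metis frechet_derivative_at)
  then show ?thesis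
    using assms by (auto simp: differentiable_def)
qed

lemma k_smooth_SucE:
  assumes "k_smooth (Suc k) f"
  obtains f' where "\<And>z. (f has_derivative f' z) (at z)" "\<And>b. b \<in> Basis \<Longrightarrow> k_smooth k (\<lambda>z. f' z b)"
  using assms that[of "\<lambda>z. frechet_derivative f (at z)"] by (simp add: frechet_derivative_works)

lemma k_smooth_continuous: "k_smooth k f \<Longrightarrow> continuous_on UNIV f"
  by (cases k) (auto intro!: differentiable_imp_continuous_on simp: differentiable_on_def)

lemma k_smooth_Suc: "k_smooth (Suc k) f \<Longrightarrow> k_smooth k f"
proof (induction k arbitrary: f)
  case 0
  then show ?case using k_smooth_continuous[OF 0] by simp
next
  case (Suc k)
  show ?case using Suc.prems Suc.IH by (auto simp del: k_smooth.simps simp: k_smooth.simps(2)[of "Suc k" f] k_smooth.simps(2)[of k f])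
qed

lemma k_smooth_const: "k_smooth k (\<lambda>_. c)"
  by (induction k arbitrary: c) auto

lemma k_smooth_bounded_linear:
  assumes "bounded_linear l"
  shows "k_smooth k l"
proof (cases k)
  case 0
  then show ?thesis using assms by (simp add: linear_continuous_on)
next
  case (Suc m)
  show ?thesis unfolding Suc
    by (rule k_smooth_SucI[where f' = "\<lambda>_. l"])
      (auto intro: bounded_linear_imp_has_derivative assms k_smooth_const)
qed

lemma k_smooth_add:
  assumes "k_smooth k f" "k_smooth k g"
  shows "k_smooth k (\<lambda>z. f z + g z)"
  using assms
proof (induction k arbitrary: f g)
  case 0
  then show ?case by (simp add: continuous_on_add)
next
  case (Suc k)
  obtain f' where f': "\<And>z. (f has_derivative f' z) (at z)" "\<And>b. b \<in> Basis \<Longrightarrow> k_smooth k (\<lambda>z. f' z b)"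
    using k_smooth_SucE[OF Suc.prems(1)] by metis
  obtain g' where g': "\<And>z. (g has_derivative g' z) (at z)" "\<And>b. b \<in> Basis \<Longrightarrow> k_smooth k (\<lambda>z. g' z b)"
    using k_smooth_SucE[OF Suc.prems(2)] by metis
  show ?case
    by (rule k_smooth_SucI[where f' = "\<lambda>z h. f' z h + g' z h"])
      (auto intro: has_derivative_add f' g' Suc.IH)
qed

lemma k_smooth_mult:
  assumes "k_smooth k f" "k_smooth k g"
  shows "k_smooth k (\<lambda>z. f z * g z)"
  using assms
proof (induction k arbitrary: f g)
  case 0
  then show ?case by (simp add: continuous_on_mult)
next
  case (Suc k)
  obtain f' where f': "\<And>z. (f has_derivative f' z) (at z)" "\<And>b. b \<in> Basis \<Longrightarrow> k_smooth k (\<lambda>z. f' z b)"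
    using k_smooth_SucE[OF Suc.prems(1)] by metis
  obtain g' where g': "\<And>z. (g has_derivative g' z) (at z)" "\<And>b. b \<in> Basis \<Longrightarrow> k_smooth k (\<lambda>z. g' z b)"
    using k_smooth_SucE[OF Suc.prems(2)] by metis
  have fg: "k_smooth k f" "k_smooth k g" using Suc.prems k_smooth_Suc by auto
  show ?case
    by (rule k_smooth_SucI[where f' = "\<lambda>z h. f z * g' z h + f' z h * g z"])
      (auto intro!: has_derivative_mult f' g' Suc.IH k_smooth_add fg)
qed

lemma k_smooth_diff:
  assumes "k_smooth k f" "k_smooth k g"
  shows "k_smooth k (\<lambda>z. f z - g z)"
  using k_smooth_add[OF assms(1) k_smooth_mult[OF k_smooth_const[of _ "-1"] assms(2)]] by simp

lemma k_smooth_prod: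
  assumes "\<And>i. i \<in> I \<Longrightarrow> k_smooth k (f i)"
  shows "k_smooth k (\<lambda>z. \<Prod>i\<in>I. f i z)"
  using assms
  by (induction I rule: infinite_finite_induct) (auto intro: k_smooth_const k_smooth_mult)

lemma k_smooth_inverse:
  assumes "k_smooth k f" "\<And>z. f z \<noteq> 0"
  shows "k_smooth k (\<lambda>z. inverse (f z))"
  using assms
proof (induction k)
  case 0
  then show ?case by (simp add: continuous_on_inverse)
next
  case (Suc k)
  obtain f' where f': "\<And>z. (f has_derivative f' z) (at z)" "\<And>b. b \<in> Basis \<Longrightarrow> k_smooth k (\<lambda>z. f' z b)"
    using k_smooth_SucE[OF Suc.prems(1)] by metis
  have "k_smooth k (\<lambda>z. inverse (f z))" using Suc k_smooth_Suc by blast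
  then have "k_smooth k (\<lambda>z. (-1) * (inverse (f z) * f' z b * inverse (f z)))" if "b \<in> Basis" for b
    by (intro k_smooth_mult k_smooth_const f' that)
  then show ?case
    by (intro k_smooth_SucI[where f' = "\<lambda>z h. - (inverse (f z) * f' z h * inverse (f z))"])
      (auto intro!: Deriv.has_derivative_inverse f' Suc.prems)
qed

text \<open>
  A derivative of the composition is again a composition of the same kind, with another polynomial,
  times a derivative of \<open>f\<close>; the induction is therefore over all \<open>q\<close> at once.
\<close>

lemma k_smooth_flat_exp:
  assumes "k_smooth k f"
  shows "k_smooth k (\<lambda>z. flat_exp q (f z))"
  using assms
proof (induction k arbitrary: q)
  case 0
  have "continuous_on UNIV (flat_exp q)"
    using flat_exp_has_derivative by (intro DERIV_continuous_on) auto
  then show ?case using 0 continuous_on_compose2 by fastforce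
next
  case (Suc k)
  obtain f' where f': "\<And>z. (f has_derivative f' z) (at z)" "\<And>b. b \<in> Basis \<Longrightarrow> k_smooth k (\<lambda>z. f' z b)"
    using k_smooth_SucE[OF Suc.prems(1)] by metis
  have "k_smooth k f" using Suc.prems k_smooth_Suc by auto
  then show ?case
    using has_derivative_compose[OF f'(1) flat_exp_has_derivative[unfolded has_field_derivative_def]]
    by (intro k_smooth_SucI[where f' = "\<lambda>z h. flat_exp (flat_exp_deriv q) (f z) * f' z h"])
      (auto intro!: k_smooth_mult f' Suc.IH)
qed

lemma flat_exp_1: "flat_exp 1 x = (if x \<le> 0 then 0 else exp (- (1 / x)))"
  by (simp add: flat_exp_def)

section \<open>Moments and convolutions\<close>

lemma kernel_borel: "kernel J \<Longrightarrow> J \<in> borel_measurable borel"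
  by (simp add: kernel_def borel_measurable_continuous_onI)

lemma kernel_nonneg: "kernel J \<Longrightarrow> 0 \<le> J x"
  and kernel_even: "kernel J \<Longrightarrow> J (- x) = J x"
  by (simp_all add: kernel_def)

lemma kernel_integrable: "kernel J \<Longrightarrow> integrable lborel J"
  and kernel_integral: "kernel J \<Longrightarrow> integral\<^sup>L lborel J = 1"
proof -
  assume J: "kernel J"
  then have "integrable lebesgue J" "integral\<^sup>L lebesgue J = 1"
    by (auto simp: kernel_def has_bochner_integral_iff)
  moreover have "J \<in> borel_measurable lborel" using kernel_borel[OF J] by simp
  ultimately show "integrable lborel J" "integral\<^sup>L lborel J = 1"
    using integrable_completion integral_completion by metis+
qed

text \<open>
  Moments are measured with \<open>(1 + |y|)\<^sup>\<gamma>\<close> rather than \<open>|y|\<^sup>\<gamma>\<close> because \<open>1 + |x - y| \<le> (1 + |x|) (1 + |y|)\<close>: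
  this weight behaves multiplicatively under convolution.
\<close>

lemma kernel_weight_integrable:
  assumes J: "kernel J" and \<gamma>: "0 \<le> \<gamma>" "ereal \<gamma> < moment_exponent J"
  shows "integrable lborel (\<lambda>y. J y * (1 + norm y) powr \<gamma>)"
proof -
  obtain \<delta> where \<delta>: "\<gamma> < \<delta>" "0 < \<delta>" "(\<integral>\<^sup>+ y. ennreal (J y * norm y powr \<delta>) \<partial>lebesgue) < \<infinity>"
    using \<gamma>(2) by (auto simp: moment_exponent_def less_Sup_iff)
  note [measurable] = kernel_borel[OF J]
  have int: "integrable lborel (\<lambda>y. J y * norm y powr \<delta>)"
    using \<delta>(3) by (intro integrableI_nonneg) (auto simp: nn_integral_completion kernel_nonneg[OF J])
  have "integrable lborel (\<lambda>y. 2 powr \<delta> * (J y + J y * norm y powr \<delta>))"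
    by (intro integrable_mult_right Bochner_Integration.integrable_add int kernel_integrable J)
  then show ?thesis
  proof (rule Bochner_Integration.integrable_bound)
    have "(1 + norm y) powr \<gamma> \<le> 2 powr \<delta> * (1 + norm y powr \<delta>)" for y :: "real ^ 'a"
    proof -
      have "(1 + norm y) powr \<gamma> \<le> (1 + norm y) powr \<delta>"
        using \<delta> by (intro powr_mono) auto
      also have "\<dots> \<le> (2 * max 1 (norm y)) powr \<delta>"
        using \<delta> by (intro powr_mono2) auto
      also have "\<dots> = 2 powr \<delta> * max 1 (norm y) powr \<delta>"
        by (simp add: powr_mult)
      also have "\<dots> \<le> 2 powr \<delta> * (1 + norm y powr \<delta>)"
        by (intro mult_left_mono) (auto simp: max_def)
      finally show ?thesis .
    qed
    from mult_left_mono[OF this kernel_nonneg[OF J]]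
    show "AE y in lborel. norm (J y * (1 + norm y) powr \<gamma>) \<le> norm (2 powr \<delta> * (J y + J y * norm y powr \<delta>))"
      by (auto simp: abs_mult kernel_nonneg[OF J] algebra_simps)
  qed simp
qed

lemma lborel_reflect: "distr lborel borel (\<lambda>y. x - y) = (lborel :: 'a::euclidean_space measure)"
  by (subst (2) lborel_affine[of "-1" x]) (auto simp: density_1)

text \<open>
  Reflecting the integration variable turns the kernel into a fixed density \<open>J y\<close>, and for Borel
  integrands the completion of the measure is immaterial.
\<close>

lemma conv_lborel:
  assumes J: "kernel J" and f[measurable]: "f \<in> borel_measurable borel"
  shows "convolves_at J f x \<longleftrightarrow> integrable lborel (\<lambda>y. J y * f (x - y))"
    and "conv J f x = (LINT y|lborel. J y * f (x - y))"
proof -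
  note [measurable] = kernel_borel[OF J]
  have "convolves_at J f x \<longleftrightarrow> integrable (distr lborel borel (\<lambda>y. x - y)) (\<lambda>y. J (x - y) * f y)"
    unfolding lborel_reflect convolves_at_def by (intro integrable_completion) simp
  also have "\<dots> \<longleftrightarrow> integrable lborel (\<lambda>y. J y * f (x - y))"
    by (subst integrable_distr_eq) auto
  finally show "convolves_at J f x \<longleftrightarrow> integrable lborel (\<lambda>y. J y * f (x - y))" .
  have "conv J f x = (LINT y|distr lborel borel (\<lambda>y. x - y). J (x - y) * f y)"
    unfolding lborel_reflect conv_def by (intro integral_completion) simp
  also have "\<dots> = (LINT y|lborel. J y * f (x - y))"
    by (subst integral_distr) auto
  finally show "conv J f x = (LINT y|lborel. J y * f (x - y))" .
qed

section \<open>Convolution of polynomials\<close>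

text \<open>
  Polynomial functions of degree less than \<open>n\<close>. With the strict bound, \<open>n = 0\<close> describes the zero
  function alone, so that truncated subtraction \<open>n - 2\<close> says "the degree drops by two" correctly
  for constant and linear polynomials too.
\<close>

inductive poly_deg_less :: "nat \<Rightarrow> (real ^ 'n \<Rightarrow> real) \<Rightarrow> bool" where
  pdl_zero: "poly_deg_less n (\<lambda>_. 0)"
| pdl_const: "poly_deg_less (Suc n) (\<lambda>_. c)"
| pdl_coord: "poly_deg_less n f \<Longrightarrow> poly_deg_less (Suc n) (\<lambda>x. x $ i * f x)"
| pdl_add: "poly_deg_less n f \<Longrightarrow> poly_deg_less n g \<Longrightarrow> poly_deg_less n (\<lambda>x. f x + g x)"

lemma pdl_0D: "poly_deg_less n f \<Longrightarrow> n = 0 \<Longrightarrow> f x = 0"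
  by (induction rule: poly_deg_less.induct) auto

lemma pdl_scale: "poly_deg_less n f \<Longrightarrow> poly_deg_less n (\<lambda>x. c * f x)"
proof (induction rule: poly_deg_less.induct)
  case (pdl_coord n f i)
  then show ?case using poly_deg_less.pdl_coord[of n "\<lambda>x. c * f x" i] by (simp add: mult.left_commute)
qed (auto simp: algebra_simps intro: poly_deg_less.intros)

lemma pdl_diff: "poly_deg_less n f \<Longrightarrow> poly_deg_less n g \<Longrightarrow> poly_deg_less n (\<lambda>x. f x - g x)"
  using pdl_add[OF _ pdl_scale[of n g "-1"]] by simp

lemma pdl_Suc: "poly_deg_less n f \<Longrightarrow> poly_deg_less (Suc n) f"
  by (induction rule: poly_deg_less.induct) (auto intro: poly_deg_less.intros)

lemma pdl_mono: "poly_deg_less n f \<Longrightarrow> n \<le> m \<Longrightarrow> poly_deg_less m f"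
  by (induction m) (auto intro: pdl_Suc simp: le_Suc_eq)

lemma pdl_sum: "(\<And>i. i \<in> I \<Longrightarrow> poly_deg_less n (f i)) \<Longrightarrow> poly_deg_less n (\<lambda>x. \<Sum>i\<in>I. f i x)"
  by (induction I rule: infinite_finite_induct) (auto intro: poly_deg_less.intros)

lemma pdl_norm_sq:
  assumes "poly_deg_less n f"
  shows "poly_deg_less (Suc (Suc n)) (\<lambda>x. (norm x)\<^sup>2 * f x)"
proof -
  have "(norm x)\<^sup>2 * f x = (\<Sum>i\<in>UNIV. x $ i * (x $ i * f x))" for x
    unfolding dot_square_norm[symmetric] inner_vec_def
    by (simp add: sum_distrib_right power2_eq_square mult.assoc)
  then show ?thesis
    using assms by (auto intro!: pdl_sum pdl_coord)
qed

lemma pdl_norm_power: "poly_deg_less (2 * p + 1) (\<lambda>x. norm x ^ (2 * p))"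
proof (induction p)
  case 0
  then show ?case using pdl_const[of 0 1] by simp
next
  case (Suc p)
  from pdl_norm_sq[OF this] show ?case
    by (simp add: power_add[symmetric] power2_eq_square mult.assoc)
qed

lemma pdl_continuous: "poly_deg_less n f \<Longrightarrow> continuous_on A f"
  by (induction rule: poly_deg_less.induct) (auto intro!: continuous_intros)

lemma pdl_borel: "poly_deg_less n f \<Longrightarrow> f \<in> borel_measurable borel"
  using pdl_continuous borel_measurable_continuous_onI by blast

lemma pdl_growth:
  assumes "poly_deg_less (Suc d) f"
  shows "\<exists>C\<ge>0. \<forall>x. \<bar>f x\<bar> \<le> C * (1 + norm x) ^ d"
proof -
  have "\<exists>C\<ge>0. \<forall>x. \<bar>f x\<bar> \<le> C * (1 + norm x) ^ (n - 1)" if "poly_deg_less n f" for n and f :: "real ^ 'a \<Rightarrow> real"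
    using that
  proof (induction rule: poly_deg_less.induct)
    case (pdl_zero n)
    show ?case by (auto intro: exI[of _ 0])
  next
    case (pdl_const n c)
    have "\<bar>c\<bar> \<le> \<bar>c\<bar> * (1 + norm x) ^ n" for x :: "real ^ 'a"
      using mult_left_mono[of 1 "(1 + norm x) ^ n" "\<bar>c\<bar>"] by simp
    then show ?case by (intro exI[of _ "\<bar>c\<bar>"]) auto
  next
    case (pdl_coord n f i)
    then obtain C where C: "C \<ge> 0" "\<And>x. \<bar>f x\<bar> \<le> C * (1 + norm x) ^ (n - 1)" by auto
    show ?case
    proof (cases n)
      case 0
      then show ?thesis using pdl_0D[OF pdl_coord.hyps] by (auto intro: exI[of _ 0])
    next
      case (Suc m)
      have "\<bar>x $ i * f x\<bar> \<le> (1 + norm x) * (C * (1 + norm x) ^ m)" for x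
        unfolding abs_mult using C(2)[of x] component_le_norm_cart[of x i] Suc
        by (intro mult_mono) auto
      then show ?thesis using C(1) Suc by (intro exI[of _ C]) (auto simp: mult_ac)
    qed
  next
    case (pdl_add n f g)
    then obtain C D where C: "C \<ge> 0" "\<And>x. \<bar>f x\<bar> \<le> C * (1 + norm x) ^ (n - 1)"
      and D: "D \<ge> 0" "\<And>x. \<bar>g x\<bar> \<le> D * (1 + norm x) ^ (n - 1)" by auto
    have "\<bar>f x + g x\<bar> \<le> (C + D) * (1 + norm x) ^ (n - 1)" for x
      using C(2)[of x] D(2)[of x] by (simp add: distrib_right)
    then show ?case using C(1) D(1) by (intro exI[of _ "C + D"]) auto
  qed
  from this[OF assms] show ?thesis by simp
qed

lemma one_plus_norm_diff_le: "1 + norm (x - y) \<le> (1 + norm x) * (1 + norm (y :: 'a::real_normed_vector))"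
proof -
  have "norm (x - y) \<le> norm x + norm y" by (rule norm_triangle_ineq4)
  moreover have "0 \<le> norm x * norm y" by simp
  ultimately show ?thesis by (simp only: distrib_left distrib_right mult_1 mult_1_right)
qed

lemma pdl_conv_integrable:
  assumes f: "poly_deg_less n f" and k[measurable]: "k \<in> borel_measurable borel"
    and int: "\<And>j. j < n \<Longrightarrow> integrable lborel (\<lambda>y. k y * (1 + norm y) ^ j)"
  shows "integrable lborel (\<lambda>y. k y * f (x - y))"
proof (cases n)
  case 0
  then show ?thesis using pdl_0D[OF f] by simp
next
  case (Suc d)
  note [measurable] = pdl_borel[OF f]
  obtain C where C: "C \<ge> 0" "\<And>x. \<bar>f x\<bar> \<le> C * (1 + norm x) ^ d"
    using pdl_growth f Suc by blast
  have "integrable lborel (\<lambda>y. C * (1 + norm x) ^ d * (k y * (1 + norm y) ^ d))"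
    using int Suc by (intro integrable_mult_right) auto
  then show ?thesis
  proof (rule Bochner_Integration.integrable_bound)
    have "\<bar>k y * f (x - y)\<bar> \<le> \<bar>k y\<bar> * (C * (1 + norm x) ^ d * (1 + norm y) ^ d)" for y
    proof -
      have "\<bar>f (x - y)\<bar> \<le> C * (1 + norm (x - y)) ^ d" by (rule C)
      also have "\<dots> \<le> C * ((1 + norm x) * (1 + norm y)) ^ d"
        using C(1) one_plus_norm_diff_le by (intro mult_left_mono power_mono) auto
      finally show ?thesis
        unfolding abs_mult by (intro mult_left_mono) (auto simp: power_mult_distrib mult_ac)
    qed
    then show "AE y in lborel. norm (k y * f (x - y)) \<le> norm (C * (1 + norm x) ^ d * (k y * (1 + norm y) ^ d))"
      using C(1) by (auto simp: abs_mult mult_ac)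
  qed measurable
qed

text \<open>
  A coordinate factor on the kernel costs one moment. In the inductions below the polynomial loses a
  coordinate at the same time, so the required moments never exceed the degree.
\<close>

lemma coord_moments:
  fixes k :: "real ^ 'n \<Rightarrow> real"
  assumes k[measurable]: "k \<in> borel_measurable borel"
    and int: "\<And>j. j < Suc n \<Longrightarrow> integrable lborel (\<lambda>y. k y * (1 + norm y) ^ j)" and "j < n"
  shows "integrable lborel (\<lambda>y. (y $ i * k y) * (1 + norm y) ^ j)"
proof -
  have "integrable lborel (\<lambda>y. k y * (1 + norm y) ^ Suc j)" using assms(3) by (intro int) auto
  then show ?thesis
  proof (rule Bochner_Integration.integrable_bound)
    have "\<bar>y $ i\<bar> \<le> 1 + norm y" for y using component_le_norm_cart[of y i] by simp
    then show "AE y in lborel. norm (y $ i * k y * (1 + norm y) ^ j) \<le> norm (k y * (1 + norm y) ^ Suc j)"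
      by (auto simp: abs_mult mult.assoc mult.left_commute intro!: mult_mono)
  qed measurable
qed

text \<open>
  Since \<open>(x - y)\<^sub>i = x\<^sub>i - y\<^sub>i\<close>, a coordinate of the polynomial can be traded for a coordinate of the kernel.
  The three inductions below rest on this, and it is why they allow kernels \<open>k\<close> of either sign and parity.
\<close>

lemma conv_coord:
  fixes k :: "real ^ 'n \<Rightarrow> real"
  assumes "poly_deg_less n f" "k \<in> borel_measurable borel"
    and int: "\<And>j. j < Suc n \<Longrightarrow> integrable lborel (\<lambda>y. k y * (1 + norm y) ^ j)"
  shows "(LINT y|lborel. k y * ((x - y) $ i * f (x - y))) =
    x $ i * (LINT y|lborel. k y * f (x - y)) - (LINT y|lborel. (y $ i * k y) * f (x - y))"
proof -
  have 1: "integrable lborel (\<lambda>y. k y * f (x - y))"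
    using assms by (intro pdl_conv_integrable[of n]) auto
  have 2: "integrable lborel (\<lambda>y. (y $ i * k y) * f (x - y))"
    using assms coord_moments[OF assms(2) int] by (intro pdl_conv_integrable[of n]) auto
  have "(LINT y|lborel. k y * ((x - y) $ i * f (x - y))) =
      (LINT y|lborel. x $ i * (k y * f (x - y)) - (y $ i * k y) * f (x - y))"
    by (intro Bochner_Integration.integral_cong) (auto simp: algebra_simps)
  also have "\<dots> = (LINT y|lborel. x $ i * (k y * f (x - y))) - (LINT y|lborel. (y $ i * k y) * f (x - y))"
    by (rule Bochner_Integration.integral_diff integrable_mult_right 1 2)+
  finally show ?thesis by simp
qed

lemma pdl_conv:
  fixes k :: "real ^ 'n \<Rightarrow> real"
  assumes "poly_deg_less n f" "k \<in> borel_measurable borel"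
    and "\<And>j. j < n \<Longrightarrow> integrable lborel (\<lambda>y. k y * (1 + norm y) ^ j)"
  shows "poly_deg_less n (\<lambda>x. LINT y|lborel. k y * f (x - y))"
  using assms
proof (induction arbitrary: k rule: poly_deg_less.induct)
  case (pdl_coord n f i)
  have "poly_deg_less n (\<lambda>x. LINT y|lborel. k y * f (x - y))"
    using pdl_coord.prems by (intro pdl_coord.IH) auto
  moreover have "poly_deg_less n (\<lambda>x. LINT y|lborel. (y $ i * k y) * f (x - y))"
    using pdl_coord.prems coord_moments[of k n] by (intro pdl_coord.IH) auto
  ultimately show ?case
    by (subst conv_coord[OF pdl_coord.hyps pdl_coord.prems])
      (auto intro: pdl_diff[OF poly_deg_less.pdl_coord pdl_Suc])
next
  case (pdl_add n f g)
  have "(LINT y|lborel. k y * (f (x - y) + g (x - y))) =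
     (LINT y|lborel. k y * f (x - y)) + (LINT y|lborel. k y * g (x - y))" for x
    unfolding distrib_left
    by (intro Bochner_Integration.integral_add pdl_conv_integrable[of n] pdl_add)
  then show ?case using pdl_add by (auto intro: poly_deg_less.pdl_add)
qed (auto intro: poly_deg_less.intros)

text \<open>
  An odd kernel has integral \<open>0\<close>, so constants are mapped to \<open>0\<close>; trading coordinates propagates the loss of
  one degree to all polynomials.
\<close>

lemma pdl_conv_odd:
  fixes k :: "real ^ 'n \<Rightarrow> real"
  assumes "poly_deg_less n f" "k \<in> borel_measurable borel" "\<And>y. k (- y) = - k y"
    and "\<And>j. j < n \<Longrightarrow> integrable lborel (\<lambda>y. k y * (1 + norm y) ^ j)"
  shows "poly_deg_less (n - 1) (\<lambda>x. LINT y|lborel. k y * f (x - y))"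
  using assms
proof (induction arbitrary: k rule: poly_deg_less.induct)
  case (pdl_const n c)
  note [measurable] = pdl_const(1)
  have "(LINT y|lborel. k y) = (LINT y|distr lborel borel (\<lambda>y. 0 - y). k y)"
    by (simp only: lborel_reflect)
  also have "\<dots> = (LINT y|lborel. k (- y))"
    by (subst integral_distr) auto
  finally have "(LINT y|lborel. k y) = 0" using pdl_const(2) by simp
  then show ?case by (auto intro: poly_deg_less.intros)
next
  case (pdl_coord n f i)
  have 1: "poly_deg_less (n - 1) (\<lambda>x. LINT y|lborel. k y * f (x - y))"
    using pdl_coord.prems by (intro pdl_coord.IH) auto
  have "poly_deg_less n (\<lambda>x. x $ i * (LINT y|lborel. k y * f (x - y)))"
  proof (cases n)
    case 0
    then show ?thesis using pdl_0D[OF pdl_coord.hyps] by (simp add: pdl_zero)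
  next
    case (Suc m)
    then show ?thesis using poly_deg_less.pdl_coord[OF 1] by simp
  qed
  moreover have "poly_deg_less n (\<lambda>x. LINT y|lborel. (y $ i * k y) * f (x - y))"
    using pdl_coord.prems coord_moments[of k n] by (intro pdl_conv pdl_coord.hyps) auto
  ultimately show ?case
    by (subst conv_coord[OF pdl_coord.hyps pdl_coord.prems(1,3)]) (auto intro: pdl_diff)
next
  case (pdl_add n f g)
  have "(LINT y|lborel. k y * (f (x - y) + g (x - y))) =
     (LINT y|lborel. k y * f (x - y)) + (LINT y|lborel. k y * g (x - y))" for x
    unfolding distrib_left
    by (intro Bochner_Integration.integral_add pdl_conv_integrable[of n] pdl_add)
  then show ?case using pdl_add by (auto intro: poly_deg_less.pdl_add)
qed (auto intro: poly_deg_less.intros)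

text \<open>
  For an even kernel, trading a coordinate produces the odd kernel \<open>y\<^sub>i k(y)\<close>, whose convolution has lost one
  degree against \<open>f\<close>, hence two degrees against \<open>x\<^sub>i f\<close>.
\<close>

lemma pdl_conv_even:
  fixes k :: "real ^ 'n \<Rightarrow> real"
  assumes "poly_deg_less n f" "k \<in> borel_measurable borel" "\<And>y. k (- y) = k y" "(LINT y|lborel. k y) = 1"
    and "\<And>j. j < n \<Longrightarrow> integrable lborel (\<lambda>y. k y * (1 + norm y) ^ j)"
  shows "poly_deg_less (n - 2) (\<lambda>x. (LINT y|lborel. k y * f (x - y)) - f x)"
  using assms
proof (induction rule: poly_deg_less.induct)
  case (pdl_coord n f i)
  have 1: "poly_deg_less (n - 2) (\<lambda>x. (LINT y|lborel. k y * f (x - y)) - f x)"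
    using pdl_coord.prems by (intro pdl_coord.IH) auto
  have "poly_deg_less (n - 1) (\<lambda>x. x $ i * ((LINT y|lborel. k y * f (x - y)) - f x))"
  proof (cases "2 \<le> n")
    case False
    then show ?thesis using pdl_0D[OF 1] by (simp add: pdl_zero)
  next
    case True
    then have "Suc (n - 2) = n - 1" by simp
    then show ?thesis using poly_deg_less.pdl_coord[OF 1, of i] by simp
  qed
  moreover have "poly_deg_less (n - 1) (\<lambda>x. LINT y|lborel. (y $ i * k y) * f (x - y))"
    using pdl_coord.prems coord_moments[of k n] by (intro pdl_conv_odd pdl_coord.hyps) auto
  ultimately have "poly_deg_less (n - 1) (\<lambda>x. x $ i * ((LINT y|lborel. k y * f (x - y)) - f x) -
      (LINT y|lborel. (y $ i * k y) * f (x - y)))"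
    by (rule pdl_diff)
  then show ?case
    by (subst conv_coord[OF pdl_coord.hyps pdl_coord.prems(1,4)]) (auto simp: algebra_simps)
next
  case (pdl_add n f g)
  have "(LINT y|lborel. k y * (f (x - y) + g (x - y))) =
     (LINT y|lborel. k y * f (x - y)) + (LINT y|lborel. k y * g (x - y))" for x
    unfolding distrib_left
    by (intro Bochner_Integration.integral_add pdl_conv_integrable[of n] pdl_add)
  then have "(\<lambda>x. (LINT y|lborel. k y * (f (x - y) + g (x - y))) - (f x + g x)) =
     (\<lambda>x. ((LINT y|lborel. k y * f (x - y)) - f x) + ((LINT y|lborel. k y * g (x - y)) - g x))"
    by (simp add: fun_eq_iff)
  then show ?case using pdl_add by (auto intro: poly_deg_less.pdl_add)
qed (auto intro: poly_deg_less.intros)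

section \<open>Weak time derivatives of classical solutions\<close>

lemma continuous_locally_integrable: "continuous_on UNIV f \<Longrightarrow> f locally_integrable_on \<Omega>"
  unfolding locally_integrable_on_def set_integrable_def
proof (intro allI impI)
  fix K :: "'a set"
  assume f: "continuous_on UNIV f" and K: "compact K \<and> K \<subseteq> \<Omega>"
  have [measurable]: "f \<in> borel_measurable borel" "K \<in> sets borel"
    using borel_measurable_continuous_onI[OF f] K by (auto intro: borel_compact)
  have "integrable lborel (\<lambda>x. indicator K x *\<^sub>R f x)"
    using f K by (intro borel_integrable_compact) (auto intro: continuous_on_subset)
  then show "integrable lebesgue (\<lambda>x. indicator K x *\<^sub>R f x)"
    by (intro integrable_completion[THEN iffD2]) auto
qed

lemma frechet_time_derivative:
  fixes \<phi> :: "(real ^ 'n) \<times> real \<Rightarrow> real"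
  assumes "k_smooth 1 \<phi>"
  shows "((\<lambda>t. \<phi> (x, t)) has_real_derivative frechet_derivative \<phi> (at (x, t)) (0, 1)) (at t)"
    and "continuous_on UNIV (\<lambda>z. frechet_derivative \<phi> (at z) (0, 1))"
proof -
  have b: "(0, 1) \<in> (Basis :: ((real ^ 'n) \<times> real) set)" by (simp add: Basis_prod_def)
  then show "continuous_on UNIV (\<lambda>z. frechet_derivative \<phi> (at z) (0, 1))"
    using assms by simp
  define D where "D = frechet_derivative \<phi> (at (x, t))"
  have D: "(\<phi> has_derivative D) (at (x, t))"
    using assms by (simp add: D_def frechet_derivative_works[symmetric])
  have "((\<lambda>t. (x, t)) has_derivative (\<lambda>h. (0, h))) (at t)"
    by (intro has_derivative_Pair has_derivative_const has_derivative_ident)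
  from has_derivative_compose[OF this D]
  have "((\<lambda>t. \<phi> (x, t)) has_derivative (\<lambda>h. D (0, h))) (at t)" .
  moreover have "(\<lambda>h. D (0, h)) = (*) (D (0, 1))"
  proof
    fix h
    show "D (0, h) = D (0, 1) * h"
      using linear_scale[OF has_derivative_linear[OF D], of h "(0, 1)"] by simp
  qed
  ultimately show "((\<lambda>t. \<phi> (x, t)) has_real_derivative frechet_derivative \<phi> (at (x, t)) (0, 1)) (at t)"
    by (metis has_field_derivative_def D_def)
qed

lemma test_function_vanishes: "test_function_on \<Omega> \<phi> \<Longrightarrow> z \<notin> closure {z. \<phi> z \<noteq> 0} \<Longrightarrow> \<phi> z = 0"
  using closure_subset[of "{z. \<phi> z \<noteq> 0}"] by auto

lemma test_function_time_derivative_vanishes: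
  fixes \<phi> :: "(real ^ 'n) \<times> real \<Rightarrow> real"
  assumes "test_function_on \<Omega> \<phi>" "z \<notin> closure {z. \<phi> z \<noteq> 0}"
  shows "frechet_derivative \<phi> (at z) h = 0"
proof -
  have "((\<lambda>_. 0) has_derivative (\<lambda>_. 0)) (at z)" by (rule has_derivative_const)
  then have "(\<phi> has_derivative (\<lambda>_. 0)) (at z)"
    by (rule has_derivative_transform_within_open[of _ _ _ _ "- closure {z. \<phi> z \<noteq> 0}"])
      (use assms test_function_vanishes in auto)
  then show ?thesis by (metis frechet_derivative_at)
qed

text \<open>
  The sum \<open>u \<phi>\<^sub>t + u\<^sub>t \<phi>\<close> is the time derivative of \<open>u \<phi>\<close>, which has compact support; its integral over every line
  in the time direction vanishes, and Fubini's theorem does the rest.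
\<close>

lemma classical_imp_weak_time_derivative:
  fixes u ut :: "(real ^ 'n) \<times> real \<Rightarrow> real"
  assumes cu: "continuous_on UNIV u" and cut: "continuous_on UNIV ut"
    and deriv: "\<And>x t. ((\<lambda>t. u (x, t)) has_real_derivative ut (x, t)) (at t)"
  shows "weak_time_derivative u ut"
  unfolding weak_time_derivative_def
proof (intro conjI allI impI continuous_locally_integrable cu cut)
  fix \<phi> :: "(real ^ 'n) \<times> real \<Rightarrow> real"
  assume \<phi>: "test_function_on spacetime \<phi>"
  define K where "K = closure {z. \<phi> z \<noteq> 0}"
  have K: "compact K" using \<phi> by (simp add: test_function_on_def K_def)
  have smooth: "k_smooth 1 \<phi>" using \<phi> unfolding test_function_on_def by blast
  define d where "d z = frechet_derivative \<phi> (at z) (0, 1)" for z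
  have cd: "continuous_on UNIV d" unfolding d_def by (rule frechet_time_derivative smooth)+
  have c\<phi>: "continuous_on UNIV \<phi>" using k_smooth_continuous[OF smooth] .
  have z: "\<phi> z = 0" "d z = 0" if "z \<notin> K" for z
    using that \<phi> test_function_vanishes test_function_time_derivative_vanishes
    unfolding K_def d_def by blast+
  have int: "integrable lborel f" if "continuous_on UNIV f" "\<And>z. z \<notin> K \<Longrightarrow> f z = 0" for f :: "(real ^ 'n) \<times> real \<Rightarrow> real"
  proof -
    have "integrable lborel (\<lambda>z. indicator K z *\<^sub>R f z)"
      using that by (intro borel_integrable_compact K) (auto intro: continuous_on_subset)
    moreover have "(\<lambda>z. indicator K z *\<^sub>R f z) = f" by (intro ext) (metis indicator_simps scaleR_one scaleR_zero_left that(2))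
    ultimately show ?thesis by simp
  qed
  have i1: "integrable lborel (\<lambda>z. u z * d z)" and i2: "integrable lborel (\<lambda>z. ut z * \<phi> z)"
    by (intro int continuous_on_mult cu cd cut c\<phi>; simp add: z)+
  define h where "h z = u z * d z + ut z * \<phi> z" for z
  have ch: "continuous_on UNIV h" unfolding h_def
    by (intro continuous_intros cu cd cut c\<phi>)
  have ih: "integrable lborel h" unfolding h_def by (intro Bochner_Integration.integrable_add i1 i2)
  obtain T where T: "\<And>z. z \<in> K \<Longrightarrow> norm z < T" 
    using compact_imp_bounded[OF K] unfolding bounded_pos_less by auto
  have far: "(x, t) \<notin> K" if "\<bar>t\<bar> \<ge> T" for x t
    using T[of "(x, t)"] that norm_snd_le[of t x] by auto
  have inner: "(LINT t|lborel. h (x, t)) = 0" for x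
  proof -
    have "(LINT t|lborel. h (x, t) * indicator {- \<bar>T\<bar>..\<bar>T\<bar>} t) = u (x, \<bar>T\<bar>) * \<phi> (x, \<bar>T\<bar>) - u (x, - \<bar>T\<bar>) * \<phi> (x, - \<bar>T\<bar>)"
    proof (rule integral_FTC_Icc_real)
      fix t
      show "((\<lambda>t. u (x, t) * \<phi> (x, t)) has_real_derivative h (x, t)) (at t)"
        unfolding h_def d_def
        by (rule derivative_eq_intros deriv frechet_time_derivative smooth refl)+ simp
      show "isCont (\<lambda>t. h (x, t)) t"
        using continuous_on_compose2[OF ch, of UNIV "\<lambda>t. (x, t)"]
        by (auto simp: continuous_on_eq_continuous_at intro!: continuous_intros)
    qed simp
    also have "\<dots> = 0" using z far by simp
    also have "(\<lambda>t. h (x, t) * indicator {- \<bar>T\<bar>..\<bar>T\<bar>} t) = (\<lambda>t. h (x, t))"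
    proof
      fix t
      show "h (x, t) * indicator {- \<bar>T\<bar>..\<bar>T\<bar>} t = h (x, t)"
        using far[of t x] z[of "(x, t)"] by (cases "\<bar>t\<bar> \<ge> T") (auto simp: h_def indicator_def)
    qed
    finally show ?thesis .
  qed
  have "(LINT z|lborel. u z * d z) + (LINT z|lborel. ut z * \<phi> z) = (LINT z|lborel. h z)"
    unfolding h_def by (rule Bochner_Integration.integral_add[symmetric] i1 i2)+
  also have "\<dots> = (LINT x|lborel. (LINT t|lborel. h (x, t)))"
    using lborel_pair.integral_fst'[of h] ih by (simp add: lborel_prod)
  also have "\<dots> = 0" by (simp add: inner)
  finally have "(LINT z|lborel. u z * d z) = - (LINT z|lborel. ut z * \<phi> z)" by simp
  moreover have "(\<lambda>z. u z * d z) \<in> borel_measurable borel" "(\<lambda>z. ut z * \<phi> z) \<in> borel_measurable borel"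
    by (intro borel_measurable_continuous_onI continuous_on_mult cu cut c\<phi> cd)+
  ultimately show "(LINT z|lebesgue. u z * frechet_derivative \<phi> (at z) (0, 1)) = - (LINT z|lebesgue. ut z * \<phi> z)"
    by (simp add: integral_completion d_def[symmetric])
qed

section \<open>The polynomial solution\<close>

lemma kernel_moment:
  assumes "kernel J" "ereal (real d) < moment_exponent J" "j \<le> d"
  shows "integrable lborel (\<lambda>y. J y * (1 + norm y) ^ j)"
proof -
  have "ereal (real j) < moment_exponent J"
    using assms(2,3) by (meson ereal_less_eq(3) of_nat_mono le_less_trans)
  then have "integrable lborel (\<lambda>y. J y * (1 + norm y) powr real j)"
    by (intro kernel_weight_integrable assms(1)) auto
  then show ?thesis by (simp add: powr_realpow add_pos_nonneg)
qed

lemma pdl_kernel_conv: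
  assumes J: "kernel J" "ereal (real d) < moment_exponent J" and f: "poly_deg_less n f" "n \<le> Suc d"
  shows "convolves_at J f x" "poly_deg_less (n - 2) (\<lambda>x. conv J f x - f x)"
proof -
  have m: "integrable lborel (\<lambda>y. J y * (1 + norm y) ^ j)" if "j < n" for j
    using kernel_moment[OF J, of j] that f(2) by simp
  show "convolves_at J f x"
    unfolding conv_lborel(1)[OF J(1) pdl_borel[OF f(1)]]
    by (intro pdl_conv_integrable[of n] f kernel_borel J m)
  show "poly_deg_less (n - 2) (\<lambda>x. conv J f x - f x)"
    unfolding conv_lborel(2)[OF J(1) pdl_borel[OF f(1)]]
    by (intro pdl_conv_even f kernel_borel kernel_even kernel_integral J m)
qed

lemma conv_add:
  assumes "convolves_at J f x" "convolves_at J g x"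
  shows "convolves_at J (\<lambda>y. f y + g y) x" "conv J (\<lambda>y. f y + g y) x = conv J f x + conv J g x"
  using assms unfolding convolves_at_def conv_def distrib_left by simp_all

lemma conv_diff:
  assumes "convolves_at J f x" "convolves_at J g x"
  shows "convolves_at J (\<lambda>y. f y - g y) x" "conv J (\<lambda>y. f y - g y) x = conv J f x - conv J g x"
  using assms unfolding convolves_at_def conv_def right_diff_distrib by simp_all

lemma conv_mult_right:
  assumes "convolves_at J f x"
  shows "convolves_at J (\<lambda>y. f y * a) x" "conv J (\<lambda>y. f y * a) x = conv J f x * a"
  using assms unfolding convolves_at_def conv_def mult.assoc[symmetric] by simp_all

lemma conv_sum:
  assumes "\<And>k. k \<in> I \<Longrightarrow> convolves_at J (f k) x"
  shows "convolves_at J (\<lambda>y. \<Sum>k\<in>I. f k y) x" "conv J (\<lambda>y. \<Sum>k\<in>I. f k y) x = (\<Sum>k\<in>I. conv J (f k) x)"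
  using assms unfolding convolves_at_def conv_def sum_distrib_left by simp_all

lemma growth_ratio_tendsto_0:
  assumes "real d < \<gamma>"
  shows "((\<lambda>x::'a::real_normed_vector. (1 + norm x) ^ d / (1 + norm x powr \<gamma>)) \<longlongrightarrow> 0) at_infinity"
proof -
  have lim: "((\<lambda>r::real. 2 ^ d * r powr (real d - \<gamma>)) \<longlongrightarrow> 2 ^ d * 0) at_top"
    using assms by (intro tendsto_mult tendsto_const tendsto_neg_powr filterlim_ident) auto
  have "((\<lambda>r::real. (1 + r) ^ d / (1 + r powr \<gamma>)) \<longlongrightarrow> 0) at_top"
  proof (rule tendsto_sandwich[OF _ _ tendsto_const])
    show "((\<lambda>r::real. 2 ^ d * r powr (real d - \<gamma>)) \<longlongrightarrow> 0) at_top"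
      using lim by simp
    show "\<forall>\<^sub>F r in at_top. (1 + r) ^ d / (1 + r powr \<gamma>) \<le> 2 ^ d * r powr (real d - \<gamma>)"
      using eventually_ge_at_top[of "1::real"]
    proof eventually_elim
      case (elim r)
      have "(1 + r) ^ d / (1 + r powr \<gamma>) \<le> (2 * r) ^ d / r powr \<gamma>"
        using elim by (intro frac_le power_mono) auto
      also have "\<dots> = 2 ^ d * r powr (real d - \<gamma>)"
        using elim by (simp add: power_mult_distrib powr_diff powr_realpow)
      finally show ?case .
    qed
    show "\<forall>\<^sub>F r in at_top. 0 \<le> (1 + r) ^ d / (1 + r powr \<gamma>)"
      using eventually_ge_at_top[of "1::real"] by eventually_elim auto
  qed
  from filterlim_compose[OF this filterlim_norm_at_top]
  show ?thesis by simp
qed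

text \<open>
  Only the degree of the initial datum matters for existence, so it is an arbitrary polynomial
  of degree at most \<open>2 p\<close> here.
\<close>

locale heat_polynomial =
  fixes J :: "real ^ 'n \<Rightarrow> real" and p :: nat and c :: "nat \<Rightarrow> real ^ 'n \<Rightarrow> real"
    and u0 :: "real ^ 'n \<Rightarrow> real"
  assumes J: "kernel J" and p: "1 \<le> p" and mom: "ereal (2 * real p) < moment_exponent J"
    and u0: "poly_deg_less (2 * p + 1) u0"
    and c1: "\<And>x. c 1 x = conv J u0 x - u0 x"
    and c_rec: "\<And>k x. 2 \<le> k \<Longrightarrow> k \<le> p \<Longrightarrow>
           c k x = 1 / (real k - 1) * (conv J (c (k - 1)) x - c (k - 1) x)"
begin

definition u :: "(real ^ 'n) \<times> real \<Rightarrow> real" where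
  "u = (\<lambda>(x, t). u0 x + (\<Sum>k=1..p. c k x * (t ^ k / real k)))"

definition ut :: "(real ^ 'n) \<times> real \<Rightarrow> real" where
  "ut = (\<lambda>(x, t). \<Sum>k=1..p. c k x * t ^ (k - 1))"

lemma mom': "ereal (real (2 * p)) < moment_exponent J" using mom by simp

lemmas conv_poly = pdl_kernel_conv[OF J mom']

lemma c_deg: "1 \<le> k \<Longrightarrow> k \<le> p \<Longrightarrow> poly_deg_less (2 * p + 1 - 2 * k) (c k)"
proof (induction k rule: nat_induct_at_least)
  case base
  then show ?case using conv_poly(2)[OF u0] unfolding c1[abs_def] by simp
next
  case (Suc k)
  have eq: "c (Suc k) = (\<lambda>x. 1 / real k * (conv J (c k) x - c k x))"
    using c_rec[of "Suc k"] Suc by auto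
  have "poly_deg_less (2 * p + 1 - 2 * k - 2) (\<lambda>x. conv J (c k) x - c k x)"
    using Suc by (intro conv_poly(2)) auto
  then show ?case unfolding eq by (intro pdl_scale) simp
qed

lemma c_deg': "k \<in> {1..p} \<Longrightarrow> poly_deg_less (2 * p + 1) (c k)"
  by (rule pdl_mono[OF c_deg]) auto

lemma c_convolves: "k \<in> {1..p} \<Longrightarrow> convolves_at J (c k) x"
  by (rule conv_poly(1)[OF c_deg']) auto

lemma u0_convolves: "convolves_at J u0 x"
  by (rule conv_poly(1)[OF u0]) auto

text \<open>
  Each step lowers the degree by two, so \<open>c p\<close> is constant and is annihilated: this is where the
  exponential series stops.
\<close>

lemma conv_c:
  assumes "k \<in> {1..p}"
  shows "conv J (c k) x - c k x = (if k < p then real k * c (Suc k) x else 0)"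
proof (cases "k < p")
  case True
  then show ?thesis using c_rec[of "Suc k" x] assms by auto
next
  case False
  then have k: "k = p" using assms by simp
  have "poly_deg_less 1 (c p)" using c_deg[of p] p by simp
  then have "poly_deg_less (1 - 2) (\<lambda>x. conv J (c p) x - c p x)" by (rule conv_poly(2)) simp
  then have "conv J (c p) x - c p x = 0" by (rule pdl_0D) simp
  then show ?thesis using k by simp
qed

lemma u_convolves: "convolves_at J (\<lambda>y. u (y, t)) x"
  unfolding u_def prod.case
  by (intro conv_add(1) conv_sum(1) conv_mult_right(1) u0_convolves c_convolves)

text \<open>
  The operator \<open>J * \<cdot> - \<cdot>\<close> shifts the index of the coefficients by one, and so does the derivative in \<open>t\<close>.
\<close>

lemma u_equation: "conv J (\<lambda>y. u (y, t)) x - u (x, t) = ut (x, t)"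
proof -
  have "conv J (\<lambda>y. u (y, t)) x = conv J u0 x + conv J (\<lambda>y. \<Sum>k=1..p. c k y * (t ^ k / real k)) x"
    unfolding u_def prod.case
    by (intro conv_add(2) conv_sum(1) conv_mult_right(1) u0_convolves c_convolves)
  also have "conv J (\<lambda>y. \<Sum>k=1..p. c k y * (t ^ k / real k)) x =
      (\<Sum>k=1..p. conv J (\<lambda>y. c k y * (t ^ k / real k)) x)"
    by (intro conv_sum(2) conv_mult_right(1) c_convolves)
  also have "\<dots> = (\<Sum>k=1..p. conv J (c k) x * (t ^ k / real k))"
    by (intro sum.cong refl conv_mult_right(2) c_convolves)
  finally have "conv J (\<lambda>y. u (y, t)) x = conv J u0 x + (\<Sum>k=1..p. conv J (c k) x * (t ^ k / real k))" .
  then have "conv J (\<lambda>y. u (y, t)) x - u (x, t) =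
     c 1 x + (\<Sum>k=1..p. (conv J (c k) x - c k x) * (t ^ k / real k))"
    unfolding u_def c1 by (simp add: sum_subtractf left_diff_distrib del: times_divide_eq_right)
  also have "(\<Sum>k=1..p. (conv J (c k) x - c k x) * (t ^ k / real k)) =
     (\<Sum>k=1..p. if k < p then c (Suc k) x * t ^ k else 0)"
    by (intro sum.cong refl) (auto simp: conv_c)
  also have "\<dots> = (\<Sum>k\<in>{1..<p}. c (Suc k) x * t ^ k)"
    by (intro sum.mono_neutral_cong_right) auto
  also have "\<dots> = (\<Sum>k\<in>{Suc 1..<Suc p}. c k x * t ^ (k - 1))"
    by (subst sum.shift_bounds_Suc_ivl) simp
  also have "c 1 x + \<dots> = (\<Sum>k\<in>{1..<Suc p}. c k x * t ^ (k - 1))"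
    using p by (subst (2) sum.atLeast_Suc_lessThan) auto
  finally show ?thesis by (simp add: ut_def atLeastLessThanSuc_atLeastAtMost)
qed

lemma u_continuous: "continuous_on UNIV u"
  and ut_continuous: "continuous_on UNIV ut"
  unfolding u_def ut_def case_prod_beta
  by (auto intro!: continuous_intros continuous_on_compose2[OF pdl_continuous[OF u0]]
       continuous_on_compose2[OF pdl_continuous[OF c_deg']])

lemma u_has_time_derivative: "((\<lambda>t. u (x, t)) has_real_derivative ut (x, t)) (at t)"
  unfolding u_def ut_def by (auto intro!: derivative_eq_intros sum.cong)

lemma u_continuous_L1: "continuous_L1_loc u"
  unfolding continuous_L1_loc_def
proof (intro conjI allI impI continuous_locally_integrable)
  show "continuous_on UNIV (\<lambda>x. u (x, t))" for t
    by (rule continuous_on_compose2[OF u_continuous]) (auto intro!: continuous_intros)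
next
  fix K :: "(real ^ 'n) set" and t :: real
  assume K: "compact K"
  have int: "set_integrable lebesgue K f" if "continuous_on UNIV f" for f :: "real ^ 'n \<Rightarrow> real"
    using continuous_locally_integrable[OF that, of UNIV] K by (auto simp: locally_integrable_on_def)
  define b where "b s = (\<Sum>k=1..p. \<bar>s ^ k / real k - t ^ k / real k\<bar> * (LINT x:K|lebesgue. \<bar>c k x\<bar>))" for s
  have cu: "continuous_on UNIV (\<lambda>x. u (x, s))" for s
    by (rule continuous_on_compose2[OF u_continuous]) (auto intro!: continuous_intros)
  have cc: "continuous_on UNIV (c k)" if "k \<in> {1..p}" for k
    by (rule pdl_continuous c_deg' that)+
  show "((\<lambda>s. LINT x:K|lebesgue. \<bar>u (x, s) - u (x, t)\<bar>) \<longlongrightarrow> 0) (at t within {0..})"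
  proof (rule tendsto_sandwich[OF _ _ tendsto_const])
    have "(b \<longlongrightarrow> (\<Sum>k=1..p. \<bar>t ^ k / real k - t ^ k / real k\<bar> * (LINT x:K|lebesgue. \<bar>c k x\<bar>))) (at t within {0..})"
      unfolding b_def by (intro tendsto_intros) auto
    then show "(b \<longlongrightarrow> 0) (at t within {0..})" by simp
    have "(LINT x:K|lebesgue. \<bar>u (x, s) - u (x, t)\<bar>) \<le> b s" for s
    proof -
      have "(LINT x:K|lebesgue. \<bar>u (x, s) - u (x, t)\<bar>) \<le>
          (LINT x:K|lebesgue. (\<Sum>k=1..p. \<bar>s ^ k / real k - t ^ k / real k\<bar> * \<bar>c k x\<bar>))"
      proof (rule set_integral_mono)
        fix x
        have "u (x, s) - u (x, t) = (\<Sum>k=1..p. (s ^ k / real k - t ^ k / real k) * c k x)"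
          unfolding u_def by (simp add: sum_subtractf[symmetric] algebra_simps)
        then show "\<bar>u (x, s) - u (x, t)\<bar> \<le> (\<Sum>k=1..p. \<bar>s ^ k / real k - t ^ k / real k\<bar> * \<bar>c k x\<bar>)"
          using sum_abs[of "\<lambda>k. (s ^ k / real k - t ^ k / real k) * c k x" "{1..p}"] by (simp add: abs_mult)
      qed (auto intro!: int continuous_intros cu cc)
      also have "\<dots> = b s"
      proof -
        have "integrable lebesgue (\<lambda>x. indicator K x * \<bar>c k x\<bar>)" if "k \<in> {1..p}" for k
          using int[of "\<lambda>x. \<bar>c k x\<bar>"] cc[OF that] by (auto simp: set_integrable_def intro!: continuous_intros)
        then have "(LINT x|lebesgue. (\<Sum>k=1..p. \<bar>s ^ k / real k - t ^ k / real k\<bar> * (indicator K x * \<bar>c k x\<bar>))) =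
            (\<Sum>k=1..p. LINT x|lebesgue. \<bar>s ^ k / real k - t ^ k / real k\<bar> * (indicator K x * \<bar>c k x\<bar>))"
          by (intro Bochner_Integration.integral_sum integrable_mult_right)
        also have "\<dots> = b s" unfolding b_def set_lebesgue_integral_def by simp
        finally show ?thesis unfolding set_lebesgue_integral_def
          by (simp only: sum_distrib_left real_scaleR_def mult.left_commute)
      qed
      finally show ?thesis .
    qed
    then show "\<forall>\<^sub>F s in at t within {0..}. (LINT x:K|lebesgue. \<bar>u (x, s) - u (x, t)\<bar>) \<le> b s"
      by simp
    show "\<forall>\<^sub>F s in at t within {0..}. 0 \<le> (LINT x:K|lebesgue. \<bar>u (x, s) - u (x, t)\<bar>)"
      by (auto simp: set_lebesgue_integral_def)
  qed
qed

lemma u_strong_solution: "strong_solution J u0 u"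
  unfolding strong_solution_def
proof (intro conjI u_continuous_L1 exI[of _ ut] classical_imp_weak_time_derivative
    u_continuous ut_continuous u_has_time_derivative)
  have "(\<lambda>(x, t). conv J (\<lambda>y. u (y, t)) x) = (\<lambda>z. u z + ut z)"
    using u_equation by (auto simp: fun_eq_iff algebra_simps)
  then show "(\<lambda>(x, t). conv J (\<lambda>y. u (y, t)) x) locally_integrable_on spacetime"
    by (auto intro!: continuous_locally_integrable continuous_on_add u_continuous ut_continuous)
  have "u (x, 0) = u0 x" for x by (simp add: u_def)
  then show "AE x in lebesgue. u (x, 0) = u0 x" by simp
qed (auto simp: u_convolves u_equation)

lemma u_uniqueness_class: "uniqueness_class J u"
proof -
  obtain \<gamma>' where \<gamma>': "ereal (2 * real p) < \<gamma>'" "\<gamma>' < moment_exponent J"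
    using mom ereal_dense2 by blast
  then obtain \<gamma> where \<gamma>: "\<gamma>' = ereal \<gamma>" by (cases \<gamma>') auto
  have \<gamma>2: "2 * real p < \<gamma>" "ereal \<gamma> < moment_exponent J" using \<gamma> \<gamma>' by auto
  obtain C0 where C0: "C0 \<ge> 0" "\<And>x. \<bar>u0 x\<bar> \<le> C0 * (1 + norm x) ^ (2 * p)"
    using pdl_growth[of "2 * p" u0] u0 by auto
  have "\<forall>k\<in>{1..p}. \<exists>C\<ge>0. \<forall>x. \<bar>c k x\<bar> \<le> C * (1 + norm x) ^ (2 * p)"
  proof
    fix k assume "k \<in> {1..p}"
    from c_deg'[OF this] show "\<exists>C\<ge>0. \<forall>x. \<bar>c k x\<bar> \<le> C * (1 + norm x) ^ (2 * p)"
      using pdl_growth[of "2 * p" "c k"] by simp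
  qed
  then obtain D where D: "\<And>k. k \<in> {1..p} \<Longrightarrow> D k \<ge> 0"
    "\<And>k x. k \<in> {1..p} \<Longrightarrow> \<bar>c k x\<bar> \<le> D k * (1 + norm x) ^ (2 * p)"
    by metis
  define C where "C t = (C0 + (\<Sum>k=1..p. D k)) * (1 + \<bar>t\<bar>) ^ p" for t :: real
  have le: "\<bar>u (x, t)\<bar> \<le> C t * (1 + norm x) ^ (2 * p)" for x t
  proof -
    have "\<bar>c k x * (t ^ k / real k)\<bar> \<le> (D k * (1 + norm x) ^ (2 * p)) * (1 + \<bar>t\<bar>) ^ p" if k: "k \<in> {1..p}" for k
    proof -
      have "\<bar>t ^ k / real k\<bar> \<le> \<bar>t\<bar> ^ k / 1"
        unfolding abs_divide power_abs using k by (intro divide_left_mono) auto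
      also have "\<dots> \<le> (1 + \<bar>t\<bar>) ^ k" using power_mono[of "\<bar>t\<bar>" "1 + \<bar>t\<bar>" k] by simp
      also have "\<dots> \<le> (1 + \<bar>t\<bar>) ^ p" using k by (intro power_increasing) auto
      finally show ?thesis
        unfolding abs_mult using D k by (intro mult_mono) auto
    qed
    then have "\<bar>\<Sum>k=1..p. c k x * (t ^ k / real k)\<bar> \<le> (\<Sum>k=1..p. (D k * (1 + norm x) ^ (2 * p)) * (1 + \<bar>t\<bar>) ^ p)"
      by (intro order_trans[OF sum_abs] sum_mono)
    moreover have "\<bar>u0 x\<bar> \<le> C0 * (1 + norm x) ^ (2 * p) * (1 + \<bar>t\<bar>) ^ p"
    proof -
      have "C0 * (1 + norm x) ^ (2 * p) * 1 \<le> C0 * (1 + norm x) ^ (2 * p) * (1 + \<bar>t\<bar>) ^ p"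
        using C0(1) by (intro mult_left_mono) auto
      then show ?thesis using C0(2)[of x] by linarith
    qed
    ultimately have "\<bar>u (x, t)\<bar> \<le> C0 * (1 + norm x) ^ (2 * p) * (1 + \<bar>t\<bar>) ^ p +
        (\<Sum>k=1..p. (D k * (1 + norm x) ^ (2 * p)) * (1 + \<bar>t\<bar>) ^ p)"
      unfolding u_def by simp
    also have "\<dots> = C t * (1 + norm x) ^ (2 * p)"
      by (simp add: C_def sum_distrib_left sum_distrib_right algebra_simps)
    finally show ?thesis .
  qed
  have "growth_below \<gamma> u"
    unfolding growth_below_def
  proof (intro exI conjI allI impI)
    show "L_infinity_loc C"
      unfolding L_infinity_loc_def
    proof (intro conjI allI impI)
      have "C \<in> borel_measurable borel"
        unfolding C_def by (intro borel_measurable_continuous_onI continuous_intros)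
      then have "C \<in> borel_measurable lebesgue" by (simp add: measurable_completion)
      then show "set_borel_measurable lebesgue {0..} C"
        unfolding set_borel_measurable_def by (intro borel_measurable_scaleR borel_measurable_indicator) auto
      fix T :: real
      assume "0 \<le> T"
      have "\<bar>C t\<bar> \<le> C T" if "t \<in> {0..T}" for t
      proof -
        have "0 \<le> C0 + (\<Sum>k=1..p. D k)" using C0 D(1) by (intro add_nonneg_nonneg sum_nonneg) auto
        then show ?thesis using that unfolding C_def by (auto simp: abs_mult intro!: mult_mono power_mono)
      qed
      then show "\<exists>M. AE t in lebesgue. t \<in> {0..T} \<longrightarrow> \<bar>C t\<bar> \<le> M" by (intro exI[of _ "C T"]) auto
    qed
    show "((\<lambda>x::real^'n. (1 + norm x) ^ (2 * p) / (1 + norm x powr \<gamma>)) \<longlongrightarrow> 0) at_infinity"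
      using \<gamma>2 by (intro growth_ratio_tendsto_0) simp
    have "1 + norm x powr \<gamma> \<noteq> 0" for x :: "real ^ 'n"
      using powr_ge_zero[of "norm x" \<gamma>] by linarith
    then show "AE x in lebesgue. \<bar>u (x, t)\<bar> \<le> C t * ((1 + norm x) ^ (2 * p) / (1 + norm x powr \<gamma>)) * (1 + norm x powr \<gamma>)" for t
      using le[of _ t] by simp
  qed
  then show ?thesis unfolding uniqueness_class_def using \<gamma>2 p by (intro exI[of _ \<gamma>]) auto
qed

end

section \<open>A weight adapted to the kernel\<close>

text \<open>
  Convolution of functions with values in \<open>[0, \<infinity>]\<close>: all estimates of the uniqueness proof are made here,
  where interchanging integrals needs no integrability.
\<close>

definition nconv :: "(real ^ 'n \<Rightarrow> real) \<Rightarrow> (real ^ 'n \<Rightarrow> ennreal) \<Rightarrow> real ^ 'n \<Rightarrow> ennreal" where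
  "nconv J f x = (\<integral>\<^sup>+ y. ennreal (J (x - y)) * f y \<partial>lborel)"

lemma nconv_measurable [measurable (raw)]:
  assumes "kernel J" and [measurable]: "f \<in> borel_measurable borel"
  shows "nconv J f \<in> borel_measurable borel"
proof -
  note [measurable] = kernel_borel[OF assms(1)]
  have "(\<lambda>x. \<integral>\<^sup>+ y. ennreal (J (x - y)) * f y \<partial>lborel) \<in> borel_measurable lborel"
    by measurable
  then show ?thesis by (simp add: nconv_def[abs_def])
qed

lemma nconv_mono: "(\<And>y. f y \<le> g y) \<Longrightarrow> nconv J f x \<le> nconv J g x"
  unfolding nconv_def by (intro nn_integral_mono mult_left_mono) auto

lemma nconv_reflect:
  assumes "kernel J" and [measurable]: "f \<in> borel_measurable borel"
  shows "nconv J f x = (\<integral>\<^sup>+ y. ennreal (J y) * f (x - y) \<partial>lborel)"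
proof -
  note [measurable] = kernel_borel[OF assms(1)]
  have "nconv J f x = (\<integral>\<^sup>+ y. ennreal (J (x - y)) * f y \<partial>distr lborel borel (\<lambda>y. x - y))"
    by (simp only: nconv_def lborel_reflect)
  also have "\<dots> = (\<integral>\<^sup>+ y. ennreal (J y) * f (x - y) \<partial>lborel)"
    by (subst nn_integral_distr) auto
  finally show ?thesis .
qed

text \<open>
  Tonelli's theorem, and the kernel is even.
\<close>

lemma nconv_adjoint:
  assumes J: "kernel J" and [measurable]: "f \<in> borel_measurable borel" "h \<in> borel_measurable borel"
  shows "(\<integral>\<^sup>+ x. nconv J f x * h x \<partial>lborel) = (\<integral>\<^sup>+ x. f x * nconv J h x \<partial>lborel)"
proof -
  note [measurable] = kernel_borel[OF J]
  have sym: "J (x - y) = J (y - x)" for x y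
    using kernel_even[OF J, of "y - x"] by simp
  have "(\<integral>\<^sup>+ x. nconv J f x * h x \<partial>lborel) = (\<integral>\<^sup>+ x. \<integral>\<^sup>+ y. ennreal (J (x - y)) * f y * h x \<partial>lborel \<partial>lborel)"
    unfolding nconv_def by (intro nn_integral_cong nn_integral_multc[symmetric]) auto
  also have "\<dots> = (\<integral>\<^sup>+ y. \<integral>\<^sup>+ x. ennreal (J (x - y)) * f y * h x \<partial>lborel \<partial>lborel)"
    by (rule lborel_pair.Fubini') measurable
  also have "\<dots> = (\<integral>\<^sup>+ y. \<integral>\<^sup>+ x. f y * (ennreal (J (y - x)) * h x) \<partial>lborel \<partial>lborel)"
    by (intro nn_integral_cong) (simp add: sym[of _ "_"] mult_ac)
  also have "\<dots> = (\<integral>\<^sup>+ x. f x * nconv J h x \<partial>lborel)"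
    unfolding nconv_def by (intro nn_integral_cong nn_integral_cmult) auto
  finally show ?thesis .
qed

lemma nconv_one: "kernel J \<Longrightarrow> nconv J (\<lambda>_. 1) x = 1"
  using nn_integral_eq_integral[OF kernel_integrable, of J]
  by (simp add: nconv_reflect kernel_nonneg kernel_integral)

text \<open>
  As the weight is submultiplicative, \<open>K\<close> can be taken to be the moment of order \<open>\<gamma>\<close> of the kernel;
  adding \<open>1\<close> to it secures \<open>1 \<le> K\<close> at no cost.
\<close>

lemma nconv_weight:
  assumes J: "kernel J" and \<gamma>: "0 \<le> \<gamma>" "ereal \<gamma> < moment_exponent J"
  obtains K :: real where "1 \<le> K"
    "\<And>x. nconv J (\<lambda>y. ennreal ((1 + norm y) powr \<gamma>)) x \<le> ennreal K * ennreal ((1 + norm x) powr \<gamma>)"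
proof
  define L where "L = (LINT y|lborel. J y * (1 + norm y) powr \<gamma>)"
  have L0: "0 \<le> L" unfolding L_def
    by (intro Bochner_Integration.integral_nonneg) (simp add: kernel_nonneg[OF J])
  then show "1 \<le> L + 1" by simp
  note [measurable] = kernel_borel[OF J]
  fix x
  have "nconv J (\<lambda>y. ennreal ((1 + norm y) powr \<gamma>)) x
      = (\<integral>\<^sup>+ y. ennreal (J y) * ennreal ((1 + norm (x - y)) powr \<gamma>) \<partial>lborel)"
    by (rule nconv_reflect[OF J]) measurable
  also have "\<dots> \<le> (\<integral>\<^sup>+ y. ennreal ((1 + norm x) powr \<gamma>) * ennreal (J y * (1 + norm y) powr \<gamma>) \<partial>lborel)"
  proof (rule nn_integral_mono)
    fix y
    have "(1 + norm (x - y)) powr \<gamma> \<le> ((1 + norm x) * (1 + norm y)) powr \<gamma>"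
      using \<gamma> by (intro powr_mono2 one_plus_norm_diff_le) auto
    also have "\<dots> = (1 + norm x) powr \<gamma> * (1 + norm y) powr \<gamma>"
      by (simp add: powr_mult)
    finally show "ennreal (J y) * ennreal ((1 + norm (x - y)) powr \<gamma>)
       \<le> ennreal ((1 + norm x) powr \<gamma>) * ennreal (J y * (1 + norm y) powr \<gamma>)"
      using kernel_nonneg[OF J, of y]
      by (auto simp: ennreal_mult[symmetric] mult.left_commute mult_left_mono intro!: ennreal_leI)
  qed
  also have "\<dots> = ennreal ((1 + norm x) powr \<gamma>) * (\<integral>\<^sup>+ y. ennreal (J y * (1 + norm y) powr \<gamma>) \<partial>lborel)"
    by (rule nn_integral_cmult) measurable
  also have "(\<integral>\<^sup>+ y. ennreal (J y * (1 + norm y) powr \<gamma>) \<partial>lborel) = ennreal L"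
    unfolding L_def
    by (intro nn_integral_eq_integral kernel_weight_integrable J \<gamma>) (simp add: kernel_nonneg[OF J])
  also have "ennreal ((1 + norm x) powr \<gamma>) * ennreal L \<le> ennreal (L + 1) * ennreal ((1 + norm x) powr \<gamma>)"
    by (subst mult.commute) (intro mult_right_mono ennreal_leI, auto)
  finally show "nconv J (\<lambda>y. ennreal ((1 + norm y) powr \<gamma>)) x \<le> ennreal (L + 1) * ennreal ((1 + norm x) powr \<gamma>)" .
qed

lemma ennreal_suminf_half_power: "(\<Sum>k. ennreal ((1/2) ^ k)) = 2"
proof -
  have "(\<Sum>k. ennreal ((1/2) ^ k)) = ennreal (1 / (1 - 1/2))"
    by (intro suminf_ennreal_eq geometric_sums) auto
  then show ?thesis by simp
qed

text \<open>
  The weight is \<open>\<rho> = (\<Sum>k. q\<^sup>k J\<^sup>*\<^sup>k * 1\<^sub>B)\<close>, a resolvent of the convolution operator applied to the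
  indicator of the ball \<open>B\<close> of radius \<open>r\<close>. Convolving with \<open>J\<close> shifts the series, whence
  \<open>J * \<rho> \<le> \<rho> / q\<close>. Convolution with \<open>J\<close> preserves the bound \<open>1\<close>, whence \<open>\<rho> \<le> 2\<close> for \<open>q \<le> 1 / 2\<close>. By
  duality the moment of \<open>J\<^sup>*\<^sup>k * 1\<^sub>B\<close> grows at most like \<open>K\<^sup>k\<close>, so that the moment of \<open>\<rho>\<close> is
  finite for \<open>q K < 1\<close>. For an explicit weight, such as a negative power of \<open>1 + |x|\<close>, the inequality
  \<open>J * \<rho> \<le> C \<rho>\<close> would require a decay of \<open>J\<close> that its moments do not provide.
\<close>

lemma supersolution_weight:
  fixes J :: "real ^ 'n \<Rightarrow> real"
  assumes J: "kernel J" and \<gamma>: "0 \<le> \<gamma>" "ereal \<gamma> < moment_exponent J"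
  obtains \<rho> :: "real ^ 'n \<Rightarrow> ennreal" and C :: real where
    "\<rho> \<in> borel_measurable borel" "0 \<le> C" "\<And>x. \<rho> x \<le> 2" "\<And>x. norm x \<le> r \<Longrightarrow> 1 \<le> \<rho> x"
    "\<And>x. nconv J \<rho> x \<le> ennreal C * \<rho> x"
    "(\<integral>\<^sup>+ x. \<rho> x * ennreal ((1 + norm x) powr \<gamma>) \<partial>lborel) < \<infinity>"
proof -
  obtain K :: real where K: "1 \<le> K"
    "\<And>x. nconv J (\<lambda>y. ennreal ((1 + norm y) powr \<gamma>)) x \<le> ennreal K * ennreal ((1 + norm x) powr \<gamma>)"
    using nconv_weight[OF J \<gamma>] by metis
  define W :: "real ^ 'n \<Rightarrow> ennreal" where "W x = ennreal ((1 + norm x) powr \<gamma>)" for x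
  have [measurable]: "W \<in> borel_measurable borel" unfolding W_def by measurable
  (* The ratio makes q K = 1/2 (finite moment) and, as 1 \<le> K, also q \<le> 1/2 (bound 2). *)
  define q where "q = 1 / (2 * K)"
  define a :: "nat \<Rightarrow> real ^ 'n \<Rightarrow> ennreal" where "a k = (nconv J ^^ k) (indicator (cball 0 r))" for k
  define \<rho> where "\<rho> x = (\<Sum>k. a k x * ennreal (q ^ k))" for x
  have q: "0 < q" "q \<le> 1/2" using K(1) by (auto simp: q_def field_simps)
  have a_Suc: "a (Suc k) = nconv J (a k)" for k by (simp add: a_def)
  have [measurable]: "a k \<in> borel_measurable borel" for k
  proof (induction k)
    case 0
    show ?case unfolding a_def funpow_0 by (rule borel_measurable_indicator) simp
  next
    case (Suc k)
    then show ?case unfolding a_Suc by (intro nconv_measurable J)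
  qed
  have \<rho>_meas [measurable]: "\<rho> \<in> borel_measurable borel" unfolding \<rho>_def by measurable
  have a_le: "a k x \<le> 1" for k x
  proof (induction k arbitrary: x)
    case 0
    show ?case by (simp add: a_def indicator_def)
  next
    case (Suc k)
    have "nconv J (a k) x \<le> nconv J (\<lambda>_. 1) x" by (rule nconv_mono) (rule Suc)
    then show ?case by (simp add: a_Suc nconv_one[OF J])
  qed
  have "\<rho> x \<le> (\<Sum>k. ennreal ((1/2) ^ k))" for x
    unfolding \<rho>_def
  proof (intro suminf_le summableI)
    fix k
    have "a k x * ennreal (q ^ k) \<le> 1 * ennreal ((1/2) ^ k)"
      using q by (intro mult_mono a_le ennreal_leI power_mono) auto
    then show "a k x * ennreal (q ^ k) \<le> ennreal ((1/2) ^ k)" by simp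
  qed
  then have \<rho>_le: "\<rho> x \<le> 2" for x by (simp add: ennreal_suminf_half_power)
  have \<rho>_ge: "1 \<le> \<rho> x" if "norm x \<le> r" for x
  proof -
    have "(\<Sum>k<1. a k x * ennreal (q ^ k)) \<le> \<rho> x"
      unfolding \<rho>_def by (intro sum_le_suminf summableI) auto
    then show ?thesis using that by (simp add: a_def)
  qed
  note [measurable] = kernel_borel[OF J]
  have \<rho>_conv: "nconv J \<rho> x \<le> ennreal (2 * K) * \<rho> x" for x
  proof -
    have "nconv J \<rho> x = (\<integral>\<^sup>+ y. (\<Sum>k. ennreal (J (x - y)) * a k y * ennreal (q ^ k)) \<partial>lborel)"
      unfolding nconv_def \<rho>_def by (simp only: ennreal_suminf_cmult mult.assoc)
    also have "\<dots> = (\<Sum>k. \<integral>\<^sup>+ y. ennreal (J (x - y)) * a k y * ennreal (q ^ k) \<partial>lborel)"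
      by (rule nn_integral_suminf) measurable
    also have "\<dots> = (\<Sum>k. a (Suc k) x * ennreal (q ^ k))"
      unfolding a_Suc nconv_def by (intro suminf_cong nn_integral_multc) measurable
    also have "\<dots> = (\<Sum>k. ennreal (2 * K) * (a (Suc k) x * ennreal (q ^ Suc k)))"
    proof (intro suminf_cong)
      fix k
      have "ennreal (q ^ k) = ennreal (2 * K) * ennreal (q ^ Suc k)"
        using K(1) q(1) by (subst ennreal_mult[symmetric]) (auto simp: q_def)
      then show "a (Suc k) x * ennreal (q ^ k) = ennreal (2 * K) * (a (Suc k) x * ennreal (q ^ Suc k))"
        by (simp only: mult_ac)
    qed
    also have "\<dots> = ennreal (2 * K) * (\<Sum>k. a (Suc k) x * ennreal (q ^ Suc k))"
      by (rule ennreal_suminf_cmult)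
    also have "(\<Sum>k. a (Suc k) x * ennreal (q ^ Suc k)) \<le> \<rho> x"
    proof (intro suminf_le_const summableI)
      fix n
      have "(\<Sum>k<n. a (Suc k) x * ennreal (q ^ Suc k)) \<le> (\<Sum>k<Suc n. a k x * ennreal (q ^ k))"
        by (subst sum.lessThan_Suc_shift) simp
      also have "\<dots> \<le> \<rho> x" unfolding \<rho>_def by (intro sum_le_suminf summableI) auto
      finally show "(\<Sum>k<n. a (Suc k) x * ennreal (q ^ Suc k)) \<le> \<rho> x" .
    qed
    finally show ?thesis by (simp add: mult_left_mono)
  qed
  define I where "I = (\<integral>\<^sup>+ x. indicator (cball 0 r) x * W x \<partial>lborel)"
  have "(\<integral>\<^sup>+ x. a k x * W x \<partial>lborel) \<le> ennreal (K ^ k) * I" for k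
  proof -
    (* By duality each convolution can be moved to the weight W, at the price of a factor K. *)
    have gen: "(\<integral>\<^sup>+ x. (nconv J ^^ k) h x * W x \<partial>lborel) \<le> ennreal (K ^ k) * (\<integral>\<^sup>+ x. h x * W x \<partial>lborel)"
      if [measurable]: "h \<in> borel_measurable borel" for h
      using that
    proof (induction k arbitrary: h)
      case 0
      then show ?case by simp
    next
      case (Suc k)
      note [measurable] = Suc.prems
      have "(\<integral>\<^sup>+ x. (nconv J ^^ Suc k) h x * W x \<partial>lborel) = (\<integral>\<^sup>+ x. (nconv J ^^ k) (nconv J h) x * W x \<partial>lborel)"
        by (simp only: funpow_Suc_right o_apply)
      also have "\<dots> \<le> ennreal (K ^ k) * (\<integral>\<^sup>+ x. nconv J h x * W x \<partial>lborel)"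
        by (intro Suc.IH nconv_measurable J Suc.prems)
      also have "(\<integral>\<^sup>+ x. nconv J h x * W x \<partial>lborel) = (\<integral>\<^sup>+ x. h x * nconv J W x \<partial>lborel)"
        by (rule nconv_adjoint[OF J]) measurable
      also have "\<dots> \<le> (\<integral>\<^sup>+ x. ennreal K * (h x * W x) \<partial>lborel)"
      proof (rule nn_integral_mono)
        fix x
        show "h x * nconv J W x \<le> ennreal K * (h x * W x)"
          using mult_left_mono[OF K(2)[of x], of "h x"] by (simp add: W_def[abs_def] mult_ac)
      qed
      also have "\<dots> = ennreal K * (\<integral>\<^sup>+ x. h x * W x \<partial>lborel)"
        by (rule nn_integral_cmult) measurable
      finally have "(\<integral>\<^sup>+ x. (nconv J ^^ Suc k) h x * W x \<partial>lborel)
          \<le> ennreal (K ^ k) * (ennreal K * (\<integral>\<^sup>+ x. h x * W x \<partial>lborel))"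
        by (simp add: mult_left_mono)
      also have "\<dots> = ennreal (K ^ k * K) * (\<integral>\<^sup>+ x. h x * W x \<partial>lborel)"
        using K(1) by (simp add: ennreal_mult mult.assoc)
      finally show ?case by (simp only: power_Suc2)
    qed
    have "(indicator (cball 0 r) :: real ^ 'n \<Rightarrow> ennreal) \<in> borel_measurable borel"
      by (rule borel_measurable_indicator) simp
    from gen[OF this] show ?thesis by (simp add: a_def I_def)
  qed note a_W = this
  have "(\<integral>\<^sup>+ x. \<rho> x * W x \<partial>lborel) = (\<integral>\<^sup>+ x. (\<Sum>k. ennreal (q ^ k) * (a k x * W x)) \<partial>lborel)"
    unfolding \<rho>_def ennreal_suminf_multc[symmetric] by (simp only: mult_ac)
  also have "\<dots> = (\<Sum>k. \<integral>\<^sup>+ x. ennreal (q ^ k) * (a k x * W x) \<partial>lborel)"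
    by (rule nn_integral_suminf) measurable
  also have "\<dots> = (\<Sum>k. ennreal (q ^ k) * (\<integral>\<^sup>+ x. a k x * W x \<partial>lborel))"
    by (intro suminf_cong nn_integral_cmult) measurable
  also have "\<dots> \<le> (\<Sum>k. ennreal ((1/2) ^ k) * I)"
  proof (intro suminf_le summableI)
    fix k
    have "ennreal (q ^ k) * (\<integral>\<^sup>+ x. a k x * W x \<partial>lborel) \<le> ennreal (q ^ k) * (ennreal (K ^ k) * I)"
      by (intro mult_left_mono a_W) simp
    also have "\<dots> = ennreal (q ^ k * K ^ k) * I"
      using q K(1) by (simp add: ennreal_mult mult.assoc)
    also have "q ^ k * K ^ k = (1/2) ^ k"
      using K(1) by (simp add: power_mult_distrib[symmetric] q_def)
    finally show "ennreal (q ^ k) * (\<integral>\<^sup>+ x. a k x * W x \<partial>lborel) \<le> ennreal ((1/2) ^ k) * I" .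
  qed
  also have "\<dots> = 2 * I" by (simp only: ennreal_suminf_multc ennreal_suminf_half_power)
  also have "\<dots> < \<infinity>"
  proof -
    have "I \<le> (\<integral>\<^sup>+ x. ennreal ((1 + \<bar>r\<bar>) powr \<gamma>) * indicator (cball (0 :: real ^ 'n) r) x \<partial>lborel)"
      unfolding I_def W_def using \<gamma>(1)
      by (intro nn_integral_mono) (auto simp: indicator_def intro!: ennreal_leI powr_mono2)
    also have "\<dots> = ennreal ((1 + \<bar>r\<bar>) powr \<gamma>) * emeasure lborel (cball (0 :: real ^ 'n) r)"
      by (simp add: nn_integral_cmult_indicator)
    also have "\<dots> < \<infinity>" using emeasure_bounded_finite[OF bounded_cball[of "0 :: real ^ 'n" r]]
      by (simp add: ennreal_mult_less_top)
    finally show ?thesis by (simp add: ennreal_mult_less_top)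
  qed
  finally have "(\<integral>\<^sup>+ x. \<rho> x * ennreal ((1 + norm x) powr \<gamma>) \<partial>lborel) < \<infinity>"
    by (simp add: W_def)
  moreover have "0 \<le> 2 * K" using K(1) by simp
  ultimately show thesis
    by (intro that[of \<rho> "2 * K"] \<rho>_meas \<rho>_le \<rho>_ge \<rho>_conv)
qed

section \<open>A Volterra inequality\<close>

text \<open>
  Inserting the inequality into itself \<open>n\<close> times improves the bound \<open>M\<close> to \<open>M (C t)\<^sup>n / n!\<close>.
\<close>

lemma volterra_iteration:
  fixes \<phi> :: "real \<Rightarrow> ennreal" and C M T :: real
  assumes [measurable]: "\<phi> \<in> borel_measurable borel" and "0 \<le> C" "0 \<le> M"
    and bound: "AE t in lborel. 0 < t \<and> t < T \<longrightarrow> \<phi> t \<le> ennreal M"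
    and volterra: "AE t in lborel. 0 < t \<and> t < T \<longrightarrow> \<phi> t \<le> ennreal C * (\<integral>\<^sup>+ s. indicator {0<..t} s * \<phi> s \<partial>lborel)"
  shows "AE t in lborel. 0 < t \<and> t < T \<longrightarrow> \<phi> t = 0"
proof -
  have "AE t in lborel. 0 < t \<and> t < T \<longrightarrow> \<phi> t \<le> ennreal (M * ((C * t) ^ n / fact n))" for n
  proof (induction n)
    case 0
    show ?case using bound by simp
  next
    case (Suc n)
    from volterra show ?case
    proof eventually_elim
      case (elim t)
      show ?case
      proof
        assume t: "0 < t \<and> t < T"
        have "(\<integral>\<^sup>+ s. indicator {0<..t} s * \<phi> s \<partial>lborel) \<le>
            (\<integral>\<^sup>+ s. ennreal (M * ((C * s) ^ n / fact n)) * indicator {0..t} s \<partial>lborel)"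
          using Suc.IH t
          by (intro nn_integral_mono_AE) (auto elim!: eventually_mono simp: indicator_def)
        also have "\<dots> = ennreal (M * (C ^ n * t ^ Suc n / fact (Suc n)) - M * (C ^ n * 0 ^ Suc n / fact (Suc n)))"
        proof (rule nn_integral_FTC_Icc)
          fix s :: real
          have "((\<lambda>s. s ^ Suc n) has_real_derivative real (Suc n) * s ^ n) (at s)"
            using DERIV_pow[of "Suc n" s] by simp
          from DERIV_cmult[OF DERIV_cdivide[OF DERIV_cmult[OF this]]]
          have "((\<lambda>s. M * (C ^ n * s ^ Suc n / fact (Suc n))) has_real_derivative
             M * (C ^ n * (real (Suc n) * s ^ n) / fact (Suc n))) (at s)" .
          also have "M * (C ^ n * (real (Suc n) * s ^ n) / fact (Suc n)) = M * ((C * s) ^ n / fact n)"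
            by (simp add: power_mult_distrib field_simps del: of_nat_Suc)
          finally show "((\<lambda>s. M * (C ^ n * s ^ Suc n / fact (Suc n))) has_real_derivative
             M * ((C * s) ^ n / fact n)) (at s)" .
          show "0 \<le> M * ((C * s) ^ n / fact n)" if "s \<in> {0..t}"
            using assms(2,3) that by simp
        qed (use t in auto)
        finally have "\<phi> t \<le> ennreal C * ennreal (M * (C ^ n * t ^ Suc n / fact (Suc n)))"
          using elim t by (auto elim!: order_trans intro!: mult_left_mono)
        also have "\<dots> = ennreal (M * ((C * t) ^ Suc n / fact (Suc n)))"
          using assms(2,3) t by (subst ennreal_mult[symmetric]) (auto simp: power_mult_distrib mult_ac)
        finally show "\<phi> t \<le> ennreal (M * ((C * t) ^ Suc n / fact (Suc n)))" .
      qed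
    qed
  qed
  then have "AE t in lborel. \<forall>n. 0 < t \<and> t < T \<longrightarrow> \<phi> t \<le> ennreal (M * ((C * t) ^ n / fact n))"
    by (subst AE_all_countable) blast
  then show ?thesis
  proof eventually_elim
    case (elim t)
    show ?case
    proof
      assume t: "0 < t \<and> t < T"
      have "(\<lambda>n. (C * t) ^ n / fact n) \<longlonglongrightarrow> 0"
        using summable_LIMSEQ_zero[OF summable_exp[of "C * t"]] by (simp add: field_simps)
      then have "(\<lambda>n. ennreal (M * ((C * t) ^ n / fact n))) \<longlonglongrightarrow> ennreal (M * 0)"
        by (intro tendsto_ennrealI tendsto_mult tendsto_const)
      then have "\<phi> t \<le> ennreal (M * 0)"
        by (rule LIMSEQ_le_const) (use elim t in auto)
      then show "\<phi> t = 0" by simp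
    qed
  qed
qed

section \<open>Slices of Lebesgue measurable functions\<close>

lemma AE_swap_lborel:
  fixes P :: "'a::euclidean_space \<times> 'b::euclidean_space \<Rightarrow> bool"
  assumes "AE z in lborel. P z"
  shows "AE t in lborel. AE x in lborel. P (x, t)"
proof -
  obtain N where N: "N \<in> null_sets lborel" "{z. \<not> P z} \<subseteq> N"
    using assms by (auto simp: eventually_ae_filter)
  have sets: "N \<in> sets ((lborel :: 'a measure) \<Otimes>\<^sub>M (lborel :: 'b measure))"
    using null_setsD2[OF N(1)] by (simp only: lborel_prod)
  have "AE z in (lborel :: 'a measure) \<Otimes>\<^sub>M (lborel :: 'b measure). z \<notin> N"
    using AE_not_in[OF N(1)] by (simp only: lborel_prod)
  from lborel_pair.AE_pair[OF this]
  have "AE x in lborel. AE t in lborel. (x, t) \<notin> N" .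
  then have "AE t in lborel. AE x in lborel. (x, t) \<notin> N"
  proof (subst lborel_pair.AE_commute[symmetric])
    show "{z \<in> space ((lborel :: 'a measure) \<Otimes>\<^sub>M (lborel :: 'b measure)). (fst z, snd z) \<notin> N} \<in>
        sets ((lborel :: 'a measure) \<Otimes>\<^sub>M (lborel :: 'b measure))"
      using sets.compl_sets[OF sets] by (simp add: set_diff_eq)
  qed
  then show ?thesis
    by (rule eventually_mono) (erule eventually_mono, use N(2) in blast)
qed

lemma lebesgue_measurable_cong_AE:
  fixes f g :: "'a::euclidean_space \<Rightarrow> real"
  assumes g: "g \<in> borel_measurable lebesgue" and eq: "AE x in lebesgue. f x = g x"
  shows "f \<in> borel_measurable lebesgue"
proof (rule measurableI)
  fix A :: "real set"
  assume A: "A \<in> sets borel"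
  have "AE x in lebesgue. (x \<in> g -` A \<inter> space lebesgue) = (x \<in> f -` A \<inter> space lebesgue)"
    using eq by eventually_elim simp
  from completion.in_sets_AE[OF this measurable_sets[OF g A]]
  show "f -` A \<inter> space lebesgue \<in> sets lebesgue" by simp
qed simp

text \<open>
  Lebesgue measure on the product is the completion of the product measure, so a slice of \<open>F\<close> is
  measurable only for almost every \<open>t\<close>; the proof compares \<open>F\<close> with a Borel version. The outer integral
  refers to the complete measure, because the inner one is arbitrary on a null set of times.
\<close>

lemma lebesgue_Fubini_snd:
  fixes F :: "'a::euclidean_space \<times> 'b::euclidean_space \<Rightarrow> real"
  assumes F: "integrable lebesgue F"
  shows "integrable lebesgue (\<lambda>t. LINT x|lebesgue. F (x, t))"
    and "(LINT z|lebesgue. F z) = (LINT t|lebesgue. LINT x|lebesgue. F (x, t))"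
proof -
  obtain F' where F'[measurable]: "F' \<in> borel_measurable lborel" and eq: "AE z in lborel. F z = F' z"
    using completion_ex_borel_measurable_real[OF borel_measurable_integrable[OF F]] by auto
  have eq_l: "AE z in lebesgue. F z = F' z" by (rule AE_completion[OF eq])
  have F'_meas: "F' \<in> borel_measurable lebesgue" by (rule measurable_completion[OF F'])
  have "integrable lebesgue F'"
    using F eq_l by (subst integrable_cong_AE[OF F'_meas borel_measurable_integrable[OF F]]) auto
  then have intF': "integrable lborel F'" by (simp add: integrable_completion)
  then have int2: "integrable ((lborel :: 'a measure) \<Otimes>\<^sub>M (lborel :: 'b measure)) (case_prod (\<lambda>x t. F' (x, t)))"
    by (simp add: lborel_prod)
  define G where "G t = (LINT x|lborel. F' (x, t))" for t
  have intG: "integrable lborel G" unfolding G_def by (rule lborel_pair.integrable_snd[OF int2])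
  have G_eq: "(LINT t|lborel. G t) = (LINT z|lborel. F' z)"
    using lborel_pair.integral_snd[OF int2] by (simp add: G_def lborel_prod)
  have "AE t in lborel. (LINT x|lebesgue. F (x, t)) = G t"
    using AE_swap_lborel[OF eq]
  proof eventually_elim
    case (elim t)
    have "(\<lambda>x. F' (x, t)) \<in> borel_measurable lborel" by measurable
    then have m: "(\<lambda>x. F' (x, t)) \<in> borel_measurable lebesgue" by (rule measurable_completion)
    have ae: "AE x in lebesgue. F (x, t) = F' (x, t)" by (rule AE_completion[OF elim])
    have "(LINT x|lebesgue. F (x, t)) = (LINT x|lebesgue. F' (x, t))"
      by (rule integral_cong_AE[OF lebesgue_measurable_cong_AE[OF m ae] m ae])
    also have "\<dots> = G t" unfolding G_def by (rule integral_completion) measurable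
    finally show ?case .
  qed
  then have ae: "AE t in lebesgue. (LINT x|lebesgue. F (x, t)) = G t" by (rule AE_completion)
  have Gm: "G \<in> borel_measurable lebesgue"
    by (rule measurable_completion[OF borel_measurable_integrable[OF intG]])
  note m = lebesgue_measurable_cong_AE[OF Gm ae]
  have "integrable lebesgue G"
    by (rule integrable_completion[THEN iffD2, OF borel_measurable_integrable[OF intG] intG])
  then show "integrable lebesgue (\<lambda>t. LINT x|lebesgue. F (x, t))"
    by (subst integrable_cong_AE[OF m Gm ae])
  have "(LINT t|lebesgue. LINT x|lebesgue. F (x, t)) = (LINT t|lebesgue. G t)"
    by (rule integral_cong_AE[OF m Gm ae])
  also have "\<dots> = (LINT t|lborel. G t)"
    by (rule integral_completion[OF borel_measurable_integrable[OF intG]])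
  also have "\<dots> = (LINT z|lebesgue. F' z)" by (simp add: G_eq integral_completion)
  also have "\<dots> = (LINT z|lebesgue. F z)"
    using eq_l by (intro integral_cong_AE[OF F'_meas borel_measurable_integrable[OF F]]) auto
  finally show "(LINT z|lebesgue. F z) = (LINT t|lebesgue. LINT x|lebesgue. F (x, t))" ..
qed

section \<open>Smooth cutoffs of boxes\<close>

lemma flat_exp_bounds: "0 \<le> flat_exp 1 s" "flat_exp 1 s \<le> 1" "0 < flat_exp 1 s \<longleftrightarrow> 0 < s"
  by (auto simp: flat_exp_1)

text \<open>
  A smooth transition from \<open>0\<close> on \<open>(-\<infinity>, 0]\<close> to \<open>1\<close> on \<open>[1, \<infinity>)\<close>.
\<close>

definition smooth_step :: "real \<Rightarrow> real" where
  "smooth_step s = flat_exp 1 s * inverse (flat_exp 1 s + flat_exp 1 (1 - s))"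

lemma smooth_step_denominator: "0 < flat_exp 1 s + flat_exp 1 (1 - s)"
  using flat_exp_bounds[of s] flat_exp_bounds[of "1 - s"] by (cases "0 < s") auto

lemma smooth_step_values:
  "0 \<le> smooth_step s" "smooth_step s \<le> 1" "s \<le> 0 \<Longrightarrow> smooth_step s = 0" "1 \<le> s \<Longrightarrow> smooth_step s = 1"
  using smooth_step_denominator[of s] flat_exp_bounds[of s] flat_exp_bounds[of "1 - s"]
  by (auto simp: smooth_step_def field_simps flat_exp_1)

lemma k_smooth_step:
  assumes "k_smooth k f"
  shows "k_smooth k (\<lambda>z. smooth_step (f z))"
  unfolding smooth_step_def using smooth_step_denominator
  by (intro k_smooth_mult k_smooth_inverse k_smooth_add k_smooth_flat_exp assms k_smooth_diff k_smooth_const)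
    (auto simp: less_imp_neq[THEN not_sym])

lemma smooth_step_derivative:
  obtains h B where "\<And>s. (smooth_step has_real_derivative h s) (at s)" "continuous_on UNIV h"
    "\<And>s. s \<notin> {0..1} \<Longrightarrow> h s = 0" "\<And>s. \<bar>h s\<bar> \<le> B"
proof -
  have "k_smooth 1 smooth_step"
    using k_smooth_step[OF k_smooth_bounded_linear[OF bounded_linear_ident]] by simp
  then have sm: "k_smooth (Suc 0) smooth_step" by simp
  define h where "h s = frechet_derivative smooth_step (at s) 1" for s
  have h: "(smooth_step has_real_derivative h s) (at s)" for s
  proof -
    have D: "(smooth_step has_derivative frechet_derivative smooth_step (at s)) (at s)"
      using sm by (simp add: frechet_derivative_works[symmetric])
    have "frechet_derivative smooth_step (at s) = (*) (h s)"
    proof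
      fix x
      show "frechet_derivative smooth_step (at s) x = h s * x"
        using linear_scale[OF has_derivative_linear[OF D], of x 1] by (simp add: h_def)
    qed
    with D show ?thesis by (simp add: has_field_derivative_def)
  qed
  have hc: "continuous_on UNIV h" using sm by (simp add: h_def[abs_def])
  have h0: "h s = 0" if "s \<notin> {0..1}" for s
  proof -
    have "((\<lambda>_. if s < 0 then 0 else 1) has_real_derivative 0) (at s)" by simp
    then have "(smooth_step has_real_derivative 0) (at s)"
      by (rule has_field_derivative_transform_within_open[where S = "if s < 0 then {..<0} else {1<..}"])
        (use that smooth_step_values in \<open>auto simp: not_le split: if_splits\<close>)
    with h show ?thesis by (rule DERIV_unique)
  qed
  have "compact (h ` {0..1})"
    by (intro compact_continuous_image continuous_on_subset[OF hc]) auto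
  then obtain B where B: "\<And>s. s \<in> {0..1} \<Longrightarrow> \<bar>h s\<bar> \<le> B"
    by (metis compact_imp_bounded bounded_iff imageI real_norm_def)
  have "0 \<le> B" using B[of 0] by auto
  then have "\<bar>h s\<bar> \<le> B" for s using B h0 by (cases "s \<in> {0..1}") auto
  with h hc h0 show thesis by (rule that)
qed

definition box_bump :: "real ^ 'n \<Rightarrow> real ^ 'n \<Rightarrow> real ^ 'n \<Rightarrow> real" where
  "box_bump l r x = (\<Prod>i\<in>UNIV. flat_exp 1 (x $ i - l $ i) * flat_exp 1 (r $ i - x $ i))"

text \<open>
  Smooth functions that increase with \<open>n\<close> to the indicator of the open box: where the bump \<open>\<beta>\<close> is positive,
  \<open>exp (- 1 / (n \<beta>))\<close> tends to \<open>1\<close>.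
\<close>

definition box_cutoff :: "real ^ 'n \<Rightarrow> real ^ 'n \<Rightarrow> nat \<Rightarrow> real ^ 'n \<Rightarrow> real" where
  "box_cutoff l r n x = flat_exp 1 (real n * box_bump l r x)"

lemma box_bump_nonneg: "0 \<le> box_bump l r x"
  unfolding box_bump_def by (intro prod_nonneg mult_nonneg_nonneg flat_exp_bounds)

lemma box_bump_pos_iff: "0 < box_bump l r x \<longleftrightarrow> x \<in> box l r"
proof -
  have "0 < box_bump l r x \<longleftrightarrow> box_bump l r x \<noteq> 0" using box_bump_nonneg[of l r x] by auto
  also have "\<dots> \<longleftrightarrow> (\<forall>i. flat_exp 1 (x $ i - l $ i) \<noteq> 0 \<and> flat_exp 1 (r $ i - x $ i) \<noteq> 0)"
    by (auto simp: box_bump_def)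
  also have "\<dots> \<longleftrightarrow> (\<forall>i. 0 < flat_exp 1 (x $ i - l $ i) \<and> 0 < flat_exp 1 (r $ i - x $ i))"
    using flat_exp_bounds(1) by (metis less_le)
  finally show ?thesis by (simp add: flat_exp_bounds mem_box_cart)
qed

lemma box_cutoff_values:
  "0 \<le> box_cutoff l r n x" "box_cutoff l r n x \<le> 1" "x \<notin> box l r \<Longrightarrow> box_cutoff l r n x = 0"
proof -
  show "x \<notin> box l r \<Longrightarrow> box_cutoff l r n x = 0"
    using box_bump_pos_iff[of l r x] box_bump_nonneg[of l r x] by (simp add: box_cutoff_def flat_exp_1)
qed (auto simp: box_cutoff_def flat_exp_bounds)

lemma box_cutoff_tendsto: "(\<lambda>n. box_cutoff l r n x) \<longlonglongrightarrow> indicator (box l r) x"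
proof (cases "x \<in> box l r")
  case True
  then have pos: "0 < box_bump l r x" by (simp add: box_bump_pos_iff)
  have "(\<lambda>n. exp (- (1 / box_bump l r x * inverse (real n)))) \<longlonglongrightarrow> exp (- (1 / box_bump l r x * 0))"
    by (intro tendsto_intros lim_inverse_n)
  then have "(\<lambda>n. exp (- (1 / box_bump l r x * inverse (real n)))) \<longlonglongrightarrow> 1" by simp
  moreover have "\<forall>\<^sub>F n in sequentially. exp (- (1 / box_bump l r x * inverse (real n))) = box_cutoff l r n x"
    using eventually_gt_at_top[of 0]
    by eventually_elim
      (use pos in \<open>auto simp: box_cutoff_def flat_exp_1 field_simps zero_less_mult_iff mult_le_0_iff\<close>)
  ultimately have "(\<lambda>n. box_cutoff l r n x) \<longlonglongrightarrow> 1" by (rule Lim_transform_eventually)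
  with True show ?thesis by simp
qed (simp add: box_cutoff_values)

lemma k_smooth_box_cutoff:
  fixes l r :: "real ^ 'n"
  shows "k_smooth k (\<lambda>z :: (real ^ 'n) \<times> real. box_cutoff l r n (fst z))"
proof -
  have "bounded_linear (\<lambda>z :: (real ^ 'n) \<times> real. fst z $ i)" for i
    by (intro bounded_linear_compose[OF bounded_linear_vec_nth] bounded_linear_fst)
  then show ?thesis
    unfolding box_cutoff_def box_bump_def
    by (intro k_smooth_flat_exp k_smooth_mult k_smooth_const k_smooth_prod k_smooth_diff k_smooth_bounded_linear)
qed

lemma box_cutoff_borel: "box_cutoff l r n \<in> borel_measurable borel"
proof -
  have "continuous_on UNIV (\<lambda>x. box_cutoff l r n (fst (x, 0::real)))"
    by (rule continuous_on_compose2[OF k_smooth_continuous[OF k_smooth_box_cutoff]])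
      (auto intro!: continuous_intros)
  then show ?thesis by (simp add: borel_measurable_continuous_onI)
qed

section \<open>From the weak to the integrated equation\<close>

lemma lebesgue_of_borel: "f \<in> borel_measurable borel \<Longrightarrow> f \<in> borel_measurable lebesgue"
  by (rule measurable_completion) simp

lemma set_integrable_lebesgue_cutoff:
  fixes v :: "'a::euclidean_space \<Rightarrow> real"
  assumes v: "v absolutely_integrable_on K" and \<psi>: "\<psi> \<in> borel_measurable borel"
    and bound: "\<And>z. \<bar>\<psi> z\<bar> \<le> C" and supp: "\<And>z. z \<notin> K \<Longrightarrow> \<psi> z = 0"
  shows "integrable lebesgue (\<lambda>z. v z * \<psi> z)"
proof -
  have eq: "(\<lambda>z. v z * \<psi> z) = (\<lambda>z. (indicator K z *\<^sub>R v z) * \<psi> z)"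
    using supp by (auto simp: fun_eq_iff indicator_def)
  have i: "integrable lebesgue (\<lambda>z. indicator K z *\<^sub>R v z)"
    using v by (simp add: set_integrable_def)
  have "integrable lebesgue (\<lambda>z. C * (indicator K z *\<^sub>R v z))" by (intro integrable_mult_right i)
  then show ?thesis unfolding eq
  proof (rule Bochner_Integration.integrable_bound)
    show "(\<lambda>z. indicator K z *\<^sub>R v z * \<psi> z) \<in> borel_measurable lebesgue"
      by (intro borel_measurable_times borel_measurable_integrable[OF i] lebesgue_of_borel \<psi>)
    have "\<bar>\<psi> z\<bar> \<le> \<bar>C\<bar>" for z using bound[of z] by linarith
    then show "AE z in lebesgue. norm (indicator K z *\<^sub>R v z * \<psi> z) \<le> norm (C * (indicator K z *\<^sub>R v z))"
      by (auto simp: abs_mult mult.commute[of "\<bar>C\<bar>"] intro!: mult_left_mono)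
  qed
qed

text \<open>
  Dominated convergence, with majorant \<open>|v|\<close> on \<open>K\<close>.
\<close>

lemma cutoff_integral_tendsto:
  fixes v :: "'a::euclidean_space \<Rightarrow> real"
  assumes v: "v absolutely_integrable_on K" and \<psi>: "\<And>n::nat. \<psi> n \<in> borel_measurable borel"
    and bound: "\<And>n z. \<bar>\<psi> n z\<bar> \<le> 1" and supp: "\<And>n z. z \<notin> K \<Longrightarrow> \<psi> n z = 0"
    and lim: "\<And>z. (\<lambda>n. \<psi> n z) \<longlonglongrightarrow> indicator S z" and S: "S \<in> sets borel"
  shows "(\<lambda>n. LINT z|lebesgue. v z * \<psi> n z) \<longlonglongrightarrow> (LINT z:S|lebesgue. v z)"
proof -
  have i: "integrable lebesgue (\<lambda>z. indicator K z *\<^sub>R v z)"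
    using v by (simp add: set_integrable_def)
  have ind0: "indicator S z = (0::real)" if "z \<notin> K" for z
    using lim[of z] supp[OF that] by (simp add: LIMSEQ_const_iff)
  have eq: "v z * a = indicator K z *\<^sub>R v z * a" if "z \<notin> K \<longrightarrow> a = 0" for z a
    using that by (auto simp: indicator_def)
  have "(\<lambda>n. LINT z|lebesgue. v z * \<psi> n z) \<longlonglongrightarrow> (LINT z|lebesgue. v z * indicator S z)"
  proof (rule integral_dominated_convergence)
    show "integrable lebesgue (\<lambda>z. \<bar>indicator K z *\<^sub>R v z\<bar>)" by (intro integrable_abs i)
    show "AE z in lebesgue. (\<lambda>n. v z * \<psi> n z) \<longlonglongrightarrow> v z * indicator S z"
      by (intro AE_I2 tendsto_mult tendsto_const lim)
    show "AE z in lebesgue. norm (v z * \<psi> n z) \<le> \<bar>indicator K z *\<^sub>R v z\<bar>" for n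
    proof (rule AE_I2)
      fix z
      show "norm (v z * \<psi> n z) \<le> \<bar>indicator K z *\<^sub>R v z\<bar>"
        using mult_left_mono[OF bound[of n z], of "\<bar>v z\<bar>"] supp[of z n]
        by (cases "z \<in> K") (auto simp: abs_mult)
    qed
    have m: "(\<lambda>z. indicator K z *\<^sub>R v z * a z) \<in> borel_measurable lebesgue"
      if "a \<in> borel_measurable borel" for a
      by (intro borel_measurable_times borel_measurable_integrable[OF i] lebesgue_of_borel that)
    have e1: "(\<lambda>z. v z * \<psi> n z) = (\<lambda>z. indicator K z *\<^sub>R v z * \<psi> n z)" for n
      using supp by (intro ext eq) auto
    have e2: "(\<lambda>z. v z * indicator S z) = (\<lambda>z. indicator K z *\<^sub>R v z * indicator S z)"
      using ind0 by (intro ext eq) auto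
    show "(\<lambda>z. v z * \<psi> n z) \<in> borel_measurable lebesgue" for n
      unfolding e1 by (rule m[OF \<psi>])
    show "(\<lambda>z. v z * indicator S z) \<in> borel_measurable lebesgue"
      unfolding e2 by (rule m[OF borel_measurable_indicator[OF S]])
  qed
  then show ?thesis by (simp add: set_lebesgue_integral_def mult.commute)
qed

text \<open>
  The functions \<open>n h(n (t - \<tau>))\<close>, derivatives of scaled smooth steps, form an approximate identity
  supported in \<open>[\<tau>, \<tau> + 1 / n]\<close>. The spatial cutoffs converge simultaneously; this does no harm because they
  are bounded by \<open>1\<close>, so that continuity of \<open>v\<close> in \<open>L\<^sup>1\<close> of the box controls the time oscillation for all \<open>n\<close> at once.
\<close>

lemma time_mollification:
  fixes v :: "(real ^ 'n) \<times> real \<Rightarrow> real"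
  assumes h: "\<And>s. (smooth_step has_real_derivative h s) (at s)" "continuous_on UNIV h"
    "\<And>s. s \<notin> {0..1} \<Longrightarrow> h s = 0" "\<And>s. \<bar>h s\<bar> \<le> B"
    and \<tau>: "0 \<le> \<tau>"
    and vK: "v absolutely_integrable_on (cbox l r \<times> {\<tau>..\<tau> + 1})"
    and vt: "\<And>t. 0 \<le> t \<Longrightarrow> (\<lambda>x. v (x, t)) absolutely_integrable_on cbox l r"
    and vcont: "((\<lambda>s. LINT x:cbox l r|lebesgue. \<bar>v (x, s) - v (x, \<tau>)\<bar>) \<longlongrightarrow> 0) (at \<tau> within {0..})"
  shows "(\<lambda>n. LINT z|lebesgue. v z * (box_cutoff l r n (fst z) * (real n * h (real n * (snd z - \<tau>)))))
      \<longlonglongrightarrow> (LINT x:box l r|lebesgue. v (x, \<tau>))"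
proof -
  define q where "q n t = real n * h (real n * (t - \<tau>))" for n t
  define V where "V n t = (LINT x|lebesgue. v (x, t) * box_cutoff l r n x)" for n t
  have q_supp: "q n t = 0" if "t \<notin> {\<tau>..\<tau> + 1 / real n}" for n t
  proof (cases "n = 0")
    case False
    then have "real n * (t - \<tau>) \<notin> {0..1}"
      using that by (auto simp: field_simps zero_le_mult_iff)
    then show ?thesis using h(3) by (simp add: q_def)
  qed (simp add: q_def)
  have q_supp1: "q n t = 0" if "t \<notin> {\<tau>..\<tau> + 1}" for n t
  proof (cases "n = 0")
    case False
    then have "1 / real n \<le> 1" by simp
    then have "t \<notin> {\<tau>..\<tau> + 1 / real n}" using that by auto
    then show ?thesis by (rule q_supp)
  qed (simp add: q_def)
  have q_bound: "\<bar>q n t\<bar> \<le> real n * B" for n t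
    unfolding q_def abs_mult using h(4) by (intro mult_mono) auto
  have q_cont: "continuous_on UNIV (q n)" for n
    unfolding q_def by (intro continuous_intros continuous_on_compose2[OF h(2)]) auto
  have q_borel: "q n \<in> borel_measurable borel" for n
    by (rule borel_measurable_continuous_onI[OF q_cont])
  have B0: "0 \<le> B" using h(4)[of 0] by linarith
  have F_int: "integrable lebesgue (\<lambda>z. v z * (box_cutoff l r n (fst z) * q n (snd z)))" for n
  proof (rule set_integrable_lebesgue_cutoff[OF vK, where C = "1 * (real n * B)"])
    note [measurable] = q_borel box_cutoff_borel
    show "(\<lambda>z. box_cutoff l r n (fst z) * q n (snd z)) \<in> borel_measurable borel"
      unfolding borel_prod[symmetric] by measurable
    show "\<bar>box_cutoff l r n (fst z) * q n (snd z)\<bar> \<le> 1 * (real n * B)" for z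
      unfolding abs_mult using box_cutoff_values(1,2)[of l r n "fst z"]
      by (intro mult_mono q_bound) auto
    show "box_cutoff l r n (fst z) * q n (snd z) = 0" if "z \<notin> cbox l r \<times> {\<tau>..\<tau> + 1}" for z
      using that q_supp1 box_cutoff_values(3)[of "fst z" l r n] box_subset_cbox[of l r]
      by (auto simp: mem_Times_iff)
  qed
  have inner: "(LINT x|lebesgue. v (x, t) * (box_cutoff l r n (fst (x, t)) * q n (snd (x, t)))) = V n t * q n t" for n t
    unfolding V_def by (simp add: mult.assoc[symmetric])
  have F_eq: "(LINT z|lebesgue. v z * (box_cutoff l r n (fst z) * q n (snd z))) = (LINT t|lebesgue. V n t * q n t)"
    and VQ_int: "integrable lebesgue (\<lambda>t. V n t * q n t)" for n
    using lebesgue_Fubini_snd[OF F_int[of n]] unfolding inner by auto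
  have q_int: "integrable lebesgue (q n)" and q_one: "n \<noteq> 0 \<Longrightarrow> (LINT t|lebesgue. q n t) = 1" for n
  proof -
    have eq: "q n t * indicator {\<tau>..\<tau> + 1} t = q n t" for t
      using q_supp1[of t n] by (auto simp: indicator_def)
    have deriv: "((\<lambda>t. smooth_step (real n * (t - \<tau>))) has_real_derivative q n t) (at t)" for t
      unfolding q_def
      by (rule DERIV_chain2[OF h(1), THEN DERIV_cong]) (auto intro!: derivative_eq_intros)
    have cont: "isCont (q n) t" for t
      using q_cont by (simp add: continuous_on_eq_continuous_at)
    have hb: "has_bochner_integral lborel (\<lambda>t. q n t * indicator {\<tau>..\<tau> + 1} t)
        (smooth_step (real n * (\<tau> + 1 - \<tau>)) - smooth_step (real n * (\<tau> - \<tau>)))"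
      by (rule has_bochner_integral_FTC_Icc_real[OF _ deriv cont]) simp
    then have i: "integrable lborel (q n)" and e: "(LINT t|lborel. q n t) = smooth_step (real n) - smooth_step 0"
      unfolding eq by (auto simp: has_bochner_integral_iff)
    show "integrable lebesgue (q n)"
      using i q_borel by (simp add: integrable_completion)
    show "(LINT t|lebesgue. q n t) = 1" if "n \<noteq> 0"
      using e q_borel that by (simp add: integral_completion smooth_step_values)
  qed
  have V_lim: "(\<lambda>n. V n \<tau>) \<longlonglongrightarrow> (LINT x:box l r|lebesgue. v (x, \<tau>))"
    unfolding V_def
  proof (rule cutoff_integral_tendsto[OF vt[OF \<tau>]])
    show "\<bar>box_cutoff l r n x\<bar> \<le> 1" for n x using box_cutoff_values(1,2)[of l r n x] by auto
    show "box_cutoff l r n x = 0" if "x \<notin> cbox l r" for n x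
      using that box_subset_cbox[of l r] by (auto intro!: box_cutoff_values)
  qed (auto simp: box_cutoff_borel box_cutoff_tendsto)
  have V_diff: "\<bar>V n t - V n \<tau>\<bar> \<le> (LINT x:cbox l r|lebesgue. \<bar>v (x, t) - v (x, \<tau>)\<bar>)" if t: "0 \<le> t" for n t
  proof -
    have i: "integrable lebesgue (\<lambda>x. v (x, t) * box_cutoff l r n x)" if "0 \<le> t" for t
    proof (rule set_integrable_lebesgue_cutoff[OF vt[OF that] box_cutoff_borel, where C = 1])
      show "\<bar>box_cutoff l r n x\<bar> \<le> 1" for x using box_cutoff_values(1,2)[of l r n x] by auto
      show "box_cutoff l r n x = 0" if "x \<notin> cbox l r" for x
        using that box_subset_cbox[of l r] by (auto intro!: box_cutoff_values)
    qed
    have "V n t - V n \<tau> = (LINT x|lebesgue. v (x, t) * box_cutoff l r n x - v (x, \<tau>) * box_cutoff l r n x)"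
      unfolding V_def by (intro Bochner_Integration.integral_diff[symmetric] i t \<tau>)
    also have "\<bar>\<dots>\<bar> \<le> (LINT x|lebesgue. indicator (cbox l r) x *\<^sub>R \<bar>v (x, t) - v (x, \<tau>)\<bar>)"
    proof (rule integral_abs_bound_integral)
      show "integrable lebesgue (\<lambda>x. v (x, t) * box_cutoff l r n x - v (x, \<tau>) * box_cutoff l r n x)"
        by (intro Bochner_Integration.integrable_diff i t \<tau>)
      have "set_integrable lebesgue (cbox l r) (\<lambda>x. \<bar>v (x, t) - v (x, \<tau>)\<bar>)"
        by (intro set_integrable_abs set_integral_diff(1) vt t \<tau>)
      then show "integrable lebesgue (\<lambda>x. indicator (cbox l r) x *\<^sub>R \<bar>v (x, t) - v (x, \<tau>)\<bar>)"
        by (simp add: set_integrable_def)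
      fix x
      have "\<bar>v (x, t) * box_cutoff l r n x - v (x, \<tau>) * box_cutoff l r n x\<bar> = \<bar>v (x, t) - v (x, \<tau>)\<bar> * box_cutoff l r n x"
        using box_cutoff_values(1)[of l r n x] by (simp add: left_diff_distrib[symmetric] abs_mult)
      also have "\<dots> \<le> \<bar>v (x, t) - v (x, \<tau>)\<bar> * indicator (cbox l r) x"
        using box_cutoff_values(1,2)[of l r n x] box_cutoff_values(3)[of x l r n] box_subset_cbox[of l r]
        by (intro mult_left_mono) (auto simp: indicator_def)
      finally show "\<bar>v (x, t) * box_cutoff l r n x - v (x, \<tau>) * box_cutoff l r n x\<bar>
         \<le> indicator (cbox l r) x *\<^sub>R \<bar>v (x, t) - v (x, \<tau>)\<bar>" by (simp add: mult.commute)
    qed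
    finally show ?thesis by (simp add: set_lebesgue_integral_def)
  qed
  have rest: "(\<lambda>n. LINT t|lebesgue. (V n t - V n \<tau>) * q n t) \<longlonglongrightarrow> 0"
  proof (rule LIMSEQ_I)
    fix e :: real
    assume e: "0 < e"
    (* The kernel q n has mass at most B on an interval of length 1/n and height n B. *)
    define d where "d = e / (2 * (B + 1))"
    have d: "0 < d" "d * B < e" using e B0
      by (auto simp: d_def field_simps intro: add_nonneg_pos)
    have "\<forall>\<^sub>F s in at \<tau> within {0..}. (LINT x:cbox l r|lebesgue. \<bar>v (x, s) - v (x, \<tau>)\<bar>) < d"
      using order_tendstoD(2)[OF vcont d(1)] .
    then obtain \<delta> where \<delta>: "\<delta> > 0" "\<And>s. 0 \<le> s \<Longrightarrow> s \<noteq> \<tau> \<Longrightarrow> dist s \<tau> < \<delta> \<Longrightarrow>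
        (LINT x:cbox l r|lebesgue. \<bar>v (x, s) - v (x, \<tau>)\<bar>) < d"
      unfolding eventually_at by auto
    obtain N :: nat where N: "N > 0" "1 / real N < \<delta>"
      using real_arch_inverse[THEN iffD1, OF \<delta>(1)] by (auto simp: inverse_eq_divide)
    show "\<exists>no. \<forall>n\<ge>no. norm ((LINT t|lebesgue. (V n t - V n \<tau>) * q n t) - 0) < e"
    proof (intro exI[of _ N] allI impI)
      fix n assume n: "N \<le> n"
      then have n0: "0 < n" and n\<delta>: "1 / real n < \<delta>"
        using N by (auto intro: le_less_trans[OF _ N(2)] simp: frac_le)
      have "\<bar>LINT t|lebesgue. (V n t - V n \<tau>) * q n t\<bar>
          \<le> (LINT t|lebesgue. indicator {\<tau>..\<tau> + 1 / real n} t * (d * (real n * B)))"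
      proof (rule integral_abs_bound_integral)
        show "integrable lebesgue (\<lambda>t. (V n t - V n \<tau>) * q n t)"
          unfolding left_diff_distrib
          by (intro Bochner_Integration.integrable_diff VQ_int integrable_mult_right q_int)
        show "integrable lebesgue (\<lambda>t. indicator {\<tau>..\<tau> + 1 / real n} t * (d * (real n * B)))"
          by (intro integrable_mult_left) (simp add: integrable_completion)
        fix t
        show "\<bar>(V n t - V n \<tau>) * q n t\<bar> \<le> indicator {\<tau>..\<tau> + 1 / real n} t * (d * (real n * B))"
        proof (cases "t \<in> {\<tau>..\<tau> + 1 / real n}")
          case True
          then have t: "0 \<le> t" "dist t \<tau> < \<delta>" using \<tau> n\<delta> by (auto simp: dist_real_def)
          have "\<bar>V n t - V n \<tau>\<bar> \<le> d"
            using V_diff[OF t(1), of n] \<delta>(2)[OF t(1) _ t(2)] d(1) by (cases "t = \<tau>") auto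
          then have "\<bar>(V n t - V n \<tau>) * q n t\<bar> \<le> d * (real n * B)"
            unfolding abs_mult using d(1) by (intro mult_mono q_bound) auto
          then show ?thesis using True by simp
        qed (simp add: q_supp)
      qed
      also have "\<dots> = d * B" using n0 by (simp add: integral_completion)
      finally show "norm ((LINT t|lebesgue. (V n t - V n \<tau>) * q n t) - 0) < e" using d(2) by simp
    qed
  qed
  have "(\<lambda>n. (LINT t|lebesgue. (V n t - V n \<tau>) * q n t) + V n \<tau>) \<longlonglongrightarrow> 0 + (LINT x:box l r|lebesgue. v (x, \<tau>))"
    by (intro tendsto_add rest V_lim)
  moreover have "\<forall>\<^sub>F n in sequentially. (LINT t|lebesgue. (V n t - V n \<tau>) * q n t) + V n \<tau> =
      (LINT z|lebesgue. v z * (box_cutoff l r n (fst z) * q n (snd z)))"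
    using eventually_gt_at_top[of 0]
  proof eventually_elim
    case (elim n)
    have "(LINT t|lebesgue. (V n t - V n \<tau>) * q n t) = (LINT t|lebesgue. V n t * q n t) - (LINT t|lebesgue. V n \<tau> * q n t)"
      unfolding left_diff_distrib
      by (intro Bochner_Integration.integral_diff VQ_int integrable_mult_right q_int)
    then show ?case using q_one[of n] elim by (simp add: F_eq)
  qed
  ultimately have "(\<lambda>n. LINT z|lebesgue. v z * (box_cutoff l r n (fst z) * q n (snd z))) \<longlonglongrightarrow>
      0 + (LINT x:box l r|lebesgue. v (x, \<tau>))"
    by (rule Lim_transform_eventually)
  then show ?thesis by (simp add: q_def)
qed

text \<open>
  The test functions are box cutoffs times the difference of two smooth steps, at \<open>a\<close> and at \<open>b\<close>. They
  converge to the indicator of \<open>box l r \<times> (a, b]\<close>, and their time derivatives to the difference of the point masses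
  at the times \<open>a\<close> and \<open>b\<close>.
\<close>

lemma integrated_weak_derivative:
  fixes v g :: "(real ^ 'n) \<times> real \<Rightarrow> real"
  assumes cont: "continuous_L1_loc v" and weak: "weak_time_derivative v g" and ab: "0 < a" "a < b"
  shows "(LINT x:box l r|lebesgue. v (x, b)) - (LINT x:box l r|lebesgue. v (x, a)) =
    (LINT z:box l r \<times> {a<..b}|lebesgue. g z)"
proof -
  obtain h B where h: "\<And>s. (smooth_step has_real_derivative h s) (at s)" "continuous_on UNIV h"
    "\<And>s. s \<notin> {0..1} \<Longrightarrow> h s = 0" "\<And>s. \<bar>h s\<bar> \<le> B"
    using smooth_step_derivative by metis
  define q where "q \<tau> n t = real n * h (real n * (t - \<tau>))" for \<tau> t :: real and n
  define \<eta> where "\<eta> n t = smooth_step (real n * (t - a)) - smooth_step (real n * (t - b))" for n t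
  define \<phi> where "\<phi> n z = box_cutoff l r n (fst z) * \<eta> n (snd z)" for n and z :: "(real ^ 'n) \<times> real"
  define K where "K = cbox l r \<times> {a..b + 1}"
  have K: "compact K" unfolding K_def by (intro compact_Times compact_cbox compact_Icc)
  have K_sp: "K \<subseteq> spacetime" using ab by (auto simp: K_def spacetime_def)
  have \<eta>_deriv: "(\<eta> n has_real_derivative q a n t - q b n t) (at t)" for n t
    unfolding \<eta>_def q_def
    by (rule DERIV_diff; rule DERIV_chain2[OF h(1), THEN DERIV_cong]; auto intro!: derivative_eq_intros)
  have \<eta>_bound: "\<bar>\<eta> n t\<bar> \<le> 1" for n t
    unfolding \<eta>_def using smooth_step_values(1,2)[of "real n * (t - a)"] smooth_step_values(1,2)[of "real n * (t - b)"]
    by linarith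
  have \<eta>_0: "\<eta> n t = 0" if "t \<notin> {a..b + 1}" for n t
  proof (cases "n = 0")
    case False
    from that consider "t < a" | "b + 1 < t" by force
    then show ?thesis
    proof cases
      case 1
      then have "real n * (t - a) \<le> 0" "real n * (t - b) \<le> 0"
        using ab by (auto simp: mult_le_0_iff)
      then show ?thesis by (simp add: \<eta>_def smooth_step_values)
    next
      case 2
      have "1 * 1 \<le> real n * (t - a)" "1 * 1 \<le> real n * (t - b)"
        using 2 ab False by (intro mult_mono; simp)+
      then show ?thesis by (simp add: \<eta>_def smooth_step_values)
    qed
  qed (simp add: \<eta>_def)
  have \<eta>_lim: "(\<lambda>n. \<eta> n t) \<longlonglongrightarrow> indicator {a<..b} t" for t
  proof -
    have step: "(\<lambda>n. smooth_step (real n * (t - \<tau>))) \<longlonglongrightarrow> indicator {\<tau><..} t" for \<tau>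
    proof (cases "\<tau> < t")
      case True
      obtain N :: nat where N: "1 / (t - \<tau>) < real N" using reals_Archimedean2 by blast
      have "smooth_step (real n * (t - \<tau>)) = 1" if "N \<le> n" for n
      proof -
        have "1 / (t - \<tau>) \<le> real n" using N that by linarith
        then show ?thesis using True by (intro smooth_step_values) (simp add: field_simps)
      qed
      then have "\<forall>\<^sub>F n in sequentially. 1 = smooth_step (real n * (t - \<tau>))"
        by (auto simp: eventually_sequentially)
      then have "(\<lambda>n. smooth_step (real n * (t - \<tau>))) \<longlonglongrightarrow> 1"
        by (rule Lim_transform_eventually[OF tendsto_const])
      then show ?thesis using True by simp
    next
      case False
      then have "smooth_step (real n * (t - \<tau>)) = 0" for n
        by (intro smooth_step_values) (simp add: mult_le_0_iff)
      then show ?thesis using False by simp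
    qed
    have "(\<lambda>n. \<eta> n t) \<longlonglongrightarrow> indicator {a<..} t - indicator {b<..} t"
      unfolding \<eta>_def by (intro tendsto_diff step)
    moreover have "indicator {a<..} t - indicator {b<..} t = (indicator {a<..b} t :: real)"
      using ab by (auto simp: indicator_def)
    ultimately show ?thesis by simp
  qed
  have sn: "k_smooth k (\<lambda>z :: (real ^ 'n) \<times> real. real n * (snd z - \<tau>))" for k n \<tau>
    by (intro k_smooth_mult k_smooth_const k_smooth_diff k_smooth_bounded_linear bounded_linear_snd)
  have \<phi>_smooth: "k_smooth k (\<phi> n)" for k n
    unfolding \<phi>_def \<eta>_def
    by (intro k_smooth_mult k_smooth_box_cutoff k_smooth_diff k_smooth_step sn)
  have \<phi>_0: "\<phi> n z = 0" if "z \<notin> K" for n z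
    using that \<eta>_0 box_cutoff_values(3)[of "fst z" l r n] box_subset_cbox[of l r]
    by (auto simp: \<phi>_def K_def mem_Times_iff)
  have supp: "closure {z. \<phi> n z \<noteq> 0} \<subseteq> K" for n
    using \<phi>_0 by (intro closure_minimal compact_imp_closed K) auto
  then have test: "test_function_on spacetime (\<phi> n)" for n
    unfolding test_function_on_def
  proof (intro conjI allI)
    have "compact (K \<inter> closure {z. \<phi> n z \<noteq> 0})" by (rule compact_Int_closed[OF K closed_closure])
    then show "compact (closure {z. \<phi> n z \<noteq> 0})" using supp[of n] by (simp add: inf.absorb2)
    show "closure {z. \<phi> n z \<noteq> 0} \<subseteq> spacetime" using supp[of n] K_sp by (rule order_trans)
  qed (rule \<phi>_smooth)
  have \<phi>_t: "frechet_derivative (\<phi> n) (at z) (0, 1) = box_cutoff l r n (fst z) * (q a n (snd z) - q b n (snd z))" for n z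
  proof -
    have "((\<lambda>t. \<phi> n (fst z, t)) has_real_derivative frechet_derivative (\<phi> n) (at (fst z, snd z)) (0, 1)) (at (snd z))"
      by (rule frechet_time_derivative \<phi>_smooth)+
    moreover have "((\<lambda>t. \<phi> n (fst z, t)) has_real_derivative box_cutoff l r n (fst z) * (q a n (snd z) - q b n (snd z))) (at (snd z))"
      unfolding \<phi>_def fst_conv snd_conv by (rule DERIV_cmult[OF \<eta>_deriv])
    ultimately show ?thesis by (simp add: DERIV_unique)
  qed
  have vloc: "v locally_integrable_on spacetime" and gloc: "g locally_integrable_on spacetime"
    using weak by (auto simp: weak_time_derivative_def)
  have vt: "(\<lambda>x. v (x, t)) absolutely_integrable_on cbox l r" if "0 \<le> t" for t
    using cont that by (auto simp: continuous_L1_loc_def locally_integrable_on_def)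
  have mol: "(\<lambda>n. LINT z|lebesgue. v z * (box_cutoff l r n (fst z) * q \<tau> n (snd z)))
      \<longlonglongrightarrow> (LINT x:box l r|lebesgue. v (x, \<tau>))" if "0 < \<tau>" for \<tau>
    unfolding q_def
  proof (rule time_mollification[OF h])
    have "compact (cbox l r \<times> {\<tau>..\<tau> + 1})" by (intro compact_Times compact_cbox compact_Icc)
    then show "v absolutely_integrable_on cbox l r \<times> {\<tau>..\<tau> + 1}"
      using vloc that by (auto simp: locally_integrable_on_def spacetime_def)
    show "((\<lambda>s. LINT x:cbox l r|lebesgue. \<bar>v (x, s) - v (x, \<tau>)\<bar>) \<longlongrightarrow> 0) (at \<tau> within {0..})"
      using cont that by (auto simp: continuous_L1_loc_def)
  qed (use that vt in auto)
  have q_cont: "continuous_on UNIV (q \<tau> n)" for \<tau> n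
    unfolding q_def by (intro continuous_intros continuous_on_compose2[OF h(2)]) auto
  have q_bound: "\<bar>q \<tau> n t\<bar> \<le> real n * B" for \<tau> n t
    unfolding q_def abs_mult using h(4) by (intro mult_mono) auto
  have q_supp: "q \<tau> n t = 0" if "t \<notin> {\<tau>..\<tau> + 1}" for \<tau> n t
  proof (cases "n = 0")
    case False
    from that consider "t < \<tau>" | "\<tau> + 1 < t" by force
    then have "real n * (t - \<tau>) \<notin> {0..1}"
    proof cases
      case 1
      then show ?thesis using False by (auto simp: zero_le_mult_iff)
    next
      case 2
      have "1 * 1 < real n * (t - \<tau>)" using 2 False by (intro mult_le_less_imp_less) auto
      then show ?thesis by simp
    qed
    then show ?thesis using h(3) by (simp add: q_def)
  qed (simp add: q_def)
  have F_int: "integrable lebesgue (\<lambda>z. v z * (box_cutoff l r n (fst z) * q \<tau> n (snd z)))" if "0 < \<tau>" for n \<tau>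
  proof (rule set_integrable_lebesgue_cutoff[where C = "1 * (real n * B)"])
    have "compact (cbox l r \<times> {\<tau>..\<tau> + 1})" by (intro compact_Times compact_cbox compact_Icc)
    then show "v absolutely_integrable_on cbox l r \<times> {\<tau>..\<tau> + 1}"
      using vloc that by (auto simp: locally_integrable_on_def spacetime_def)
    note [measurable] = borel_measurable_continuous_onI[OF q_cont] box_cutoff_borel
    show "(\<lambda>z. box_cutoff l r n (fst z) * q \<tau> n (snd z)) \<in> borel_measurable borel"
      unfolding borel_prod[symmetric] by measurable
    show "\<bar>box_cutoff l r n (fst z) * q \<tau> n (snd z)\<bar> \<le> 1 * (real n * B)" for z
      unfolding abs_mult using box_cutoff_values(1,2)[of l r n "fst z"]
      by (intro mult_mono q_bound) auto
    show "box_cutoff l r n (fst z) * q \<tau> n (snd z) = 0" if "z \<notin> cbox l r \<times> {\<tau>..\<tau> + 1}" for z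
      using that q_supp box_cutoff_values(3)[of "fst z" l r n] box_subset_cbox[of l r]
      by (auto simp: mem_Times_iff)
  qed
  have b0: "0 < b" using ab by simp
  have "(LINT z|lebesgue. v z * frechet_derivative (\<phi> n) (at z) (0, 1)) =
      (LINT z|lebesgue. v z * (box_cutoff l r n (fst z) * q a n (snd z))) -
      (LINT z|lebesgue. v z * (box_cutoff l r n (fst z) * q b n (snd z)))" for n
    unfolding \<phi>_t right_diff_distrib
    by (intro Bochner_Integration.integral_diff F_int ab b0)
  then have "(\<lambda>n. LINT z|lebesgue. v z * frechet_derivative (\<phi> n) (at z) (0, 1)) \<longlonglongrightarrow>
      (LINT x:box l r|lebesgue. v (x, a)) - (LINT x:box l r|lebesgue. v (x, b))"
    by (simp only:) (intro tendsto_diff mol ab b0)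
  moreover have "(LINT z|lebesgue. v z * frechet_derivative (\<phi> n) (at z) (0, 1)) = - (LINT z|lebesgue. g z * \<phi> n z)" for n
    using weak test by (simp add: weak_time_derivative_def)
  ultimately have lim1: "(\<lambda>n. - (LINT z|lebesgue. g z * \<phi> n z)) \<longlonglongrightarrow>
      (LINT x:box l r|lebesgue. v (x, a)) - (LINT x:box l r|lebesgue. v (x, b))"
    by simp
  have "(\<lambda>n. LINT z|lebesgue. g z * \<phi> n z) \<longlonglongrightarrow> (LINT z:box l r \<times> {a<..b}|lebesgue. g z)"
  proof (rule cutoff_integral_tendsto)
    show "g absolutely_integrable_on K" using gloc K K_sp by (simp add: locally_integrable_on_def)
    show "\<phi> n \<in> borel_measurable borel" for n
      by (rule borel_measurable_continuous_onI[OF k_smooth_continuous[OF \<phi>_smooth]])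
    show "\<bar>\<phi> n z\<bar> \<le> 1" for n z
      unfolding \<phi>_def abs_mult using box_cutoff_values(1,2)[of l r n "fst z"] \<eta>_bound
      by (intro mult_le_one) auto
    show "(\<lambda>n. \<phi> n z) \<longlonglongrightarrow> indicator (box l r \<times> {a<..b}) z" for z
    proof -
      have "(\<lambda>n. \<phi> n z) \<longlonglongrightarrow> indicator (box l r) (fst z) * indicator {a<..b} (snd z)"
        unfolding \<phi>_def by (intro tendsto_mult box_cutoff_tendsto \<eta>_lim)
      moreover have "indicator (box l r) (fst z) * indicator {a<..b} (snd z) = (indicator (box l r \<times> {a<..b}) z :: real)"
        by (auto simp: indicator_def mem_Times_iff)
      ultimately show ?thesis by simp
    qed
    show "box l r \<times> {a<..b} \<in> sets borel" by (intro borel_Times) auto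
  qed (rule \<phi>_0)
  then have lim2: "(\<lambda>n. - (LINT z|lebesgue. g z * \<phi> n z)) \<longlonglongrightarrow> - (LINT z:box l r \<times> {a<..b}|lebesgue. g z)"
    by (rule tendsto_minus)
  show ?thesis using LIMSEQ_unique[OF lim1 lim2] by simp
qed

text \<open>
  The positive and the negative part of \<open>f\<close> are densities of two measures that agree on boxes. Boxes generate
  the Borel sets and are stable under intersection, so the measures, and hence the densities, agree.
\<close>

lemma AE_eq_0_if_box_integrals_eq_0:
  fixes f :: "'a::euclidean_space \<Rightarrow> real"
  assumes f: "integrable lborel f" and zero: "\<And>l r. (LINT x:box l r|lborel. f x) = 0"
  shows "AE x in lborel. f x = 0"
proof -
  have [measurable]: "f \<in> borel_measurable borel" using f by simp
  define M where "M s = density lborel (\<lambda>x. ennreal (s * f x))" for s :: real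
  have em: "emeasure (M s) (box l r) = (\<integral>\<^sup>+x. ennreal (s * (indicator (box l r) x * f x)) \<partial>lborel)" for s l r
    unfolding M_def by (subst emeasure_density) (auto intro!: nn_integral_cong simp: indicator_def)
  have i: "integrable lborel (\<lambda>x. indicator (box l r) x * f x)" for l r
    using integrable_mult_indicator[OF _ f, of "box l r"] by simp
  have fin: "(\<integral>\<^sup>+x. ennreal (s * (indicator (box l r) x * f x)) \<partial>lborel) \<noteq> \<infinity>" for s l r
    using integrable_mult_right[OF i[of l r], of s] unfolding real_integrable_def by blast
  have eq: "M 1 = M (-1)"
  proof (rule measure_eqI_generator_eq)
    let ?E = "range (\<lambda>(a, b). box a b::'a set)"
    show "Int_stable ?E" by (auto simp: Int_stable_def box_Int_box)
    show "?E \<subseteq> Pow UNIV" "sets (M 1) = sigma_sets UNIV ?E" "sets (M (-1)) = sigma_sets UNIV ?E"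
      by (simp_all add: borel_eq_box M_def)
    let ?A = "\<lambda>n::nat. box (- (real n *\<^sub>R One)) (real n *\<^sub>R One) :: 'a set"
    show "range ?A \<subseteq> ?E" "(\<Union>i. ?A i) = UNIV" unfolding UN_box_eq_UNIV by auto
    show "emeasure (M 1) (?A i) \<noteq> \<infinity>" for i unfolding em by (rule fin)
    fix X assume "X \<in> ?E"
    then obtain l r where X: "X = box l r" by auto
    have "(LINT x|lborel. indicator (box l r) x * f x) = 0"
      using zero[of l r] by (simp add: set_lebesgue_integral_def)
    then have "enn2real (\<integral>\<^sup>+x. ennreal (indicator (box l r) x * f x) \<partial>lborel) =
        enn2real (\<integral>\<^sup>+x. ennreal (- (indicator (box l r) x * f x)) \<partial>lborel)"
      using real_lebesgue_integral_def[OF i[of l r]] by simp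
    then have "enn2real (emeasure (M 1) X) = enn2real (emeasure (M (-1)) X)"
      by (simp add: X em)
    moreover have "emeasure (M 1) X \<noteq> \<infinity>" "emeasure (M (-1)) X \<noteq> \<infinity>"
      unfolding X em by (rule fin)+
    ultimately show "emeasure (M 1) X = emeasure (M (-1)) X"
      by (metis ennreal_enn2real infinity_ennreal_def top.not_eq_extremum)
  qed
  have "AE x in lborel. ennreal (1 * f x) = ennreal (-1 * f x)"
    using eq unfolding M_def by (intro sigma_finite_measure.density_unique[OF sigma_finite_lborel]) auto
  then show ?thesis
  proof eventually_elim
    case (elim x)
    then show ?case by (cases "0 \<le> f x") (auto simp: ennreal_neg)
  qed
qed

lemma spacetime_exhaustion:
  obtains K :: "nat \<Rightarrow> ((real ^ 'n) \<times> real) set" where "\<And>n. compact (K n)" "\<And>n. K n \<subseteq> spacetime"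
    "\<And>z. z \<in> spacetime \<Longrightarrow> \<forall>\<^sub>F n in sequentially. z \<in> K n"
proof
  define K :: "nat \<Rightarrow> ((real ^ 'n) \<times> real) set" where
    "K n = cball 0 (real n) \<times> {inverse (real (Suc n))..real n}" for n
  show "compact (K n)" for n unfolding K_def by (intro compact_Times compact_cball compact_Icc)
  show "K n \<subseteq> spacetime" for n
    by (auto simp: K_def spacetime_def intro: less_le_trans[OF positive_imp_inverse_positive, rotated])
  fix z :: "(real ^ 'n) \<times> real"
  assume z: "z \<in> spacetime"
  have 1: "\<forall>\<^sub>F n in sequentially. norm (fst z) \<le> real n" "\<forall>\<^sub>F n in sequentially. snd z \<le> real n"
    using filterlim_real_sequentially by (auto simp: filterlim_at_top)
  have 2: "\<forall>\<^sub>F n in sequentially. inverse (real (Suc n)) < snd z"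
    using order_tendstoD(2)[OF LIMSEQ_inverse_real_of_nat, of "snd z"] z by (auto simp: spacetime_def)
  show "\<forall>\<^sub>F n in sequentially. z \<in> K n"
    using 1 2 by eventually_elim (auto simp: K_def mem_Times_iff)
qed

text \<open>
  Tonelli's theorem for the product measure requires Borel functions.
\<close>

lemma locally_integrable_borel_version:
  fixes f :: "(real ^ 'n) \<times> real \<Rightarrow> real"
  assumes "f locally_integrable_on spacetime"
  obtains f' where "f' \<in> borel_measurable borel" "AE z in lborel. 0 < snd z \<longrightarrow> f z = f' z"
proof -
  obtain K :: "nat \<Rightarrow> ((real ^ 'n) \<times> real) set" where K: "\<And>n. compact (K n)" "\<And>n. K n \<subseteq> spacetime"
    "\<And>z. z \<in> spacetime \<Longrightarrow> \<forall>\<^sub>F n in sequentially. z \<in> K n"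
    using spacetime_exhaustion by metis
  have "(\<lambda>z. indicator spacetime z * f z) \<in> borel_measurable lebesgue"
  proof (rule borel_measurable_LIMSEQ_real)
    show "(\<lambda>z. indicator (K n) z *\<^sub>R f z) \<in> borel_measurable lebesgue" for n
      using assms K(1,2) by (auto simp: locally_integrable_on_def set_integrable_def dest!: borel_measurable_integrable)
    fix z
    show "(\<lambda>n. indicator (K n) z *\<^sub>R f z) \<longlonglongrightarrow> indicator spacetime z * f z"
    proof (cases "z \<in> spacetime")
      case True
      from K(3)[OF True] have "\<forall>\<^sub>F n in sequentially. f z = indicator (K n) z *\<^sub>R f z"
        by eventually_elim simp
      then show ?thesis using True by (simp add: Lim_transform_eventually[OF tendsto_const])
    next
      case False
      then have "z \<notin> K n" for n using K(2) by auto
      then show ?thesis using False by simp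
    qed
  qed
  from completion_ex_borel_measurable_real[OF this]
  obtain f' where f': "f' \<in> borel_measurable lborel" "AE z in lborel. indicator spacetime z * f z = f' z" by auto
  show thesis
  proof (rule that)
    show "f' \<in> borel_measurable borel" using f'(1) by simp
    show "AE z in lborel. 0 < snd z \<longrightarrow> f z = f' z"
      using f'(2) by eventually_elim (auto simp: spacetime_def indicator_def mem_Times_iff)
  qed
qed

text \<open>
  Integrating the pointwise identity \<open>v(x, b) - v(x, a) = \<integral>\<^sub>a\<^sup>b g(x, s) ds\<close> over boxes gives what
  \<open>integrated_weak_derivative\<close> proves, and box integrals determine a function almost everywhere. Only the resulting
  inequality is kept, with an integral in \<open>[0, \<infinity>]\<close>, so that it survives letting \<open>a\<close> tend to \<open>0\<close>, where \<open>g\<close> is not known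
  to be integrable.
\<close>

lemma mild_formulation:
  fixes v g g' :: "(real ^ 'n) \<times> real \<Rightarrow> real"
  assumes cont: "continuous_L1_loc v" and weak: "weak_time_derivative v g" and ab: "0 < a" "a < b"
    and g'[measurable]: "g' \<in> borel_measurable borel" and gg': "AE z in lborel. 0 < snd z \<longrightarrow> g z = g' z"
  shows "AE x in lebesgue. ennreal \<bar>v (x, b) - v (x, a)\<bar> \<le> (\<integral>\<^sup>+ s. indicator {a<..b} s * ennreal \<bar>g' (x, s)\<bar> \<partial>lborel)"
proof -
  have gloc: "g locally_integrable_on spacetime" using weak by (simp add: weak_time_derivative_def)
  have b0: "0 < b" using ab by simp
  have AEB: "AE x in lborel. x \<in> box l r \<longrightarrow> ennreal \<bar>v (x, b) - v (x, a)\<bar> \<le> (\<integral>\<^sup>+ s. indicator {a<..b} s * ennreal \<bar>g' (x, s)\<bar> \<partial>lborel)"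
    for l r
  proof -
    have gS: "set_integrable lebesgue (box l' r' \<times> {a<..b}) g" for l' r'
    proof (rule set_integrable_subset)
      have "compact (cbox l' r' \<times> {a..b})" by (intro compact_Times compact_cbox compact_Icc)
      then show "g absolutely_integrable_on cbox l' r' \<times> {a..b}"
        using gloc ab by (auto simp: locally_integrable_on_def spacetime_def)
      have "box l' r' \<times> {a<..b} \<in> sets borel" by (intro borel_Times) auto
      then show "box l' r' \<times> {a<..b} \<in> sets lebesgue" by simp
    qed (use box_subset_cbox in auto)
    have ind_meas: "(indicator (box l' r' \<times> {a<..b}) :: (real ^ 'n) \<times> real \<Rightarrow> real) \<in> borel_measurable borel" for l' r'
      by (intro borel_measurable_indicator borel_Times) auto
    define P where "P l' r' z = indicator (box l' r' \<times> {a<..b}) z * g' z" for l' r' z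
    have P_meas: "P l' r' \<in> borel_measurable borel" for l' r'
      unfolding P_def by (intro borel_measurable_times ind_meas g')
    have P_eq: "AE z in lebesgue. indicator (box l' r' \<times> {a<..b}) z *\<^sub>R g z = P l' r' z" for l' r'
      using AE_completion[OF gg'] by eventually_elim (use ab in \<open>auto simp: P_def indicator_def\<close>)
    have P_int: "integrable lborel (P l' r')" for l' r'
    proof -
      have "integrable lebesgue (P l' r')"
        using gS[of l' r'] lebesgue_of_borel[OF P_meas] P_eq
        by (auto simp: set_integrable_def intro: integrable_cong_AE_imp)
      then show ?thesis using P_meas by (simp add: integrable_completion)
    qed
    have P_integral: "(LINT z|lborel. P l' r' z) = (LINT z:box l' r' \<times> {a<..b}|lebesgue. g z)" for l' r'
    proof -
      have "(LINT z|lborel. P l' r' z) = (LINT z|lebesgue. P l' r' z)"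
        using P_meas by (simp add: integral_completion)
      also have "\<dots> = (LINT z|lebesgue. indicator (box l' r' \<times> {a<..b}) z *\<^sub>R g z)"
        using gS[of l' r'] AE_symmetric[OF P_eq[of l' r']] lebesgue_of_borel[OF P_meas]
        by (intro integral_cong_AE) (auto simp: set_integrable_def)
      finally show ?thesis by (simp add: set_lebesgue_integral_def)
    qed
    define Q where "Q x = (LINT s|lborel. P l r (x, s))" for x
    have P_int2: "integrable ((lborel :: (real ^ 'n) measure) \<Otimes>\<^sub>M (lborel :: real measure)) (P l' r')" for l' r'
      using P_int by (simp add: lborel_prod)
    have Q_int: "integrable lborel Q" unfolding Q_def by (rule lborel_pair.integrable_fst'[OF P_int2])
    have vt: "set_integrable lebesgue (box l' r') (\<lambda>x. v (x, t))" if "0 < t" for t l' r'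
    proof (rule set_integrable_subset)
      show "(\<lambda>x. v (x, t)) absolutely_integrable_on cbox l' r'"
        using cont that by (auto simp: continuous_L1_loc_def locally_integrable_on_def)
    qed (use box_subset_cbox in auto)
    define k where "k x = indicator (box l r) x * (v (x, b) - v (x, a))" for x
    have k_int: "integrable lebesgue k"
      using set_integral_diff(1)[OF vt[OF b0] vt[OF ab(1)], of l r]
      by (simp add: set_integrable_def k_def[abs_def])
    obtain k' where k': "k' \<in> borel_measurable lborel" "AE x in lborel. k x = k' x"
      using completion_ex_borel_measurable_real[OF borel_measurable_integrable[OF k_int]] by auto
    have k'_int: "integrable lborel k'"
    proof -
      have "integrable lebesgue k'"
        using k_int measurable_completion[OF k'(1)] AE_completion[OF k'(2)] by (rule integrable_cong_AE_imp)
      then show ?thesis using k'(1) by (simp add: integrable_completion)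
    qed
    have "AE x in lborel. k' x - Q x = 0"
    proof (rule AE_eq_0_if_box_integrals_eq_0)
      show "integrable lborel (\<lambda>x. k' x - Q x)" by (intro Bochner_Integration.integrable_diff k'_int Q_int)
      fix l' r' :: "real ^ 'n"
      obtain l2 r2 where B2: "box l' r' \<inter> box l r = box l2 r2" unfolding box_Int_box by blast
      have s1: "set_integrable lborel (box l' r') k'" "set_integrable lborel (box l' r') Q"
        unfolding set_integrable_def by (intro integrable_mult_indicator k'_int Q_int; simp)+
      have "(LINT x:box l' r'|lborel. k' x) = (LINT x|lebesgue. indicator (box l' r') x * k' x)"
        unfolding set_lebesgue_integral_def using k'(1)
        by (subst integral_completion) (auto intro!: borel_measurable_times borel_measurable_indicator)
      also have "\<dots> = (LINT x|lebesgue. indicator (box l' r') x * k x)"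
      proof (rule integral_cong_AE)
        have ib: "(indicator (box l' r') :: real ^ 'n \<Rightarrow> real) \<in> borel_measurable lebesgue"
          by (intro lebesgue_of_borel borel_measurable_indicator) simp
        show "(\<lambda>x. indicator (box l' r') x * k' x) \<in> borel_measurable lebesgue"
          by (intro borel_measurable_times ib measurable_completion k')
        show "(\<lambda>x. indicator (box l' r') x * k x) \<in> borel_measurable lebesgue"
          by (intro borel_measurable_times ib borel_measurable_integrable[OF k_int])
        show "AE x in lebesgue. indicator (box l' r') x * k' x = indicator (box l' r') x * k x"
          using AE_completion[OF k'(2)] by eventually_elim simp
      qed
      also have "\<dots> = (LINT x:box l2 r2|lebesgue. v (x, b) - v (x, a))"
        unfolding set_lebesgue_integral_def B2[symmetric] k_def
        by (intro Bochner_Integration.integral_cong) (auto simp: indicator_def)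
      also have "\<dots> = (LINT x:box l2 r2|lebesgue. v (x, b)) - (LINT x:box l2 r2|lebesgue. v (x, a))"
        by (intro set_integral_diff(2) vt b0 ab)
      also have "\<dots> = (LINT z|lborel. P l2 r2 z)"
        unfolding P_integral by (rule integrated_weak_derivative[OF cont weak ab])
      also have "\<dots> = (LINT x|lborel. LINT s|lborel. P l2 r2 (x, s))"
        using lborel_pair.integral_fst'[OF P_int2, of l2 r2] by (simp add: lborel_prod)
      also have "\<dots> = (LINT x|lborel. indicator (box l' r') x * Q x)"
      proof (intro Bochner_Integration.integral_cong refl)
        fix x
        have "P l2 r2 (x, s) = indicator (box l' r') x * P l r (x, s)" for s
          by (auto simp: P_def B2[symmetric] indicator_def)
        then show "(LINT s|lborel. P l2 r2 (x, s)) = indicator (box l' r') x * Q x"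
          by (simp add: Q_def)
      qed
      also have "\<dots> = (LINT x:box l' r'|lborel. Q x)" by (simp add: set_lebesgue_integral_def)
      finally show "(LINT x:box l' r'|lborel. k' x - Q x) = 0"
        using set_integral_diff(2)[OF s1] by simp
    qed
    then show ?thesis using k'(2)
    proof eventually_elim
      case (elim x)
      show ?case
      proof
        assume x: "x \<in> box l r"
        then have "v (x, b) - v (x, a) = Q x" using elim by (simp add: k_def)
        moreover have "ennreal \<bar>Q x\<bar> \<le> (\<integral>\<^sup>+ s. ennreal \<bar>P l r (x, s)\<bar> \<partial>lborel)"
        proof (cases "integrable lborel (\<lambda>s. P l r (x, s))")
          case True
          from integral_norm_bound_ennreal[OF this] show ?thesis by (simp add: Q_def)
        qed (simp add: Q_def not_integrable_integral_eq)
        moreover have "(\<integral>\<^sup>+ s. ennreal \<bar>P l r (x, s)\<bar> \<partial>lborel) = (\<integral>\<^sup>+ s. indicator {a<..b} s * ennreal \<bar>g' (x, s)\<bar> \<partial>lborel)"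
          using x by (intro nn_integral_cong) (auto simp: P_def indicator_def)
        ultimately show "ennreal \<bar>v (x, b) - v (x, a)\<bar> \<le> (\<integral>\<^sup>+ s. indicator {a<..b} s * ennreal \<bar>g' (x, s)\<bar> \<partial>lborel)"
          by simp
      qed
    qed
  qed
  let ?B = "\<lambda>n::nat. box (- (real n *\<^sub>R One)) (real n *\<^sub>R One) :: (real ^ 'n) set"
  have "AE x in lborel. \<forall>n. x \<in> ?B n \<longrightarrow> ennreal \<bar>v (x, b) - v (x, a)\<bar> \<le> (\<integral>\<^sup>+ s. indicator {a<..b} s * ennreal \<bar>g' (x, s)\<bar> \<partial>lborel)"
    by (subst AE_all_countable) (intro allI AEB)
  then have "AE x in lborel. ennreal \<bar>v (x, b) - v (x, a)\<bar> \<le> (\<integral>\<^sup>+ s. indicator {a<..b} s * ennreal \<bar>g' (x, s)\<bar> \<partial>lborel)"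
  proof eventually_elim
    case (elim x)
    have "x \<in> (\<Union>n. ?B n)" using UN_box_eq_UNIV by blast
    with elim show ?case by blast
  qed
  then show ?thesis by (rule AE_completion)
qed

section \<open>Uniqueness of solutions of moderate growth\<close>

lemma locally_integrable_measurable:
  fixes f :: "real ^ 'n \<Rightarrow> real"
  assumes "f locally_integrable_on UNIV"
  shows "f \<in> borel_measurable lebesgue"
proof (rule borel_measurable_LIMSEQ_real)
  show "(\<lambda>x. indicator (cball 0 (real n)) x *\<^sub>R f x) \<in> borel_measurable lebesgue" for n
    using assms by (intro borel_measurable_integrable) (simp add: locally_integrable_on_def set_integrable_def)
  fix x :: "real ^ 'n"
  have "\<forall>\<^sub>F n in sequentially. norm x \<le> real n"
    using filterlim_real_sequentially by (auto simp: filterlim_at_top)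
  then have "\<forall>\<^sub>F n in sequentially. f x = indicator (cball 0 (real n)) x *\<^sub>R f x"
    by eventually_elim simp
  then show "(\<lambda>n. indicator (cball 0 (real n)) x *\<^sub>R f x) \<longlonglongrightarrow> f x"
    by (rule Lim_transform_eventually[OF tendsto_const])
qed

lemma continuous_L1_bounded:
  fixes v :: "(real ^ 'n) \<times> real \<Rightarrow> real"
  assumes cont: "continuous_L1_loc v" and K: "compact K"
  shows "\<exists>N. \<forall>t\<in>{0..T}. (LINT x:K|lebesgue. \<bar>v (x, t)\<bar>) \<le> N"
proof -
  define n where "n t = (LINT x:K|lebesgue. \<bar>v (x, t)\<bar>)" for t
  have vt: "set_integrable lebesgue K (\<lambda>x. v (x, t))" if "0 \<le> t" for t
    using cont K that by (auto simp: continuous_L1_loc_def locally_integrable_on_def)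
  have lip: "\<bar>n s - n t\<bar> \<le> (LINT x:K|lebesgue. \<bar>v (x, s) - v (x, t)\<bar>)" if "0 \<le> s" "0 \<le> t" for s t
  proof -
    have "n s - n t = (LINT x:K|lebesgue. \<bar>v (x, s)\<bar> - \<bar>v (x, t)\<bar>)"
      unfolding n_def using that by (intro set_integral_diff(2)[symmetric] set_integrable_abs vt)
    also have "\<bar>\<dots>\<bar> \<le> (LINT x|lebesgue. indicator K x *\<^sub>R \<bar>v (x, s) - v (x, t)\<bar>)"
      unfolding set_lebesgue_integral_def
    proof (rule integral_abs_bound_integral)
      show "integrable lebesgue (\<lambda>x. indicator K x *\<^sub>R (\<bar>v (x, s)\<bar> - \<bar>v (x, t)\<bar>))"
        using set_integral_diff(1)[OF set_integrable_abs[OF vt] set_integrable_abs[OF vt]] that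
        by (simp add: set_integrable_def)
      show "integrable lebesgue (\<lambda>x. indicator K x *\<^sub>R \<bar>v (x, s) - v (x, t)\<bar>)"
        using set_integrable_abs[OF set_integral_diff(1)[OF vt vt]] that
        by (simp add: set_integrable_def)
      show "\<bar>indicator K x *\<^sub>R (\<bar>v (x, s)\<bar> - \<bar>v (x, t)\<bar>)\<bar> \<le> indicator K x *\<^sub>R \<bar>v (x, s) - v (x, t)\<bar>" for x
        by (auto simp: indicator_def)
    qed
    finally show ?thesis by (simp add: set_lebesgue_integral_def)
  qed
  have "continuous_on {0..T} n"
    unfolding continuous_on_def
  proof
    fix t assume t: "t \<in> {0..T}"
    have "((\<lambda>s. n s - n t) \<longlongrightarrow> 0) (at t within {0..T})"
    proof (rule Lim_null_comparison)
      show "\<forall>\<^sub>F s in at t within {0..T}. norm (n s - n t) \<le> (LINT x:K|lebesgue. \<bar>v (x, s) - v (x, t)\<bar>)"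
        using lip t by (auto simp: eventually_at_filter)
      have "((\<lambda>s. LINT x:K|lebesgue. \<bar>v (x, s) - v (x, t)\<bar>) \<longlongrightarrow> 0) (at t within {0..})"
        using cont K t by (auto simp: continuous_L1_loc_def)
      then show "((\<lambda>s. LINT x:K|lebesgue. \<bar>v (x, s) - v (x, t)\<bar>) \<longlongrightarrow> 0) (at t within {0..T})"
        by (rule tendsto_within_subset) auto
    qed
    then show "(n \<longlongrightarrow> n t) (at t within {0..T})" by (simp add: LIM_zero_iff)
  qed
  then have "bounded (n ` {0..T})" by (intro compact_imp_bounded compact_continuous_image) auto
  then obtain N where "\<forall>y\<in>n ` {0..T}. norm y \<le> N" unfolding bounded_iff by blast
  then have "\<bar>n t\<bar> \<le> N" if "t \<in> {0..T}" for t using that by auto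
  then show ?thesis unfolding n_def by (meson abs_le_D1)
qed

text \<open>
  Where the convolution integral diverges, the left-hand side is \<open>0\<close>.
\<close>

lemma abs_conv_le_nconv:
  assumes J: "kernel J" and f: "f \<in> borel_measurable borel" and wf: "AE y in lborel. w y = f y"
  shows "ennreal \<bar>conv J w x\<bar> \<le> nconv J (\<lambda>y. ennreal \<bar>f y\<bar>) x"
proof -
  have "ennreal \<bar>conv J w x\<bar> \<le> (\<integral>\<^sup>+ y. ennreal \<bar>J (x - y) * w y\<bar> \<partial>lebesgue)"
  proof (cases "integrable lebesgue (\<lambda>y. J (x - y) * w y)")
    case True
    from integral_norm_bound_ennreal[OF this] show ?thesis by (simp add: conv_def)
  qed (simp add: conv_def not_integrable_integral_eq)
  also have "\<dots> = nconv J (\<lambda>y. ennreal \<bar>f y\<bar>) x"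
    unfolding nconv_def nn_integral_completion using wf
    by (intro nn_integral_cong_AE)
      (auto elim!: eventually_mono simp: abs_mult ennreal_mult kernel_nonneg[OF J])
  finally show ?thesis .
qed

text \<open>
  In \<open>L\<^sup>1\<close> with weight \<open>\<rho>\<close> the operator \<open>J * \<cdot> - \<cdot>\<close> is bounded, since by duality the integral of \<open>(J * |f|) \<rho>\<close> is that of
  \<open>|f| (J * \<rho>)\<close>. The function \<open>f\<close> is a Borel version of \<open>w\<close>.
\<close>

lemma generator_weighted_bound:
  assumes J: "kernel J" and f[measurable]: "f \<in> borel_measurable borel"
    and \<rho>[measurable]: "\<rho> \<in> borel_measurable borel" and C: "0 \<le> C" "\<And>x. nconv J \<rho> x \<le> ennreal C * \<rho> x"
    and wf: "AE y in lborel. w y = f y" and G: "AE x in lborel. G x = conv J w x - f x"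
  shows "(\<integral>\<^sup>+ x. ennreal \<bar>G x\<bar> * \<rho> x \<partial>lborel) \<le> ennreal (C + 1) * (\<integral>\<^sup>+ x. ennreal \<bar>f x\<bar> * \<rho> x \<partial>lborel)"
proof -
  let ?f = "\<lambda>x. ennreal \<bar>f x\<bar>"
  have [measurable]: "nconv J ?f \<in> borel_measurable borel" by (rule nconv_measurable[OF J]) measurable
  have [measurable]: "nconv J \<rho> \<in> borel_measurable borel" by (rule nconv_measurable[OF J \<rho>])
  have "(\<integral>\<^sup>+ x. ennreal \<bar>G x\<bar> * \<rho> x \<partial>lborel) \<le> (\<integral>\<^sup>+ x. nconv J ?f x * \<rho> x + ?f x * \<rho> x \<partial>lborel)"
  proof (rule nn_integral_mono_AE)
    show "AE x in lborel. ennreal \<bar>G x\<bar> * \<rho> x \<le> nconv J ?f x * \<rho> x + ?f x * \<rho> x"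
      using G
    proof eventually_elim
      case (elim x)
      have "ennreal \<bar>G x\<bar> \<le> ennreal (\<bar>conv J w x\<bar> + \<bar>f x\<bar>)"
        unfolding elim by (intro ennreal_leI) linarith
      also have "\<dots> = ennreal \<bar>conv J w x\<bar> + ?f x" by simp
      also have "\<dots> \<le> nconv J ?f x + ?f x" by (intro add_mono abs_conv_le_nconv J f wf order_refl)
      finally show ?case unfolding distrib_right[symmetric] by (rule mult_right_mono) simp
    qed
  qed
  also have "\<dots> = (\<integral>\<^sup>+ x. nconv J ?f x * \<rho> x \<partial>lborel) + (\<integral>\<^sup>+ x. ?f x * \<rho> x \<partial>lborel)"
    by (rule nn_integral_add) measurable
  also have "(\<integral>\<^sup>+ x. nconv J ?f x * \<rho> x \<partial>lborel) = (\<integral>\<^sup>+ x. ?f x * nconv J \<rho> x \<partial>lborel)"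
    by (rule nconv_adjoint[OF J]) measurable
  also have "\<dots> \<le> (\<integral>\<^sup>+ x. ennreal C * (?f x * \<rho> x) \<partial>lborel)"
  proof (rule nn_integral_mono)
    fix x
    show "?f x * nconv J \<rho> x \<le> ennreal C * (?f x * \<rho> x)"
      using mult_left_mono[OF C(2)[of x], of "?f x"] by (simp add: mult_ac)
  qed
  also have "\<dots> = ennreal C * (\<integral>\<^sup>+ x. ?f x * \<rho> x \<partial>lborel)" by (rule nn_integral_cmult) measurable
  also have "ennreal C * (\<integral>\<^sup>+ x. ?f x * \<rho> x \<partial>lborel) + (\<integral>\<^sup>+ x. ?f x * \<rho> x \<partial>lborel)
     = ennreal (C + 1) * (\<integral>\<^sup>+ x. ?f x * \<rho> x \<partial>lborel)"
    using C(1) by (simp add: distrib_right)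
  finally show ?thesis by (simp add: add_right_mono)
qed

text \<open>
  The weighted norm \<open>\<Phi> t = \<integral> |v(x, t)| \<rho>(x) dx\<close> is bounded on bounded time intervals: on a ball because \<open>\<rho>\<close> is bounded and
  \<open>v\<close> is continuous in \<open>L\<^sup>1\<close>, outside it because \<open>\<rho> (1 + |x|)\<^sup>\<gamma>\<close> is integrable. It satisfies
  \<open>\<Phi> b \<le> (C + 1) \<integral>\<^sub>0\<^sup>b \<Phi>\<close>, hence vanishes, and \<open>\<rho>\<close> is at least \<open>1\<close> on a ball of prescribed radius.
\<close>

lemma zero_initial_data_imp_zero:
  fixes v g :: "(real ^ 'n) \<times> real \<Rightarrow> real"
  assumes J: "kernel J" and \<gamma>: "0 \<le> \<gamma>" "ereal \<gamma> < moment_exponent J"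
    and cont: "continuous_L1_loc v" and weak: "weak_time_derivative v g"
    and eq: "AE z in lebesgue. 0 < snd z \<longrightarrow> g z = conv J (\<lambda>y. v (y, snd z)) (fst z) - v z"
    and init: "AE x in lebesgue. v (x, 0) = 0"
    and far: "\<And>T. 0 \<le> T \<Longrightarrow> \<exists>M\<ge>0. AE t in lebesgue. t \<in> {0..T} \<longrightarrow>
       (AE x in lebesgue. R \<le> norm x \<longrightarrow> \<bar>v (x, t)\<bar> \<le> M * (1 + norm x) powr \<gamma>)"
    and t: "0 \<le> t"
  shows "AE x in lebesgue. v (x, t) = 0"
proof -
  have vloc: "v locally_integrable_on spacetime" and gloc: "g locally_integrable_on spacetime"
    using weak by (auto simp: weak_time_derivative_def)
  obtain v' where v': "v' \<in> borel_measurable borel" and vv': "AE z in lborel. 0 < snd z \<longrightarrow> v z = v' z"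
    using locally_integrable_borel_version[OF vloc] by metis
  obtain g' where g': "g' \<in> borel_measurable borel" and gg': "AE z in lborel. 0 < snd z \<longrightarrow> g z = g' z"
    using locally_integrable_borel_version[OF gloc] by metis
  have [measurable]: "v' \<in> borel_measurable (borel \<Otimes>\<^sub>M borel)" "g' \<in> borel_measurable (borel \<Otimes>\<^sub>M borel)"
    using v' g' by (simp_all add: borel_prod)
  have v_meas: "(\<lambda>x. v (x, s)) \<in> borel_measurable lebesgue" if "0 \<le> s" for s
    using cont that by (intro locally_integrable_measurable) (auto simp: continuous_L1_loc_def)
  have v_int: "set_integrable lebesgue K (\<lambda>x. v (x, s))" if "0 \<le> s" "compact K" for s K
    using cont that by (auto simp: continuous_L1_loc_def locally_integrable_on_def)
  have "AE z in lborel. 0 < snd z \<longrightarrow> v z = v' z \<and> g' z = conv J (\<lambda>y. v (y, snd z)) (fst z) - v' z"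
    using vv' gg' eq[unfolded AE_completion_iff] by eventually_elim auto
  from AE_swap_lborel[OF this]
  have slice: "AE s in lborel. 0 < s \<longrightarrow> (AE x in lborel. v (x, s) = v' (x, s)) \<and>
      (AE x in lborel. g' (x, s) = conv J (\<lambda>y. v (y, s)) x - v' (x, s))"
    by eventually_elim (auto simp: AE_conj_iff)
  have ball: "AE x in lebesgue. norm x \<le> r \<longrightarrow> v (x, b) = 0" if b: "0 < b" for b r
  proof -
    obtain \<rho> :: "real ^ 'n \<Rightarrow> ennreal" and C :: real where
      \<rho>[measurable]: "\<rho> \<in> borel_measurable borel" and C: "0 \<le> C" and \<rho>2: "\<And>x. \<rho> x \<le> 2"
      and \<rho>1: "\<And>x. norm x \<le> r \<Longrightarrow> 1 \<le> \<rho> x" and \<rho>C: "\<And>x. nconv J \<rho> x \<le> ennreal C * \<rho> x"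
      and \<rho>W: "(\<integral>\<^sup>+ x. \<rho> x * ennreal ((1 + norm x) powr \<gamma>) \<partial>lborel) < \<infinity>"
      by (rule supersolution_weight[OF J \<gamma>, where r = r], rule that)
    have \<rho>_leb: "\<rho> \<in> borel_measurable lebesgue" by (rule measurable_completion) simp
    define \<Phi> where "\<Phi> s = (\<integral>\<^sup>+ x. ennreal \<bar>v (x, s)\<bar> * \<rho> x \<partial>lebesgue)" for s
    define \<phi> where "\<phi> s = (\<integral>\<^sup>+ x. ennreal \<bar>v' (x, s)\<bar> * \<rho> x \<partial>lborel)" for s
    have \<phi>_meas[measurable]: "\<phi> \<in> borel_measurable borel"
    proof -
      have "(\<lambda>s. \<integral>\<^sup>+ x. ennreal \<bar>v' (x, s)\<bar> * \<rho> x \<partial>lborel) \<in> borel_measurable lborel" by measurable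
      then show ?thesis by (simp add: \<phi>_def[abs_def])
    qed
    have \<Phi>\<phi>: "AE s in lborel. 0 < s \<longrightarrow> \<Phi> s = \<phi> s"
      using slice
    proof eventually_elim
      case (elim s)
      show ?case
      proof
        assume "0 < s"
        with elim have "AE x in lborel. v (x, s) = v' (x, s)" by simp
        then show "\<Phi> s = \<phi> s" unfolding \<Phi>_def \<phi>_def nn_integral_completion
          by (intro nn_integral_cong_AE) (auto elim!: eventually_mono)
      qed
    qed
    have volterra: "\<Phi> b \<le> ennreal (C + 1) * (\<integral>\<^sup>+ s. indicator {0<..b} s * \<phi> s \<partial>lborel)" if b: "0 < b" for b
    proof -
      define S where "S = (\<integral>\<^sup>+ s. indicator {0<..b} s * (\<integral>\<^sup>+ x. ennreal \<bar>g' (x, s)\<bar> * \<rho> x \<partial>lborel) \<partial>lborel)"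
      define G where "G x = (\<integral>\<^sup>+ s. indicator {0<..b} s * ennreal \<bar>g' (x, s)\<bar> \<partial>lborel)" for x
      have G_meas[measurable]: "G \<in> borel_measurable borel"
      proof -
        have "(\<lambda>x. \<integral>\<^sup>+ s. indicator {0<..b} s * ennreal \<bar>g' (x, s)\<bar> \<partial>lborel) \<in> borel_measurable lborel" by measurable
        then show ?thesis by (simp add: G_def[abs_def])
      qed
      have G_leb: "G \<in> borel_measurable lebesgue" by (rule measurable_completion) simp
      have GS: "(\<integral>\<^sup>+ x. G x * \<rho> x \<partial>lebesgue) = S"
      proof -
        have "(\<integral>\<^sup>+ x. G x * \<rho> x \<partial>lebesgue) = (\<integral>\<^sup>+ x. \<integral>\<^sup>+ s. indicator {0<..b} s * ennreal \<bar>g' (x, s)\<bar> * \<rho> x \<partial>lborel \<partial>lborel)"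
          unfolding G_def nn_integral_completion by (intro nn_integral_cong nn_integral_multc[symmetric]) measurable
        also have "\<dots> = (\<integral>\<^sup>+ s. \<integral>\<^sup>+ x. indicator {0<..b} s * ennreal \<bar>g' (x, s)\<bar> * \<rho> x \<partial>lborel \<partial>lborel)"
          by (rule lborel_pair.Fubini'[symmetric]) measurable
        also have "\<dots> = S"
          unfolding S_def mult.assoc by (intro nn_integral_cong nn_integral_cmult) measurable
        finally show ?thesis .
      qed
      have ball_le: "(\<integral>\<^sup>+ x. indicator (cball 0 (real n)) x * (ennreal \<bar>v (x, b)\<bar> * \<rho> x) \<partial>lebesgue) \<le> S" for n
      proof (rule ennreal_le_epsilon)
        fix e :: real
        assume e: "0 < e"
        let ?B = "cball 0 (real n) :: (real ^ 'n) set"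
        define D where "D a = (LINT x:?B|lebesgue. \<bar>v (x, a) - v (x, 0)\<bar>)" for a
        have "(D \<longlongrightarrow> 0) (at 0 within {0..})"
          using cont by (auto simp: continuous_L1_loc_def D_def[abs_def])
        then have "\<forall>\<^sub>F a in at 0 within {0..}. D a < e / 2"
          using e by (intro order_tendstoD) auto
        then obtain d where d: "0 < d" "\<And>a. 0 \<le> a \<Longrightarrow> a \<noteq> 0 \<Longrightarrow> dist a 0 < d \<Longrightarrow> D a < e / 2"
          unfolding eventually_at by auto
        (* The equation is known for positive times only, so v is compared with its value at a small time a,
           and v(., a) is close to v(., 0) = 0 in L^1 of the ball. *)
        define a where "a = min (d / 2) (b / 2)"
        have a01: "0 < a" "a < b" "a < d" using b d(1) by (auto simp: a_def)
        then have "D a < e / 2" by (intro d(2)) auto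
        note a = a01(1,2) this
        have int: "integrable lebesgue (\<lambda>x. indicator ?B x *\<^sub>R \<bar>v (x, a) - v (x, 0)\<bar>)"
          using set_integrable_abs[OF set_integral_diff(1)[OF v_int[of a ?B] v_int[of 0 ?B]]] a(1)
          by (simp add: set_integrable_def)
        note ie = measurable_compose[OF borel_measurable_integrable[OF int] measurable_ennreal]
        have "(\<integral>\<^sup>+ x. indicator ?B x * (ennreal \<bar>v (x, b)\<bar> * \<rho> x) \<partial>lebesgue) \<le>
            (\<integral>\<^sup>+ x. 2 * ennreal (indicator ?B x *\<^sub>R \<bar>v (x, a) - v (x, 0)\<bar>) + G x * \<rho> x \<partial>lebesgue)"
        proof (rule nn_integral_mono_AE)
          show "AE x in lebesgue. indicator ?B x * (ennreal \<bar>v (x, b)\<bar> * \<rho> x) \<le>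
              2 * ennreal (indicator ?B x *\<^sub>R \<bar>v (x, a) - v (x, 0)\<bar>) + G x * \<rho> x"
            using init mild_formulation[OF cont weak a(1,2) g' gg']
          proof eventually_elim
            case (elim x)
            have "(\<integral>\<^sup>+ s. indicator {a<..b} s * ennreal \<bar>g' (x, s)\<bar> \<partial>lborel) \<le> G x"
              unfolding G_def using a(1) by (intro nn_integral_mono) (auto simp: indicator_def)
            with elim have le: "ennreal \<bar>v (x, b) - v (x, a)\<bar> \<le> G x" by auto
            have "ennreal \<bar>v (x, b)\<bar> \<le> ennreal (\<bar>v (x, a) - v (x, 0)\<bar> + \<bar>v (x, b) - v (x, a)\<bar>)"
              using elim by (intro ennreal_leI) linarith
            also have "\<dots> = ennreal \<bar>v (x, a) - v (x, 0)\<bar> + ennreal \<bar>v (x, b) - v (x, a)\<bar>" by simp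
            also have "\<dots> \<le> ennreal \<bar>v (x, a) - v (x, 0)\<bar> + G x" by (intro add_mono le order_refl)
            finally have "ennreal \<bar>v (x, b)\<bar> * \<rho> x \<le> (ennreal \<bar>v (x, a) - v (x, 0)\<bar> + G x) * \<rho> x"
              by (rule mult_right_mono) simp
            also have "\<dots> = \<rho> x * ennreal \<bar>v (x, a) - v (x, 0)\<bar> + G x * \<rho> x"
              by (simp only: distrib_right mult.commute[of "\<rho> x"])
            also have "\<dots> \<le> 2 * ennreal \<bar>v (x, a) - v (x, 0)\<bar> + G x * \<rho> x"
              by (intro add_mono mult_right_mono \<rho>2 order_refl) simp
            finally show ?case by (auto simp: indicator_def)
          qed
        qed
        also have "\<dots> = (\<integral>\<^sup>+ x. 2 * ennreal (indicator ?B x *\<^sub>R \<bar>v (x, a) - v (x, 0)\<bar>) \<partial>lebesgue) + (\<integral>\<^sup>+ x. G x * \<rho> x \<partial>lebesgue)"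
          by (intro nn_integral_add borel_measurable_times_ennreal borel_measurable_const ie G_leb \<rho>_leb)
        also have "(\<integral>\<^sup>+ x. 2 * ennreal (indicator ?B x *\<^sub>R \<bar>v (x, a) - v (x, 0)\<bar>) \<partial>lebesgue) = 
            2 * (\<integral>\<^sup>+ x. ennreal (indicator ?B x *\<^sub>R \<bar>v (x, a) - v (x, 0)\<bar>) \<partial>lebesgue)"
          by (intro nn_integral_cmult ie)
        also have "(\<integral>\<^sup>+ x. ennreal (indicator ?B x *\<^sub>R \<bar>v (x, a) - v (x, 0)\<bar>) \<partial>lebesgue) = ennreal (D a)"
          unfolding D_def set_lebesgue_integral_def by (intro nn_integral_eq_integral int) simp
        also have "2 * ennreal (D a) \<le> ennreal e"
        proof -
          have "2 * ennreal (D a) = ennreal (2 * D a)" by (simp add: ennreal_mult')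
          also have "\<dots> \<le> ennreal e" using a(3) by (intro ennreal_leI) simp
          finally show ?thesis .
        qed
        finally show "(\<integral>\<^sup>+ x. indicator ?B x * (ennreal \<bar>v (x, b)\<bar> * \<rho> x) \<partial>lebesgue) \<le> S + ennreal e"
          unfolding GS by (simp add: add.commute add_right_mono)
      qed
      have "(\<lambda>n. \<integral>\<^sup>+ x. indicator (cball 0 (real n)) x * (ennreal \<bar>v (x, b)\<bar> * \<rho> x) \<partial>lebesgue) \<longlonglongrightarrow> \<Phi> b"
        unfolding \<Phi>_def
      proof (rule nn_integral_LIMSEQ)
        show "incseq (\<lambda>n x. indicator (cball 0 (real n)) x * (ennreal \<bar>v (x, b)\<bar> * \<rho> x))"
          by (auto simp: incseq_def le_fun_def indicator_def)
        have ind: "(indicator (cball 0 (real n)) :: real ^ 'n \<Rightarrow> ennreal) \<in> borel_measurable lebesgue" for n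
          by (intro borel_measurable_indicator) simp
        show "(\<lambda>x. indicator (cball 0 (real n)) x * (ennreal \<bar>v (x, b)\<bar> * \<rho> x)) \<in> borel_measurable lebesgue" for n
          by (intro borel_measurable_times_ennreal ind \<rho>_leb measurable_compose[OF _ measurable_ennreal]
              borel_measurable_abs v_meas) (use b in simp)
        fix x :: "real ^ 'n"
        have "\<forall>\<^sub>F n in sequentially. norm x \<le> real n"
          using filterlim_real_sequentially by (auto simp: filterlim_at_top)
        then have "\<forall>\<^sub>F n in sequentially. ennreal \<bar>v (x, b)\<bar> * \<rho> x = indicator (cball 0 (real n)) x * (ennreal \<bar>v (x, b)\<bar> * \<rho> x)"
          by eventually_elim simp
        then show "(\<lambda>n. indicator (cball 0 (real n)) x * (ennreal \<bar>v (x, b)\<bar> * \<rho> x)) \<longlonglongrightarrow> ennreal \<bar>v (x, b)\<bar> * \<rho> x"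
          by (rule Lim_transform_eventually[OF tendsto_const])
      qed
      then have "\<Phi> b \<le> S" by (rule LIMSEQ_le_const2) (use ball_le in auto)
      also have "S \<le> (\<integral>\<^sup>+ s. ennreal (C + 1) * (indicator {0<..b} s * \<phi> s) \<partial>lborel)"
        unfolding S_def
      proof (rule nn_integral_mono_AE)
        show "AE s in lborel. indicator {0<..b} s * (\<integral>\<^sup>+ x. ennreal \<bar>g' (x, s)\<bar> * \<rho> x \<partial>lborel)
            \<le> ennreal (C + 1) * (indicator {0<..b} s * \<phi> s)"
          using slice
        proof eventually_elim
          case (elim s)
          have "(\<integral>\<^sup>+ x. ennreal \<bar>g' (x, s)\<bar> * \<rho> x \<partial>lborel) \<le> ennreal (C + 1) * \<phi> s" if "0 < s"
            unfolding \<phi>_def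
          proof (rule generator_weighted_bound[OF J _ \<rho> C \<rho>C])
            show "(\<lambda>x. v' (x, s)) \<in> borel_measurable borel" by measurable
            show "AE x in lborel. v (x, s) = v' (x, s)" 
              "AE x in lborel. g' (x, s) = conv J (\<lambda>y. v (y, s)) x - v' (x, s)"
              using elim that by auto
          qed
          then show ?case by (auto simp: indicator_def)
        qed
      qed
      also have "\<dots> = ennreal (C + 1) * (\<integral>\<^sup>+ s. indicator {0<..b} s * \<phi> s \<partial>lborel)"
        by (rule nn_integral_cmult) measurable
      finally show ?thesis .
    qed
    (* Any time beyond b would do: the Volterra lemma speaks about open time intervals. *)
    define T where "T = b + 1"
    have T: "0 \<le> T" using b by (simp add: T_def)
    obtain M where M: "0 \<le> M" "AE t in lebesgue. t \<in> {0..T} \<longrightarrow>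
       (AE x in lebesgue. R \<le> norm x \<longrightarrow> \<bar>v (x, t)\<bar> \<le> M * (1 + norm x) powr \<gamma>)"
      using far[OF T] by auto
    obtain N where N: "\<And>t. t \<in> {0..T} \<Longrightarrow> (LINT x:cball 0 R|lebesgue. \<bar>v (x, t)\<bar>) \<le> N"
      using continuous_L1_bounded[OF cont compact_cball[of 0 R], of T] by blast
    define Q where "Q = 2 * ennreal N + ennreal M * (\<integral>\<^sup>+ x. \<rho> x * ennreal ((1 + norm x) powr \<gamma>) \<partial>lborel)"
    have Q_fin: "Q < \<infinity>" using \<rho>W by (simp add: Q_def ennreal_mult_less_top)
    have \<Phi>_bound: "AE s in lborel. 0 < s \<and> s < T \<longrightarrow> \<Phi> s \<le> Q"
      using M(2)[unfolded AE_completion_iff]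
    proof eventually_elim
      case (elim s)
      show ?case
      proof
        assume s: "0 < s \<and> s < T"
        then have bd: "AE x in lebesgue. R \<le> norm x \<longrightarrow> \<bar>v (x, s)\<bar> \<le> M * (1 + norm x) powr \<gamma>"
          using elim by (simp add: AE_completion_iff)
        let ?B = "cball 0 R :: (real ^ 'n) set"
        have int: "integrable lebesgue (\<lambda>x. indicator ?B x *\<^sub>R \<bar>v (x, s)\<bar>)"
          using set_integrable_abs[OF v_int[of s ?B]] s by (simp add: set_integrable_def)
        note ie = measurable_compose[OF borel_measurable_integrable[OF int] measurable_ennreal]
        have W_leb: "(\<lambda>x :: real ^ 'n. \<rho> x * ennreal ((1 + norm x) powr \<gamma>)) \<in> borel_measurable lebesgue"
          by (rule measurable_completion) measurable
        have "\<Phi> s \<le> (\<integral>\<^sup>+ x. 2 * ennreal (indicator ?B x *\<^sub>R \<bar>v (x, s)\<bar>) + ennreal M * (\<rho> x * ennreal ((1 + norm x) powr \<gamma>)) \<partial>lebesgue)"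
          unfolding \<Phi>_def
        proof (rule nn_integral_mono_AE)
          show "AE x in lebesgue. ennreal \<bar>v (x, s)\<bar> * \<rho> x \<le>
              2 * ennreal (indicator ?B x *\<^sub>R \<bar>v (x, s)\<bar>) + ennreal M * (\<rho> x * ennreal ((1 + norm x) powr \<gamma>))"
            using bd
          proof eventually_elim
            case (elim x)
            show ?case
            proof (cases "x \<in> ?B")
              case True
              have "ennreal \<bar>v (x, s)\<bar> * \<rho> x \<le> ennreal \<bar>v (x, s)\<bar> * 2" by (intro mult_left_mono \<rho>2) simp
              then show ?thesis using True by (simp add: mult.commute add_increasing2)
            next
              case False
              then have "\<bar>v (x, s)\<bar> \<le> M * (1 + norm x) powr \<gamma>" using elim by simp
              then have "ennreal \<bar>v (x, s)\<bar> \<le> ennreal M * ennreal ((1 + norm x) powr \<gamma>)"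
                using M(1) by (simp add: ennreal_mult[symmetric] ennreal_leI)
              then have "ennreal \<bar>v (x, s)\<bar> * \<rho> x \<le> ennreal M * ennreal ((1 + norm x) powr \<gamma>) * \<rho> x"
                by (rule mult_right_mono) simp
              then show ?thesis using False by (simp add: mult_ac)
            qed
          qed
        qed
        also have "\<dots> = (\<integral>\<^sup>+ x. 2 * ennreal (indicator ?B x *\<^sub>R \<bar>v (x, s)\<bar>) \<partial>lebesgue) +
            (\<integral>\<^sup>+ x. ennreal M * (\<rho> x * ennreal ((1 + norm x) powr \<gamma>)) \<partial>lebesgue)"
          by (intro nn_integral_add borel_measurable_times_ennreal borel_measurable_const ie W_leb)
        also have "(\<integral>\<^sup>+ x. 2 * ennreal (indicator ?B x *\<^sub>R \<bar>v (x, s)\<bar>) \<partial>lebesgue) =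
            2 * (\<integral>\<^sup>+ x. ennreal (indicator ?B x *\<^sub>R \<bar>v (x, s)\<bar>) \<partial>lebesgue)"
          by (intro nn_integral_cmult ie)
        also have "(\<integral>\<^sup>+ x. ennreal (indicator ?B x *\<^sub>R \<bar>v (x, s)\<bar>) \<partial>lebesgue) = ennreal (LINT x:?B|lebesgue. \<bar>v (x, s)\<bar>)"
          unfolding set_lebesgue_integral_def by (intro nn_integral_eq_integral int) simp
        also have "(\<integral>\<^sup>+ x. ennreal M * (\<rho> x * ennreal ((1 + norm x) powr \<gamma>)) \<partial>lebesgue) =
            ennreal M * (\<integral>\<^sup>+ x. \<rho> x * ennreal ((1 + norm x) powr \<gamma>) \<partial>lborel)"
          unfolding nn_integral_completion by (rule nn_integral_cmult) measurable
        finally show "\<Phi> s \<le> Q"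
          unfolding Q_def using N[of s] s
          by (elim order_trans) (intro add_mono mult_left_mono ennreal_leI, auto)
      qed
    qed
    have "AE s in lborel. 0 < s \<and> s < T \<longrightarrow> \<phi> s = 0"
    proof (rule volterra_iteration[OF \<phi>_meas])
      show "0 \<le> C + 1" "0 \<le> enn2real Q" using C by auto
      show "AE s in lborel. 0 < s \<and> s < T \<longrightarrow> \<phi> s \<le> ennreal (enn2real Q)"
        using \<Phi>_bound \<Phi>\<phi> by eventually_elim (use Q_fin in auto)
      show "AE s in lborel. 0 < s \<and> s < T \<longrightarrow> \<phi> s \<le> ennreal (C + 1) * (\<integral>\<^sup>+ s'. indicator {0<..s} s' * \<phi> s' \<partial>lborel)"
        using \<Phi>\<phi> by eventually_elim (metis volterra)
    qed
    then have "(\<integral>\<^sup>+ s. indicator {0<..b} s * \<phi> s \<partial>lborel) = (\<integral>\<^sup>+ s. 0 \<partial>(lborel :: real measure))"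
      by (intro nn_integral_cong_AE) (auto elim!: eventually_mono simp: indicator_def T_def)
    then have "\<Phi> b = 0" using volterra[OF b] by simp
    then have "AE x in lebesgue. ennreal \<bar>v (x, b)\<bar> * \<rho> x = 0"
      unfolding \<Phi>_def
      by (subst (asm) nn_integral_0_iff_AE) (use v_meas[of b] b \<rho>_leb in \<open>auto intro!: borel_measurable_times_ennreal\<close>)
    then show ?thesis
    proof eventually_elim
      case (elim x)
      show ?case
      proof
        assume "norm x \<le> r"
        then have "\<rho> x \<noteq> 0" using \<rho>1[of x] by auto
        then show "v (x, b) = 0" using elim by simp
      qed
    qed
  qed
  show ?thesis
  proof (cases "t = 0")
    case False
    with t have "0 < t" by simp
    then have "AE x in lebesgue. \<forall>n. norm x \<le> real n \<longrightarrow> v (x, t) = 0"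
      by (subst AE_all_countable) (intro allI ball)
    then show ?thesis
    proof eventually_elim
      case (elim x)
      then show ?case using real_arch_simple[of "norm x"] by auto
    qed
  qed (use init in simp)
qed

text \<open>
  The factor \<open>\<epsilon>\<close> tends to \<open>0\<close> at infinity, so it is at most \<open>1\<close> in absolute value outside some ball; nothing
  is known about it inside. The bound holds for almost every time only, because \<open>C\<close> is merely essentially bounded.
\<close>

lemma growth_below_far_bound:
  fixes u :: "(real ^ 'n) \<times> real \<Rightarrow> real"
  assumes growth: "growth_below \<gamma> u" and \<gamma>: "0 \<le> \<gamma>" "\<gamma> \<le> \<gamma>'"
  shows "\<exists>R. \<forall>T\<ge>0. \<exists>M\<ge>0. AE t in lebesgue. t \<in> {0..T} \<longrightarrow>
       (AE x in lebesgue. R \<le> norm x \<longrightarrow> \<bar>u (x, t)\<bar> \<le> M * (1 + norm x) powr \<gamma>')"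
proof -
  obtain C \<epsilon> where C: "L_infinity_loc C" and \<epsilon>: "(\<epsilon> \<longlongrightarrow> 0) at_infinity"
    and u: "\<And>t. 0 \<le> t \<Longrightarrow> AE x in lebesgue. \<bar>u (x, t)\<bar> \<le> C t * \<epsilon> x * (1 + norm x powr \<gamma>)"
    using growth by (auto simp: growth_below_def)
  have "\<forall>\<^sub>F x in at_infinity. dist (\<epsilon> x) 0 < 1" using tendstoD[OF \<epsilon>, of 1] by simp
  then obtain R where R: "\<And>x. R \<le> norm x \<Longrightarrow> \<bar>\<epsilon> x\<bar> < 1"
    by (auto simp: eventually_at_infinity dist_real_def)
  have W: "1 + norm x powr \<gamma> \<le> 2 * (1 + norm x) powr \<gamma>'" for x :: "real ^ 'n"
  proof -
    have "norm x powr \<gamma> \<le> (1 + norm x) powr \<gamma>" using \<gamma> by (intro powr_mono2) auto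
    also have "\<dots> \<le> (1 + norm x) powr \<gamma>'" using \<gamma> by (intro powr_mono) auto
    finally have "norm x powr \<gamma> \<le> (1 + norm x) powr \<gamma>'" .
    moreover have "1 \<le> (1 + norm x) powr \<gamma>'" using \<gamma> by (intro ge_one_powr_ge_zero) auto
    ultimately show ?thesis by linarith
  qed
  show ?thesis
  proof (rule exI[of _ R], intro allI impI)
    fix T :: real
    assume "0 \<le> T"
    then obtain M where M: "AE t in lebesgue. t \<in> {0..T} \<longrightarrow> \<bar>C t\<bar> \<le> M"
      using C by (auto simp: L_infinity_loc_def)
    have "AE t in lebesgue. t \<in> {0..T} \<longrightarrow>
       (AE x in lebesgue. R \<le> norm x \<longrightarrow> \<bar>u (x, t)\<bar> \<le> (2 * \<bar>M\<bar>) * (1 + norm x) powr \<gamma>')"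
      using M
    proof eventually_elim
      case (elim t)
      show ?case
      proof
        assume t: "t \<in> {0..T}"
        with elim have Ct: "\<bar>C t\<bar> \<le> \<bar>M\<bar>" by auto
        from t have "AE x in lebesgue. \<bar>u (x, t)\<bar> \<le> C t * \<epsilon> x * (1 + norm x powr \<gamma>)" by (intro u) simp
        then show "AE x in lebesgue. R \<le> norm x \<longrightarrow> \<bar>u (x, t)\<bar> \<le> (2 * \<bar>M\<bar>) * (1 + norm x) powr \<gamma>'"
        proof eventually_elim
          case (elim x)
          show ?case
          proof
            assume "R \<le> norm x"
            then have "\<bar>C t * \<epsilon> x\<bar> \<le> \<bar>M\<bar> * 1"
              unfolding abs_mult using Ct R[of x] by (intro mult_mono) auto
            then have "C t * \<epsilon> x * (1 + norm x powr \<gamma>) \<le> \<bar>M\<bar> * (2 * (1 + norm x) powr \<gamma>')"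
              using W[of x] by (intro mult_mono) auto
            with elim show "\<bar>u (x, t)\<bar> \<le> (2 * \<bar>M\<bar>) * (1 + norm x) powr \<gamma>'" by simp
          qed
        qed
      qed
    qed
    then show "\<exists>M\<ge>0. AE t in lebesgue. t \<in> {0..T} \<longrightarrow>
       (AE x in lebesgue. R \<le> norm x \<longrightarrow> \<bar>u (x, t)\<bar> \<le> M * (1 + norm x) powr \<gamma>')"
      by (intro exI[of _ "2 * \<bar>M\<bar>"]) auto
  qed
qed

lemma continuous_L1_loc_diff:
  fixes u w :: "(real ^ 'n) \<times> real \<Rightarrow> real"
  assumes u: "continuous_L1_loc u" and w: "continuous_L1_loc w"
  shows "continuous_L1_loc (\<lambda>z. w z - u z)"
  unfolding continuous_L1_loc_def
proof (intro conjI allI impI)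
  fix t :: real
  assume t: "0 \<le> t"
  show "(\<lambda>x. w (x, t) - u (x, t)) locally_integrable_on UNIV"
    using u w t by (auto simp: continuous_L1_loc_def locally_integrable_on_def intro: set_integral_diff(1))
next
  fix K :: "(real ^ 'n) set" and t :: real
  assume K: "compact K" and t: "0 \<le> t"
  have i: "set_integrable lebesgue K (\<lambda>x. a (x, s))" if "0 \<le> s" "continuous_L1_loc a" for a s
    using that K by (auto simp: continuous_L1_loc_def locally_integrable_on_def)
  show "((\<lambda>s. LINT x:K|lebesgue. \<bar>(w (x, s) - u (x, s)) - (w (x, t) - u (x, t))\<bar>) \<longlongrightarrow> 0) (at t within {0..})"
  proof (rule tendsto_sandwich[OF _ _ tendsto_const])
    have "((\<lambda>s. (LINT x:K|lebesgue. \<bar>w (x, s) - w (x, t)\<bar>) + (LINT x:K|lebesgue. \<bar>u (x, s) - u (x, t)\<bar>)) \<longlongrightarrow> 0 + 0) (at t within {0..})"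
      using u w K t by (intro tendsto_add) (auto simp: continuous_L1_loc_def)
    then show "((\<lambda>s. (LINT x:K|lebesgue. \<bar>w (x, s) - w (x, t)\<bar>) + (LINT x:K|lebesgue. \<bar>u (x, s) - u (x, t)\<bar>)) \<longlongrightarrow> 0) (at t within {0..})"
      by simp
    show "\<forall>\<^sub>F s in at t within {0..}. 0 \<le> (LINT x:K|lebesgue. \<bar>(w (x, s) - u (x, s)) - (w (x, t) - u (x, t))\<bar>)"
      by (auto simp: set_lebesgue_integral_def)
    have "(LINT x:K|lebesgue. \<bar>(w (x, s) - u (x, s)) - (w (x, t) - u (x, t))\<bar>) \<le>
        (LINT x:K|lebesgue. \<bar>w (x, s) - w (x, t)\<bar>) + (LINT x:K|lebesgue. \<bar>u (x, s) - u (x, t)\<bar>)" if s: "0 \<le> s" for s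
    proof -
      have d: "set_integrable lebesgue K (\<lambda>x. \<bar>a (x, s) - a (x, t)\<bar>)" if "continuous_L1_loc a" for a
        by (intro set_integrable_abs set_integral_diff(1) i s t that)
      have "(LINT x:K|lebesgue. \<bar>(w (x, s) - u (x, s)) - (w (x, t) - u (x, t))\<bar>) \<le>
          (LINT x:K|lebesgue. \<bar>w (x, s) - w (x, t)\<bar> + \<bar>u (x, s) - u (x, t)\<bar>)"
        by (intro set_integral_mono set_integrable_abs set_integral_diff(1) set_integral_add(1) i s t u w) linarith
      also have "\<dots> = (LINT x:K|lebesgue. \<bar>w (x, s) - w (x, t)\<bar>) + (LINT x:K|lebesgue. \<bar>u (x, s) - u (x, t)\<bar>)"
        by (intro set_integral_add(2) d u w)
      finally show ?thesis .
    qed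
    then show "\<forall>\<^sub>F s in at t within {0..}. (LINT x:K|lebesgue. \<bar>(w (x, s) - u (x, s)) - (w (x, t) - u (x, t))\<bar>) \<le>
        (LINT x:K|lebesgue. \<bar>w (x, s) - w (x, t)\<bar>) + (LINT x:K|lebesgue. \<bar>u (x, s) - u (x, t)\<bar>)"
      by (auto simp: eventually_at_filter)
  qed
qed

lemma test_function_integrable:
  fixes f \<phi> :: "(real ^ 'n) \<times> real \<Rightarrow> real"
  assumes f: "f locally_integrable_on spacetime" and \<phi>: "test_function_on spacetime \<phi>"
  shows "integrable lebesgue (\<lambda>z. f z * \<phi> z)"
    and "integrable lebesgue (\<lambda>z. f z * frechet_derivative \<phi> (at z) (0, 1))"
proof -
  define K where "K = closure {z. \<phi> z \<noteq> 0}"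
  have K: "compact K" "K \<subseteq> spacetime" using \<phi> by (auto simp: test_function_on_def K_def)
  have fK: "f absolutely_integrable_on K" using f K by (simp add: locally_integrable_on_def)
  have sm: "k_smooth 1 \<phi>" using \<phi> unfolding test_function_on_def by blast
  have gen: "integrable lebesgue (\<lambda>z. f z * \<psi> z)"
    if c: "continuous_on UNIV \<psi>" and z: "\<And>z. z \<notin> K \<Longrightarrow> \<psi> z = 0" for \<psi> :: "(real ^ 'n) \<times> real \<Rightarrow> real"
  proof -
    have "bounded (\<psi> ` K)"
      by (intro compact_imp_bounded compact_continuous_image K continuous_on_subset[OF c]) auto
    then obtain C where C: "\<And>z. z \<in> K \<Longrightarrow> \<bar>\<psi> z\<bar> \<le> C" unfolding bounded_iff by auto
    have bound: "\<bar>\<psi> z\<bar> \<le> \<bar>C\<bar>" for z using C[of z] z[of z] by (cases "z \<in> K") auto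
    show ?thesis
      by (rule set_integrable_lebesgue_cutoff[OF fK borel_measurable_continuous_onI[OF c] bound z])
  qed
  show "integrable lebesgue (\<lambda>z. f z * \<phi> z)"
    by (rule gen[OF k_smooth_continuous[OF sm] test_function_vanishes[OF \<phi>, folded K_def]])
  show "integrable lebesgue (\<lambda>z. f z * frechet_derivative \<phi> (at z) (0, 1))"
    by (rule gen[OF frechet_time_derivative(2)[OF sm] test_function_time_derivative_vanishes[OF \<phi>, folded K_def]])
qed

lemma weak_time_derivative_diff:
  assumes u: "weak_time_derivative u ut" and w: "weak_time_derivative w wt"
  shows "weak_time_derivative (\<lambda>z. w z - u z) (\<lambda>z. wt z - ut z)"
proof -
  have loc: "u locally_integrable_on spacetime" "ut locally_integrable_on spacetime"
    "w locally_integrable_on spacetime" "wt locally_integrable_on spacetime"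
    using u w by (auto simp: weak_time_derivative_def)
  show ?thesis
    unfolding weak_time_derivative_def
  proof (intro conjI allI impI)
    show "(\<lambda>z. w z - u z) locally_integrable_on spacetime" "(\<lambda>z. wt z - ut z) locally_integrable_on spacetime"
      using loc by (auto simp: locally_integrable_on_def intro: set_integral_diff(1))
    fix \<phi> :: "(real ^ 'a) \<times> real \<Rightarrow> real"
    assume \<phi>: "test_function_on spacetime \<phi>"
    note i = test_function_integrable[OF _ \<phi>]
    show "(LINT z|lebesgue. (w z - u z) * frechet_derivative \<phi> (at z) (0, 1)) = - (LINT z|lebesgue. (wt z - ut z) * \<phi> z)"
      using u w \<phi> i loc
      by (simp add: left_diff_distrib Bochner_Integration.integral_diff weak_time_derivative_def)
  qed
qed

text \<open>
  Both solutions grow more slowly than \<open>(1 + |x|)\<^sup>\<gamma>\<close> for the larger of the two exponents, and this exponent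
  is still below the moment exponent. As the convolutions converge almost everywhere, the difference solves the linear equation with zero
  initial data.
\<close>

lemma strong_solution_unique:
  fixes u w :: "(real ^ 'n) \<times> real \<Rightarrow> real"
  assumes J: "kernel J" and u: "strong_solution J u0 u" "uniqueness_class J u"
    and w: "strong_solution J u0 w" "uniqueness_class J w" and t: "0 \<le> t"
  shows "AE x in lebesgue. w (x, t) = u (x, t)"
proof -
  obtain \<gamma>1 where \<gamma>1: "0 < \<gamma>1" "ereal \<gamma>1 < moment_exponent J" "growth_below \<gamma>1 u"
    using u(2) by (auto simp: uniqueness_class_def)
  obtain \<gamma>2 where \<gamma>2: "0 < \<gamma>2" "ereal \<gamma>2 < moment_exponent J" "growth_below \<gamma>2 w"
    using w(2) by (auto simp: uniqueness_class_def)
  define \<gamma> where "\<gamma> = max \<gamma>1 \<gamma>2"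
  have \<gamma>: "0 \<le> \<gamma>" "ereal \<gamma> < moment_exponent J" "\<gamma>1 \<le> \<gamma>" "\<gamma>2 \<le> \<gamma>"
    using \<gamma>1 \<gamma>2 by (auto simp: \<gamma>_def max_def)
  obtain R1 where R1: "\<And>T. 0 \<le> T \<Longrightarrow> \<exists>M\<ge>0. AE t in lebesgue. t \<in> {0..T} \<longrightarrow>
       (AE x in lebesgue. R1 \<le> norm x \<longrightarrow> \<bar>u (x, t)\<bar> \<le> M * (1 + norm x) powr \<gamma>)"
    using growth_below_far_bound[OF \<gamma>1(3) less_imp_le[OF \<gamma>1(1)] \<gamma>(3)] by blast
  obtain R2 where R2: "\<And>T. 0 \<le> T \<Longrightarrow> \<exists>M\<ge>0. AE t in lebesgue. t \<in> {0..T} \<longrightarrow>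
       (AE x in lebesgue. R2 \<le> norm x \<longrightarrow> \<bar>w (x, t)\<bar> \<le> M * (1 + norm x) powr \<gamma>)"
    using growth_below_far_bound[OF \<gamma>2(3) less_imp_le[OF \<gamma>2(1)] \<gamma>(4)] by blast
  obtain ut where ut: "weak_time_derivative u ut"
    "AE (x, t) in lebesgue. 0 < t \<longrightarrow> ut (x, t) = conv J (\<lambda>y. u (y, t)) x - u (x, t)"
    using u(1) by (auto simp: strong_solution_def)
  obtain wt where wt: "weak_time_derivative w wt"
    "AE (x, t) in lebesgue. 0 < t \<longrightarrow> wt (x, t) = conv J (\<lambda>y. w (y, t)) x - w (x, t)"
    using w(1) by (auto simp: strong_solution_def)
  have cu: "AE (x, t) in lebesgue. 0 < t \<longrightarrow> convolves_at J (\<lambda>y. u (y, t)) x"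
    and cw: "AE (x, t) in lebesgue. 0 < t \<longrightarrow> convolves_at J (\<lambda>y. w (y, t)) x"
    using u(1) w(1) by (auto simp: strong_solution_def)
  have "AE x in lebesgue. w (x, t) - u (x, t) = 0"
  proof (rule zero_initial_data_imp_zero[OF J \<gamma>(1,2), where v = "\<lambda>z. w z - u z" and g = "\<lambda>z. wt z - ut z" and R = "max R1 R2"])
    show "continuous_L1_loc (\<lambda>z. w z - u z)"
      using u(1) w(1) by (intro continuous_L1_loc_diff) (auto simp: strong_solution_def)
    show "weak_time_derivative (\<lambda>z. w z - u z) (\<lambda>z. wt z - ut z)"
      by (rule weak_time_derivative_diff[OF ut(1) wt(1)])
    show "AE z in lebesgue. 0 < snd z \<longrightarrow> wt z - ut z = conv J (\<lambda>y. w (y, snd z) - u (y, snd z)) (fst z) - (w z - u z)"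
      using ut(2) wt(2) cu cw by eventually_elim (auto simp: conv_diff split: prod.splits)
    have "AE x in lebesgue. u (x, 0) = u0 x" "AE x in lebesgue. w (x, 0) = u0 x"
      using u(1) w(1) by (auto simp: strong_solution_def)
    then show "AE x in lebesgue. w (x, 0) - u (x, 0) = 0" by eventually_elim simp
  next
    fix T :: real
    assume T: "0 \<le> T"
    obtain M1 where M1: "0 \<le> M1" "AE t in lebesgue. t \<in> {0..T} \<longrightarrow>
       (AE x in lebesgue. R1 \<le> norm x \<longrightarrow> \<bar>u (x, t)\<bar> \<le> M1 * (1 + norm x) powr \<gamma>)"
      using R1[OF T] by auto
    obtain M2 where M2: "0 \<le> M2" "AE t in lebesgue. t \<in> {0..T} \<longrightarrow>
       (AE x in lebesgue. R2 \<le> norm x \<longrightarrow> \<bar>w (x, t)\<bar> \<le> M2 * (1 + norm x) powr \<gamma>)"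
      using R2[OF T] by auto
    have "AE t in lebesgue. t \<in> {0..T} \<longrightarrow>
       (AE x in lebesgue. max R1 R2 \<le> norm x \<longrightarrow> \<bar>w (x, t) - u (x, t)\<bar> \<le> (M1 + M2) * (1 + norm x) powr \<gamma>)"
      using M1(2) M2(2)
    proof eventually_elim
      case (elim t)
      show ?case
      proof
        assume "t \<in> {0..T}"
        with elim have "AE x in lebesgue. R1 \<le> norm x \<longrightarrow> \<bar>u (x, t)\<bar> \<le> M1 * (1 + norm x) powr \<gamma>"
          "AE x in lebesgue. R2 \<le> norm x \<longrightarrow> \<bar>w (x, t)\<bar> \<le> M2 * (1 + norm x) powr \<gamma>" by auto
        then show "AE x in lebesgue. max R1 R2 \<le> norm x \<longrightarrow> \<bar>w (x, t) - u (x, t)\<bar> \<le> (M1 + M2) * (1 + norm x) powr \<gamma>"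
          by eventually_elim (auto simp: distrib_right)
      qed
    qed
    then show "\<exists>M\<ge>0. AE t in lebesgue. t \<in> {0..T} \<longrightarrow>
       (AE x in lebesgue. max R1 R2 \<le> norm x \<longrightarrow> \<bar>w (x, t) - u (x, t)\<bar> \<le> M * (1 + norm x) powr \<gamma>)"
      using M1(1) M2(1) by (intro exI[of _ "M1 + M2"]) auto
  qed (rule t)
  then show ?thesis by eventually_elim simp
qed

theorem theorem6p1:
  fixes J :: "real ^ 'n \<Rightarrow> real" and p :: nat and c :: "nat \<Rightarrow> real ^ 'n \<Rightarrow> real"
  assumes "kernel J"
    and "0 < moment_exponent J" and "moment_exponent J < \<infinity>"
    and "1 \<le> p" and "ereal (2 * real p) < moment_exponent J"
    and "\<And>x. c 1 x = conv J (\<lambda>y. norm y ^ (2 * p)) x - norm x ^ (2 * p)"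
    and "\<And>k x. 2 \<le> k \<Longrightarrow> k \<le> p \<Longrightarrow>
           c k x = 1 / (real k - 1) * (conv J (c (k - 1)) x - c (k - 1) x)"
  shows "(\<forall>x. convolves_at J (\<lambda>y. norm y ^ (2 * p)) x) \<and>
         (\<forall>k\<in>{1..<p}. \<forall>x. convolves_at J (c k) x) \<and>
         is_unique_solution J (\<lambda>x. norm x ^ (2 * p))
           (\<lambda>(x, t). norm x ^ (2 * p) + (\<Sum>k=1..p. c k x * (t ^ k / real k)))"
proof -
  interpret heat_polynomial J p c "\<lambda>x. norm x ^ (2 * p)"
    by unfold_locales (fact assms pdl_norm_power)+
  show ?thesis
    unfolding is_unique_solution_def u_def[symmetric]
    using u0_convolves c_convolves u_strong_solution u_uniqueness_class
      strong_solution_unique[OF assms(1) u_strong_solution u_uniqueness_class]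
    by auto
qed

end
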